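(* Fix $\alpha>0$, $M_0>0$, $M>0$, $M_1>0$ and $\rho>0$. The minimax risk, under the Frobenius norm, of estimating the covariance matrix $\Sigma=\Sigma_{p\times p}$ from an i.i.d. sample $\mathbf X_1,\dots,\mathbf X_n$ satisfies $$\inf_{\hat\Sigma}\ \sup_{\mathcal P_\alpha}\ \mathbb E\,\frac1p\|\hat\Sigma-\Sigma\|_F^2\ \asymp\ \inf_{\hat\Sigma}\ \sup_{\mathcal P'_\alpha}\ \mathbb E\,\frac1p\|\hat\Sigma-\Sigma\|_F^2\ \asymp\ \min\left\{n^{-\frac{2\alpha+1}{2(\alpha+1)}},\ \frac pn\right\},$$ where the infima are over all estimators $\hat\Sigma=\hat\Sigma(\mathbf X_1,\dots,\mathbf X_n)$ of $\Sigma$, and the suprema are over the common distribution of the $\mathbf X_l$ in $\mathcal P_\alpha=\mathcal P_\alpha(M_0,M,\rho)$ and in $\mathcal P'_\alpha=\mathcal P'_\alpha(M_0,M_1,\rho)$ respectively.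
   Context: $\mathbf X_1,\dots,\mathbf X_n$ are i.i.d. random vectors in $\mathbb R^p$ with covariance matrix $\Sigma=(\sigma_{ij})_{1\le i,j\le p}$. The Frobenius norm of $A=(a_{ij})$ is $\|A\|_F=\sqrt{\sum_{i,j}a_{ij}^2}$. $\lambda_{\max}$ denotes the largest eigenvalue. $\mathcal F_\alpha(M_0,M)$ is the set of $p\times p$ covariance matrices $\Sigma$ such that $\max_j\sum_{i:\,|i-j|>k}|\sigma_{ij}|\le Mk^{-\alpha}$ for all $k$ (positive integers), and $\lambda_{\max}(\Sigma)\le M_0$. $\mathcal G_\alpha(M_0,M_1)$ is the set of $p\times p$ covariance matrices $\Sigma$ such that $|\sigma_{ij}|\le M_1|i-j|^{-(\alpha+1)}$ for all $i\ne j$, and $\lambda_{\max}(\Sigma)\le M_0$. A distribution of $\mathbf X_1$ on $\mathbb R^p$ is sub-Gaussian with parameter $\rho$ if $\mathbb P\{|\mathbf v^T(\mathbf X_1-\mathbb E\mathbf X_1)|>t\}\le e^{-t^2\rho/2}$ for all $t>0$ and all $\|\mathbf v\|_2=1$. $\mathcal P_\alpha(M_0,M,\rho)$ (resp. $\mathcal P'_\alpha(M_0,M_1,\rho)$) is the set of distributions that are sub-Gaussian with parameter $\rho$ and whose covariance matrix lies in $\mathcal F_\alpha(M_0,M)$ (resp. $\mathcal G_\alpha(M_0,M_1)$). $a\asymp b$ means that there are constants $0<c\le C$, independent of $n$ and $p$ (they may depend on $\alpha,M_0,M,M_1,\rho$), with $c\le a/b\le C$. *)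

theory Defs
  imports "HOL-Probability.Probability" "Jordan_Normal_Form.Spectral_Radius"
begin

text \<open>
  Vectors in \<open>\<real>\<^sup>p\<close> are functions on \<open>{..<p}\<close>, as the dimension \<open>p\<close> has to vary within
  a single statement; matrices are carried by \<open>real mat\<close>.
\<close>

abbreviation vec_borel :: "nat \<Rightarrow> (nat \<Rightarrow> real) measure" where
  "vec_borel p \<equiv> Pi\<^sub>M {..<p} (\<lambda>_. borel)"

text \<open>Square integrability of the coordinates makes the covariance integrals below meaningful
  (Bochner integrals of non-integrable functions are 0).\<close>

definition L2_distributions :: "nat \<Rightarrow> (nat \<Rightarrow> real) measure set" where
  "L2_distributions p =
    {P. sets P = sets (vec_borel p) \<and> prob_space P \<and> (\<forall>i<p. integrable P (\<lambda>x. (x i)\<^sup>2))}"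

definition mean_vec :: "(nat \<Rightarrow> real) measure \<Rightarrow> nat \<Rightarrow> real" where
  "mean_vec P i = (\<integral>x. x i \<partial>P)"

definition cov_matrix :: "nat \<Rightarrow> (nat \<Rightarrow> real) measure \<Rightarrow> real mat" where
  "cov_matrix p P =
    mat p p (\<lambda>(i, j). \<integral>x. (x i - mean_vec P i) * (x j - mean_vec P j) \<partial>P)"

definition covariance_matrices :: "nat \<Rightarrow> real mat set" where
  "covariance_matrices p = cov_matrix p ` L2_distributions p"

definition lambda_max :: "real mat \<Rightarrow> real" where
  "lambda_max A = Max (spectrum A)"

definition frobenius_norm :: "real mat \<Rightarrow> real" where
  "frobenius_norm A = sqrt (\<Sum>i<dim_row A. \<Sum>j<dim_col A. (A $$ (i, j))\<^sup>2)"

definition F_class :: "nat \<Rightarrow> real \<Rightarrow> real \<Rightarrow> real \<Rightarrow> real mat set" where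
  "F_class p \<alpha> M0 M = {S \<in> covariance_matrices p.
     (\<forall>k::nat. k \<ge> 1 \<longrightarrow>
        (MAX j\<in>{..<p}. \<Sum>i | i < p \<and> \<bar>int i - int j\<bar> > int k. \<bar>S $$ (i, j)\<bar>)
          \<le> M * real k powr (- \<alpha>)) \<and>
     lambda_max S \<le> M0}"

definition G_class :: "nat \<Rightarrow> real \<Rightarrow> real \<Rightarrow> real \<Rightarrow> real mat set" where
  "G_class p \<alpha> M0 M1 = {S \<in> covariance_matrices p.
     (\<forall>i<p. \<forall>j<p. i \<noteq> j \<longrightarrow>
        \<bar>S $$ (i, j)\<bar> \<le> M1 * \<bar>real i - real j\<bar> powr (- (\<alpha> + 1))) \<and>
     lambda_max S \<le> M0}"

definition sub_gaussian :: "nat \<Rightarrow> real \<Rightarrow> (nat \<Rightarrow> real) measure \<Rightarrow> bool" where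
  "sub_gaussian p \<rho> P \<longleftrightarrow>
    (\<forall>t>0. \<forall>v. L2_set v {..<p} = 1 \<longrightarrow>
       measure P {x \<in> space P. \<bar>\<Sum>i<p. v i * (x i - mean_vec P i)\<bar> > t}
         \<le> exp (- (t\<^sup>2 * \<rho> / 2)))"

definition P_class :: "nat \<Rightarrow> real \<Rightarrow> real \<Rightarrow> real \<Rightarrow> real \<Rightarrow> (nat \<Rightarrow> real) measure set" where
  "P_class p \<alpha> M0 M \<rho> =
    {P \<in> L2_distributions p. sub_gaussian p \<rho> P \<and> cov_matrix p P \<in> F_class p \<alpha> M0 M}"

definition P'_class :: "nat \<Rightarrow> real \<Rightarrow> real \<Rightarrow> real \<Rightarrow> real \<Rightarrow> (nat \<Rightarrow> real) measure set" where
  "P'_class p \<alpha> M0 M1 \<rho> =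
    {P \<in> L2_distributions p. sub_gaussian p \<rho> P \<and> cov_matrix p P \<in> G_class p \<alpha> M0 M1}"

text \<open>An estimator is a measurable function of the sample \<open>X 0, \<dots>, X (n - 1)\<close>; it is not required
  to take symmetric or positive semidefinite values.\<close>

definition estimators :: "nat \<Rightarrow> nat \<Rightarrow> ((nat \<Rightarrow> nat \<Rightarrow> real) \<Rightarrow> real mat) set" where
  "estimators n p = {T.
     (\<forall>X \<in> space (Pi\<^sub>M {..<n} (\<lambda>_. vec_borel p)). T X \<in> carrier_mat p p) \<and>
     (\<forall>i<p. \<forall>j<p. (\<lambda>X. T X $$ (i, j)) \<in> borel_measurable (Pi\<^sub>M {..<n} (\<lambda>_. vec_borel p)))}"

text \<open>The sample is i.i.d. with common distribution \<open>P\<close>, so its law is the \<open>n\<close>-fold product of \<open>P\<close>.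
  Risks are extended nonnegative reals, as the expectation may be infinite.\<close>

definition frobenius_risk ::
  "nat \<Rightarrow> nat \<Rightarrow> (nat \<Rightarrow> real) measure \<Rightarrow> ((nat \<Rightarrow> nat \<Rightarrow> real) \<Rightarrow> real mat) \<Rightarrow> ennreal" where
  "frobenius_risk n p P T =
    (\<integral>\<^sup>+ X. ennreal (1 / real p * (frobenius_norm (T X - cov_matrix p P))\<^sup>2)
      \<partial>(Pi\<^sub>M {..<n} (\<lambda>_. P)))"

definition minimax_risk :: "nat \<Rightarrow> nat \<Rightarrow> (nat \<Rightarrow> real) measure set \<Rightarrow> ennreal" where
  "minimax_risk n p \<P> = (INF T\<in>estimators n p. SUP P\<in>\<P>. frobenius_risk n p P T)"

text \<open>The constants \<open>c\<close> and \<open>C\<close> are uniform in the sample size and the dimension. In \<open>ennreal\<close>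
  the quotients \<open>a / 0\<close> and \<open>a / \<infinity>\<close> only take the values \<open>0\<close> and \<open>\<infinity>\<close>, so that the bounds also force
  both sides to be positive and finite.\<close>

definition same_rate :: "(nat \<Rightarrow> nat \<Rightarrow> ennreal) \<Rightarrow> (nat \<Rightarrow> nat \<Rightarrow> ennreal) \<Rightarrow> bool"
  (infix "\<asymp>" 50) where
  "a \<asymp> b \<longleftrightarrow>
    (\<exists>c C :: real. 0 < c \<and> c \<le> C \<and>
      (\<forall>n\<ge>1. \<forall>p\<ge>1. ennreal c \<le> a n p / b n p \<and> a n p / b n p \<le> ennreal C))"

end

theory Submission
  imports Defs
begin

text \<open>
  Upper bound: covariances are estimated without bias from differences of disjoint pairs of observations,
  kept within distance \<open>k = n\<^bsup>1/(2\<alpha>+2)\<^esup>\<close> of the diagonal, and hard-thresholded at the level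
  \<open>(d/k)\<^bsup>\<alpha>/2\<^esup> n\<^bsup>-1/2\<^esup>\<close> at distance \<open>d > k\<close>.  The band costs \<open>k/n\<close> per row.  Plain banding would not do on the
  larger class, which allows all of the tail mass \<open>M k\<^bsup>-\<alpha>\<^esup>\<close> of a row to sit in a single entry; with thresholding an
  entry \<open>\<sigma>\<close> costs at most \<open>|\<sigma>|\<close> times its threshold, which sums to \<open>k\<^bsup>-\<alpha>\<^esup> n\<^bsup>-1/2\<^esup>\<close>, plus the rare event
  that noise exceeds the threshold.  The polynomially growing thresholds make these events summable
  because the noise has exponential moments.

  Lower bound: Assouad's lemma for laws on \<open>{- r, 0, r}\<^sup>p\<close>.  In each block of \<open>2k\<close> coordinates the first \<open>k\<close> are
  independent signs, and the others are signs whose conditional means are linear in the first ones with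
  coefficients \<open>\<plusminus> \<gamma>\<close>, \<open>\<gamma> = n\<^bsup>-1/2\<^esup>/4\<close>.  These coefficients are, up to scaling, the free entries of the covariance
  matrix.  Flipping one of them changes the density pointwise by a factor \<open>1 + O(\<gamma>)\<close>, so that samples of
  size \<open>n\<close> do not determine it.
\<close>

text \<open>The block size is fixed by one equation. At distance
  \<open>k = n powr (1 / (2 * (\<alpha> + 1)))\<close> the admissible entries
  \<open>k powr (- (\<alpha> + 1))\<close> have just the size of the noise
  \<open>n powr (- 1 / 2)\<close>. Blocks of this width can therefore be filled with undetectable
  entries, each costing \<open>1 / n\<close>, and the same \<open>k\<close> balances
  \<open>k / n\<close> against \<open>k powr (- \<alpha>) * n powr (- 1 / 2)\<close> in the upper
  bound. When \<open>p\<close> is too small for such a block, blocks of about \<open>p / 2\<close>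
  coordinates give \<open>p / n\<close>; for \<open>p \<le> 2\<close>, where no block fits, the
  scale of the variances is perturbed instead.

  Of the four bounds only two need a proof: the lower one for the class with entrywise decay and the
  upper one for the class with summed tails. After a change of the constants \<open>M\<close> and
  \<open>M1\<close> the first class lies in the second, which yields the other two.

  Laws with finitely many atoms are used instead of Gaussian ones because their moments are finite
  sums and because neighbouring densities can then be compared point by point. A pointwise
  comparison multiplies over the sample, so no distance between measures is required.\<close>

section \<open>Two-point and Assouad lower bounds\<close>

text \<open>The two measures are compared on finite rectangles, where Tonelli factors the integral.
  \<open>one\<close> makes \<open>density M f\<close> a probability measure, so that its product is
  determined by these values.\<close>

lemma PiM_density:
  assumes "prob_space M" "finite I" and f[measurable]: "f \<in> borel_measurable M"
    and one: "(\<integral>\<^sup>+x. f x \<partial>M) = 1"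
  shows "Pi\<^sub>M I (\<lambda>_. density M f) = density (Pi\<^sub>M I (\<lambda>_. M)) (\<lambda>X. \<Prod>i\<in>I. f (X i))"
proof -
  interpret M: prob_space M by fact
  interpret D: prob_space "density M f"
    by (rule prob_spaceI) (simp add: emeasure_density one cong: nn_integral_cong)
  interpret PM: product_sigma_finite "\<lambda>_. M" by standard
  interpret PD: product_sigma_finite "\<lambda>_. density M f" by standard
  have "density (Pi\<^sub>M I (\<lambda>_. M)) (\<lambda>X. \<Prod>i\<in>I. f (X i)) = Pi\<^sub>M I (\<lambda>_. density M f)"
  proof (rule PD.PiM_eqI)
    show "finite I" by fact
    show "sets (density (Pi\<^sub>M I (\<lambda>_. M)) (\<lambda>X. \<Prod>i\<in>I. f (X i))) = sets (Pi\<^sub>M I (\<lambda>_. density M f))"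
      by (simp cong: sets_PiM_cong)
    fix A assume "\<And>i. i \<in> I \<Longrightarrow> A i \<in> sets (density M f)"
    then have A[measurable]: "\<And>i. i \<in> I \<Longrightarrow> A i \<in> sets M" by simp
    have "emeasure (density (Pi\<^sub>M I (\<lambda>_. M)) (\<lambda>X. \<Prod>i\<in>I. f (X i))) (Pi\<^sub>E I A)
        = (\<integral>\<^sup>+X. (\<Prod>i\<in>I. f (X i)) * indicator (Pi\<^sub>E I A) X \<partial>Pi\<^sub>M I (\<lambda>_. M))"
      by (rule emeasure_density) (auto intro!: sets_PiM_I_finite \<open>finite I\<close> A)
    also have "\<dots> = (\<integral>\<^sup>+X. (\<Prod>i\<in>I. f (X i) * indicator (A i) (X i)) \<partial>Pi\<^sub>M I (\<lambda>_. M))"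
    proof (rule nn_integral_cong)
      fix X assume "X \<in> space (Pi\<^sub>M I (\<lambda>_. M))"
      then have "indicator (Pi\<^sub>E I A) X = (\<Prod>i\<in>I. indicator (A i) (X i) :: ennreal)"
        using \<open>finite I\<close>
        by (auto simp: indicator_def space_PiM PiE_iff prod_zero_iff split: if_splits)
      then show "(\<Prod>i\<in>I. f (X i)) * indicator (Pi\<^sub>E I A) X = (\<Prod>i\<in>I. f (X i) * indicator (A i) (X i))"
        by (simp add: prod.distrib)
    qed
    also have "\<dots> = (\<Prod>i\<in>I. \<integral>\<^sup>+x. f x * indicator (A i) x \<partial>M)"
      by (rule PM.product_nn_integral_prod) (use \<open>finite I\<close> in auto)
    also have "\<dots> = (\<Prod>i\<in>I. emeasure (density M f) (A i))"
      by (intro prod.cong refl) (simp add: emeasure_density A)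
    finally show "emeasure (density (Pi\<^sub>M I (\<lambda>_. M)) (\<lambda>X. \<Prod>i\<in>I. f (X i))) (Pi\<^sub>E I A)
        = (\<Prod>i\<in>I. emeasure (density M f) (A i))" .
  qed
  then show ?thesis by simp
qed

lemma nn_integral_PiM_density_prod:
  fixes f :: "'a \<Rightarrow> real"
  assumes "prob_space M" "finite I" and f[measurable]: "f \<in> borel_measurable M"
    and nn: "\<And>x. x \<in> space M \<Longrightarrow> 0 \<le> f x" and one: "(\<integral>\<^sup>+x. ennreal (f x) \<partial>M) = 1"
    and g[measurable]: "g \<in> borel_measurable (Pi\<^sub>M I (\<lambda>_. M))"
  shows "(\<integral>\<^sup>+X. g X \<partial>Pi\<^sub>M I (\<lambda>_. density M f))
    = (\<integral>\<^sup>+X. ennreal (\<Prod>i\<in>I. f (X i)) * g X \<partial>Pi\<^sub>M I (\<lambda>_. M))"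
proof -
  have "(\<integral>\<^sup>+X. g X \<partial>Pi\<^sub>M I (\<lambda>_. density M f))
      = (\<integral>\<^sup>+X. g X \<partial>density (Pi\<^sub>M I (\<lambda>_. M)) (\<lambda>X. \<Prod>i\<in>I. ennreal (f (X i))))"
    by (subst PiM_density[OF assms(1,2) _ one]) auto
  also have "\<dots> = (\<integral>\<^sup>+X. (\<Prod>i\<in>I. ennreal (f (X i))) * g X \<partial>Pi\<^sub>M I (\<lambda>_. M))"
    by (rule nn_integral_density) auto
  also have "\<dots> = (\<integral>\<^sup>+X. ennreal (\<Prod>i\<in>I. f (X i)) * g X \<partial>Pi\<^sub>M I (\<lambda>_. M))"
    by (intro nn_integral_cong) (auto simp: prod_ennreal nn space_PiM PiE_iff)
  finally show ?thesis .
qed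

text \<open>At a sample point \<open>A\<close> and \<open>B\<close> are the densities of the two
  sample laws and \<open>C\<close> that of a third law between them. Since \<open>2 * s\<close> is
  at most the sum of the two errors of \<open>t\<close>, AM-GM applied to each error bounds
  \<open>C\<close> by the weighted squared errors plus \<open>s\<^sup>2 * q * (A + B)\<close>; after
  integration these extra terms take away only half of the left side.\<close>

lemma two_point_pointwise:
  fixes t m s q A B C :: real
  assumes "0 \<le> s" "0 \<le> q" "0 \<le> A" "0 \<le> B" "0 \<le> C" and AB: "q * C\<^sup>2 \<le> A * B"
  shows "4 * s\<^sup>2 * q * C \<le> A * (t - (m + s))\<^sup>2 + B * (t - (m - s))\<^sup>2 + s\<^sup>2 * q * A + s\<^sup>2 * q * B"
proof -
  have key: "2 * \<bar>u\<bar> * s * q * C \<le> u\<^sup>2 * A' + s\<^sup>2 * q * B'"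
    if "q * C\<^sup>2 \<le> A' * B'" "0 \<le> A'" "0 \<le> B'" for u A' B'
  proof -
    have "(\<bar>u\<bar> * s * q * C)\<^sup>2 \<le> (u\<^sup>2 * A') * (s\<^sup>2 * q * B')"
    proof -
      have "(\<bar>u\<bar> * s * q * C)\<^sup>2 = (u\<^sup>2 * s\<^sup>2 * q) * (q * C\<^sup>2)"
        by (simp add: power_mult_distrib power2_eq_square)
      also have "\<dots> \<le> (u\<^sup>2 * s\<^sup>2 * q) * (A' * B')"
        using that assms by (intro mult_left_mono) auto
      finally show ?thesis by (simp add: algebra_simps)
    qed
    then have "\<bar>u\<bar> * s * q * C \<le> sqrt ((u\<^sup>2 * A') * (s\<^sup>2 * q * B'))"
      by (rule real_le_rsqrt)
    also have "\<dots> \<le> (u\<^sup>2 * A' + s\<^sup>2 * q * B') / 2"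
      using that assms by (intro arith_geo_mean_sqrt) auto
    finally show ?thesis by simp
  qed
  have "4 * s\<^sup>2 * q * C = 2 * (2 * s) * (s * q * C)" by (simp add: power2_eq_square)
  also have "\<dots> \<le> 2 * (\<bar>t - (m + s)\<bar> + \<bar>t - (m - s)\<bar>) * (s * q * C)"
    using assms by (intro mult_right_mono mult_left_mono) (linarith | simp)+
  also have "\<dots> = 2 * \<bar>t - (m + s)\<bar> * s * q * C + 2 * \<bar>t - (m - s)\<bar> * s * q * C"
    by (simp add: algebra_simps)
  also have "\<dots> \<le> ((t - (m + s))\<^sup>2 * A + s\<^sup>2 * q * B) + ((t - (m - s))\<^sup>2 * B + s\<^sup>2 * q * A)"
    using key[of A B "t - (m + s)"] key[of B A "t - (m - s)"] AB assms
    by (intro add_mono) (auto simp: mult.commute)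
  finally show ?thesis by (simp add: algebra_simps)
qed

text \<open>A form of Le Cam's two-point bound in which the affinity condition \<open>aff\<close> is
  pointwise and hence multiplies over the sample. The intermediate law is the product of the
  midpoint densities \<open>(f x + g x) / 2\<close>, not the midpoint of the two products, since
  only the former factors.\<close>

lemma two_point_lower_bound:
  fixes f g :: "'a \<Rightarrow> real"
  assumes M: "prob_space M" and I: "finite I"
    and f[measurable]: "f \<in> borel_measurable M" and g[measurable]: "g \<in> borel_measurable M"
    and nn: "\<And>x. x \<in> space M \<Longrightarrow> 0 \<le> f x" "\<And>x. x \<in> space M \<Longrightarrow> 0 \<le> g x"
    and one: "(\<integral>\<^sup>+x. ennreal (f x) \<partial>M) = 1" "(\<integral>\<^sup>+x. ennreal (g x) \<partial>M) = 1"
    and aff: "\<And>x. x \<in> space M \<Longrightarrow> q * ((f x + g x) / 2)\<^sup>2 \<le> f x * g x" and q: "0 \<le> q" and s: "0 \<le> s"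
    and T[measurable]: "T \<in> borel_measurable (Pi\<^sub>M I (\<lambda>_. M))"
  shows "ennreal (2 * s\<^sup>2 * q ^ card I) \<le>
    (\<integral>\<^sup>+X. ennreal ((T X - (m + s))\<^sup>2) \<partial>Pi\<^sub>M I (\<lambda>_. density M f)) +
    (\<integral>\<^sup>+X. ennreal ((T X - (m - s))\<^sup>2) \<partial>Pi\<^sub>M I (\<lambda>_. density M g))"
proof -
  interpret M: prob_space M by fact
  let ?PM = "Pi\<^sub>M I (\<lambda>_. M)"
  interpret PM: prob_space ?PM by (intro prob_space_PiM M)
  let ?h = "\<lambda>x. (f x + g x) / 2"
  let ?Q = "q ^ card I"
  have one_h: "(\<integral>\<^sup>+x. ennreal (?h x) \<partial>M) = 1"
  proof -
    have "(\<integral>\<^sup>+x. ennreal (?h x) \<partial>M) = (\<integral>\<^sup>+x. (ennreal (f x) + ennreal (g x)) / 2 \<partial>M)"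
      using nn by (intro nn_integral_cong)
        (simp add: ennreal_plus[symmetric] divide_ennreal[symmetric] del: ennreal_plus)
    also have "\<dots> = ((\<integral>\<^sup>+x. ennreal (f x) \<partial>M) + (\<integral>\<^sup>+x. ennreal (g x) \<partial>M)) / 2"
      by (simp add: nn_integral_divide nn_integral_add)
    also have "\<dots> = 1" unfolding one by simp
    finally show ?thesis .
  qed
  define F where "F u X = (\<Prod>i\<in>I. u (X i))" for u :: "'a \<Rightarrow> real" and X :: "'b \<Rightarrow> 'a"
  have [measurable]: "F u \<in> borel_measurable ?PM" if [measurable]: "u \<in> borel_measurable M" for u
    unfolding F_def[abs_def] by measurable
  have F_nn: "0 \<le> F u X" if "\<And>x. x \<in> space M \<Longrightarrow> 0 \<le> u x" "X \<in> space ?PM" for u X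
    unfolding F_def using that by (auto intro!: prod_nonneg simp: space_PiM PiE_iff)
  have F_one: "(\<integral>\<^sup>+X. ennreal (F u X) \<partial>?PM) = 1"
    if "u \<in> borel_measurable M" "\<And>x. x \<in> space M \<Longrightarrow> 0 \<le> u x" "(\<integral>\<^sup>+x. ennreal (u x) \<partial>M) = 1" for u
  proof -
    have "prob_space (density M u)"
      using that by (intro prob_spaceI) (simp add: emeasure_density cong: nn_integral_cong)
    then have "prob_space (Pi\<^sub>M I (\<lambda>_. density M u))" by (intro prob_space_PiM)
    then have "1 = (\<integral>\<^sup>+X. 1 \<partial>Pi\<^sub>M I (\<lambda>_. density M u))"
      by (simp add: prob_space.emeasure_space_1)
    also have "\<dots> = (\<integral>\<^sup>+X. ennreal (F u X) * 1 \<partial>?PM)"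
      unfolding F_def using that by (intro nn_integral_PiM_density_prod M I) auto
    finally show ?thesis by simp
  qed
  let ?L = "\<lambda>X. ennreal (F f X) * ennreal ((T X - (m + s))\<^sup>2)"
  let ?R = "\<lambda>X. ennreal (F g X) * ennreal ((T X - (m - s))\<^sup>2)"
  let ?c = "s\<^sup>2 * ?Q"
  have c: "0 \<le> ?c" using q by auto
  \<comment> \<open>The product of the midpoint densities integrates to one, so the constant becomes
    an integral to which the pointwise bound applies.\<close>
  have "ennreal (4 * ?c) = (\<integral>\<^sup>+X. ennreal (4 * ?c) * ennreal (F ?h X) \<partial>?PM)"
    using F_one[of ?h] one_h nn by (subst nn_integral_cmult) auto
  also have "\<dots> \<le> (\<integral>\<^sup>+X. ?L X + ?R X + (ennreal ?c * ennreal (F f X) + ennreal ?c * ennreal (F g X)) \<partial>?PM)"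
  proof (rule nn_integral_mono)
    fix X assume X: "X \<in> space ?PM"
    have AB: "?Q * (F ?h X)\<^sup>2 \<le> F f X * F g X"
    proof -
      have "?Q * (F ?h X)\<^sup>2 = (\<Prod>i\<in>I. q * (?h (X i))\<^sup>2)"
        by (simp add: F_def prod_power_distrib prod.distrib)
      also have "\<dots> \<le> (\<Prod>i\<in>I. f (X i) * g (X i))"
        using X aff q nn by (intro prod_mono) (auto simp: space_PiM PiE_iff)
      finally show ?thesis by (simp add: F_def prod.distrib)
    qed
    have nnF: "0 \<le> F f X" "0 \<le> F g X" "0 \<le> F ?h X"
      using X nn by (auto intro!: F_nn)
    have "4 * s\<^sup>2 * ?Q * F ?h X \<le> F f X * (T X - (m + s))\<^sup>2 + F g X * (T X - (m - s))\<^sup>2 + ?c * F f X + ?c * F g X"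
      using AB nnF s q by (intro two_point_pointwise) auto
    then have "ennreal (4 * ?c * F ?h X) \<le> ennreal (F f X * (T X - (m + s))\<^sup>2 + F g X * (T X - (m - s))\<^sup>2 + (?c * F f X + ?c * F g X))"
      by (intro ennreal_leI) (simp add: algebra_simps)
    also have "\<dots> = ?L X + ?R X + (ennreal ?c * ennreal (F f X) + ennreal ?c * ennreal (F g X))"
      using nnF c by (simp add: ennreal_plus[symmetric] ennreal_mult[symmetric] del: ennreal_plus)
    finally show "ennreal (4 * ?c) * ennreal (F ?h X) \<le> ?L X + ?R X + (ennreal ?c * ennreal (F f X) + ennreal ?c * ennreal (F g X))"
      using nnF c by (simp add: ennreal_mult[symmetric])
  qed
  also have "\<dots> = (\<integral>\<^sup>+X. ?L X \<partial>?PM) + (\<integral>\<^sup>+X. ?R X \<partial>?PM) + (ennreal ?c + ennreal ?c)"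
    using F_one[of f] F_one[of g] nn one by (simp add: nn_integral_add nn_integral_cmult)
  finally have le: "ennreal (4 * ?c) \<le> (\<integral>\<^sup>+X. ?L X \<partial>?PM) + (\<integral>\<^sup>+X. ?R X \<partial>?PM) + (ennreal ?c + ennreal ?c)" .
  \<comment> \<open>The finite amount \<open>2 * ?c\<close> is split off on both sides and
    cancelled, in place of a subtraction in \<open>ennreal\<close>.\<close>
  have "ennreal ?c + ennreal ?c = ennreal (2 * ?c)"
    using c ennreal_plus[of ?c ?c] by (simp only: mult_2)
  moreover have "ennreal (4 * ?c) = ennreal (2 * ?c) + ennreal (2 * ?c)"
    using c ennreal_plus[of "2 * ?c" "2 * ?c"] by (simp add: mult.commute)
  ultimately have "ennreal (2 * ?c) + ennreal (2 * ?c) \<le> ennreal (2 * ?c) + ((\<integral>\<^sup>+X. ?L X \<partial>?PM) + (\<integral>\<^sup>+X. ?R X \<partial>?PM))"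
    using le by (simp only: add.commute)
  then have "ennreal (2 * ?c) \<le> (\<integral>\<^sup>+X. ?L X \<partial>?PM) + (\<integral>\<^sup>+X. ?R X \<partial>?PM)"
    by (subst (asm) ennreal_add_left_cancel_le) auto
  also have "(\<integral>\<^sup>+X. ?L X \<partial>?PM) = (\<integral>\<^sup>+X. ennreal ((T X - (m + s))\<^sup>2) \<partial>Pi\<^sub>M I (\<lambda>_. density M f))"
    unfolding F_def using nn one by (intro nn_integral_PiM_density_prod[symmetric] M I) auto
  also have "(\<integral>\<^sup>+X. ?R X \<partial>?PM) = (\<integral>\<^sup>+X. ennreal ((T X - (m - s))\<^sup>2) \<partial>Pi\<^sub>M I (\<lambda>_. density M g))"
    unfolding F_def using nn one by (intro nn_integral_PiM_density_prod[symmetric] M I) auto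
  finally show ?thesis by (simp add: mult.assoc)
qed

text \<open>For fixed \<open>k\<close> the subsets of \<open>K\<close> fall into pairs
  \<open>D\<close>, \<open>insert k D\<close>, so summing \<open>R k\<close> over all
  \<open>2 ^ card K\<close> hypotheses gives at least \<open>2 ^ card K * b\<close>. Summing over
  \<open>k\<close> as well bounds the average total risk from below, hence also the worst
  one.\<close>

lemma assouad_averaging:
  fixes R :: "'k \<Rightarrow> 'k set \<Rightarrow> ennreal"
  assumes K: "finite K"
    and pair: "\<And>k D. k \<in> K \<Longrightarrow> D \<subseteq> K - {k} \<Longrightarrow> ennreal (2 * b) \<le> R k (insert k D) + R k D"
    and bound: "\<And>D. D \<subseteq> K \<Longrightarrow> (\<Sum>k\<in>K. R k D) \<le> U" and b: "0 \<le> b"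
  shows "ennreal (real (card K) * b) \<le> U"
proof (cases "K = {}")
  case False
  let ?N = "2 ^ card K :: real"
  have card_pos: "0 < card K" using False K by (simp add: card_gt_0_iff)
  have each: "ennreal (?N * b) \<le> (\<Sum>D\<in>Pow K. R k D)" if k: "k \<in> K" for k
  proof -
    have [simp]: "finite (K - {k})" using K by simp
    have eq: "Pow K = insert k ` Pow (K - {k}) \<union> Pow (K - {k})"
      using k Pow_insert[of k "K - {k}"] by (auto simp: insert_absorb)
    have inj: "inj_on (insert k) (Pow (K - {k}))"
      by (auto simp: inj_on_def)
    have "(\<Sum>D\<in>Pow K. R k D) = (\<Sum>D\<in>insert k ` Pow (K - {k}). R k D) + (\<Sum>D\<in>Pow (K - {k}). R k D)"
      unfolding eq using K by (intro sum.union_disjoint) auto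
    also have "\<dots> = (\<Sum>D\<in>Pow (K - {k}). R k (insert k D) + R k D)"
      by (simp add: sum.reindex[OF inj] sum.distrib)
    also have "\<dots> \<ge> (\<Sum>D\<in>Pow (K - {k}). ennreal (2 * b))"
      using k by (intro sum_mono pair) auto
    also have "(\<Sum>D\<in>Pow (K - {k}). ennreal (2 * b)) = ennreal (\<Sum>D\<in>Pow (K - {k}). 2 * b)"
      using b by (subst sum_ennreal) auto
    also have "(\<Sum>D\<in>Pow (K - {k}). 2 * b) = ?N * b"
      using K k power_minus_mult[OF card_pos, of "2::real"] by (simp add: card_Pow algebra_simps)
    finally show ?thesis .
  qed
  have "ennreal ?N * ennreal (real (card K) * b) = (\<Sum>k\<in>K. ennreal (?N * b))"
    using b by (simp add: ennreal_mult[symmetric] ennreal_of_nat_eq_real_of_nat algebra_simps)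
  also have "\<dots> \<le> (\<Sum>k\<in>K. \<Sum>D\<in>Pow K. R k D)"
    by (intro sum_mono each)
  also have "\<dots> = (\<Sum>D\<in>Pow K. \<Sum>k\<in>K. R k D)" by (rule sum.swap)
  also have "\<dots> \<le> (\<Sum>D\<in>Pow K. U)" by (intro sum_mono bound) auto
  also have "\<dots> = ennreal ?N * U"
    using K by (simp add: card_Pow ennreal_power[symmetric] flip: ennreal_numeral)
  finally show ?thesis
    by (subst (asm) ennreal_mult_le_mult_iff) auto
qed simp

section \<open>Assouad's lemma for the entries of a covariance matrix\<close>

lemma frobenius_norm_sq:
  "A \<in> carrier_mat p p \<Longrightarrow> (frobenius_norm A)\<^sup>2 = (\<Sum>i<p. \<Sum>j<p. (A $$ (i, j))\<^sup>2)"
  by (auto simp: frobenius_norm_def sum_nonneg)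

lemma frobenius_norm_sq_diff:
  assumes "A \<in> carrier_mat p p" "B \<in> carrier_mat p p"
  shows "(frobenius_norm (A - B))\<^sup>2 = (\<Sum>i<p. \<Sum>j<p. (A $$ (i, j) - B $$ (i, j))\<^sup>2)"
  using assms by (subst frobenius_norm_sq[of _ p]) (auto intro!: sum.cong)

lemma cov_matrix_carrier: "cov_matrix p P \<in> carrier_mat p p"
  by (simp add: cov_matrix_def)

text \<open>\<open>D\<close> records which entries in \<open>K\<close> are raised. Entries outside
  \<open>K\<close> may move with \<open>D\<close> in any way: they contribute only nonnegative
  squares to the loss, and these are dropped. The constructions below may therefore create
  correlations besides the free ones.\<close>

lemma minimax_risk_assouad:
  fixes f :: "(nat \<times> nat) set \<Rightarrow> (nat \<Rightarrow> real) \<Rightarrow> real"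
  assumes \<nu>: "prob_space \<nu>" and sets[measurable_cong]: "sets \<nu> = sets (vec_borel p)"
    and K: "K \<subseteq> {..<p} \<times> {..<p}" and p: "p \<ge> 1"
    and meas: "\<And>D. D \<subseteq> K \<Longrightarrow> f D \<in> borel_measurable \<nu>"
    and nn: "\<And>D x. D \<subseteq> K \<Longrightarrow> x \<in> space \<nu> \<Longrightarrow> 0 \<le> f D x"
    and one: "\<And>D. D \<subseteq> K \<Longrightarrow> (\<integral>\<^sup>+x. ennreal (f D x) \<partial>\<nu>) = 1"
    and mem: "\<And>D. D \<subseteq> K \<Longrightarrow> density \<nu> (f D) \<in> \<P>"
    and cov: "\<And>D i j. D \<subseteq> K \<Longrightarrow> (i, j) \<in> K \<Longrightarrow>
        cov_matrix p (density \<nu> (f D)) $$ (i, j) = (if (i, j) \<in> D then m + s else m - s)"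
    and aff: "\<And>D k x. k \<in> K \<Longrightarrow> D \<subseteq> K - {k} \<Longrightarrow> x \<in> space \<nu> \<Longrightarrow>
        q * ((f (insert k D) x + f D x) / 2)\<^sup>2 \<le> f (insert k D) x * f D x"
    and q: "0 \<le> q" and s: "0 \<le> s"
  shows "ennreal (real (card K) / real p * (s\<^sup>2 * q ^ n)) \<le> minimax_risk n p \<P>"
  unfolding minimax_risk_def
proof (rule INF_greatest)
  fix T assume T: "T \<in> estimators n p"
  define U where "U = (SUP P\<in>\<P>. frobenius_risk n p P T)"
  define Q where "Q D = density \<nu> (\<lambda>x. ennreal (f D x))" for D
  have sets_Q: "sets (Pi\<^sub>M {..<n} (\<lambda>_. Q D)) = sets (Pi\<^sub>M {..<n} (\<lambda>_. vec_borel p))" for D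
    by (rule sets_PiM_cong) (auto simp: Q_def sets)
  have space_Q: "space (Pi\<^sub>M {..<n} (\<lambda>_. Q D)) = space (Pi\<^sub>M {..<n} (\<lambda>_. vec_borel p))" for D
    by (rule sets_eq_imp_space_eq) (rule sets_Q)
  have sets_\<nu>: "sets (Pi\<^sub>M {..<n} (\<lambda>_. \<nu>)) = sets (Pi\<^sub>M {..<n} (\<lambda>_. vec_borel p))"
    by (rule sets_PiM_cong) (auto simp: sets)
  have T_meas: "(\<lambda>X. T X $$ (i, j)) \<in> borel_measurable (Pi\<^sub>M {..<n} (\<lambda>_. vec_borel p))"
    if "i < p" "j < p" for i j
    using T that by (auto simp: estimators_def)
  have finK: "finite K" using K by (rule finite_subset) auto
  define R where "R k D = (\<integral>\<^sup>+X. ennreal (1 / real p) *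
      ennreal ((T X $$ k - cov_matrix p (Q D) $$ k)\<^sup>2) \<partial>Pi\<^sub>M {..<n} (\<lambda>_. Q D))" for k D
  have T_measQ: "(\<lambda>X. T X $$ k) \<in> borel_measurable (Pi\<^sub>M {..<n} (\<lambda>_. Q D))" if "k \<in> K" for k D
    using T_meas[of "fst k" "snd k"] K that
    by (subst measurable_cong_sets[OF sets_Q refl]) auto
  have "ennreal (real (card K) * (1 / real p * (s\<^sup>2 * q ^ n))) \<le> U"
  proof (rule assouad_averaging[OF finK])
    fix D assume D: "D \<subseteq> K"
    have "(\<Sum>k\<in>K. R k D) = (\<integral>\<^sup>+X. (\<Sum>k\<in>K. ennreal (1 / real p) *
        ennreal ((T X $$ k - cov_matrix p (Q D) $$ k)\<^sup>2)) \<partial>Pi\<^sub>M {..<n} (\<lambda>_. Q D))"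
      unfolding R_def
      by (intro nn_integral_sum[symmetric] borel_measurable_times_ennreal borel_measurable_const
          measurable_compose[OF _ measurable_ennreal] borel_measurable_power borel_measurable_diff T_measQ)
    also have "\<dots> \<le> frobenius_risk n p (Q D) T"
      unfolding frobenius_risk_def
    proof (rule nn_integral_mono)
      fix X assume "X \<in> space (Pi\<^sub>M {..<n} (\<lambda>_. Q D))"
      then have TX: "T X \<in> carrier_mat p p"
        using T by (simp add: estimators_def space_Q)
      have "(\<Sum>k\<in>K. (T X $$ k - cov_matrix p (Q D) $$ k)\<^sup>2)
          \<le> (\<Sum>k\<in>{..<p} \<times> {..<p}. (T X $$ k - cov_matrix p (Q D) $$ k)\<^sup>2)"
        using K by (intro sum_mono2) auto
      also have "\<dots> = (frobenius_norm (T X - cov_matrix p (Q D)))\<^sup>2"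
        by (subst frobenius_norm_sq_diff[OF TX cov_matrix_carrier])
          (auto simp: sum.cartesian_product intro!: sum.cong)
      finally have "1 / real p * (\<Sum>k\<in>K. (T X $$ k - cov_matrix p (Q D) $$ k)\<^sup>2)
          \<le> 1 / real p * (frobenius_norm (T X - cov_matrix p (Q D)))\<^sup>2"
        by (intro mult_left_mono) auto
      then show "(\<Sum>k\<in>K. ennreal (1 / real p) * ennreal ((T X $$ k - cov_matrix p (Q D) $$ k)\<^sup>2))
          \<le> ennreal (1 / real p * (frobenius_norm (T X - cov_matrix p (Q D)))\<^sup>2)"
        by (simp add: ennreal_mult[symmetric] sum_distrib_left ennreal_leI)
    qed
    also have "\<dots> \<le> U"
      unfolding U_def Q_def by (intro SUP_upper mem D)
    finally show "(\<Sum>k\<in>K. R k D) \<le> U" .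
  next
    fix k D assume k: "k \<in> K" and D: "D \<subseteq> K - {k}"
    then have D': "D \<subseteq> K" "insert k D \<subseteq> K" "k \<notin> D" by auto
    have kp: "fst k < p" "snd k < p" using K k by auto
    have R_eq: "R k E = ennreal (1 / real p) *
        (\<integral>\<^sup>+X. ennreal ((T X $$ k - (if k \<in> E then m + s else m - s))\<^sup>2) \<partial>Pi\<^sub>M {..<n} (\<lambda>_. Q E))"
      if "E \<subseteq> K" for E
      using cov[OF that, of "fst k" "snd k"] k T_measQ[OF k, of E]
      unfolding R_def by (subst nn_integral_cmult) (auto simp: Q_def)
    have "ennreal (2 * s\<^sup>2 * q ^ card {..<n}) \<le>
      (\<integral>\<^sup>+X. ennreal ((T X $$ k - (m + s))\<^sup>2) \<partial>Pi\<^sub>M {..<n} (\<lambda>_. Q (insert k D))) +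
      (\<integral>\<^sup>+X. ennreal ((T X $$ k - (m - s))\<^sup>2) \<partial>Pi\<^sub>M {..<n} (\<lambda>_. Q D))"
      unfolding Q_def
    proof (rule two_point_lower_bound[OF \<nu>])
      show "(\<lambda>X. T X $$ k) \<in> borel_measurable (Pi\<^sub>M {..<n} (\<lambda>_. \<nu>))"
        using T_meas[of "fst k" "snd k"] kp by (subst measurable_cong_sets[OF sets_\<nu> refl]) auto
    qed (use D' k D meas nn one aff q s in auto)
    then have "ennreal (1 / real p) * ennreal (2 * s\<^sup>2 * q ^ n) \<le>
      ennreal (1 / real p) * ((\<integral>\<^sup>+X. ennreal ((T X $$ k - (m + s))\<^sup>2) \<partial>Pi\<^sub>M {..<n} (\<lambda>_. Q (insert k D))) +
      (\<integral>\<^sup>+X. ennreal ((T X $$ k - (m - s))\<^sup>2) \<partial>Pi\<^sub>M {..<n} (\<lambda>_. Q D)))"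
      by (intro mult_left_mono) auto
    also have "\<dots> = R k (insert k D) + R k D"
      using D' by (simp add: R_eq distrib_left)
    finally show "ennreal (2 * (1 / real p * (s\<^sup>2 * q ^ n))) \<le> R k (insert k D) + R k D"
      using q by (simp add: ennreal_mult[symmetric] mult.assoc)
  qed (use q in auto)
  then show "ennreal (real (card K) / real p * (s\<^sup>2 * q ^ n)) \<le> (SUP P\<in>\<P>. frobenius_risk n p P T)"
    by (simp add: U_def)
qed

section \<open>Averages over random signs\<close>

lemma tanh_le_self: "0 \<le> x \<Longrightarrow> tanh x \<le> (x::real)"
proof -
  assume "0 \<le> x"
  then have "0 - tanh 0 \<le> x - tanh x"
  proof (rule DERIV_nonneg_imp_nondecreasing)
    fix z :: real assume "0 \<le> z" "z \<le> x"
    have "((\<lambda>x. x - tanh x) has_real_derivative (1 - (1 - tanh z ^ 2))) (at z)"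
      by (auto intro!: derivative_eq_intros)
    then show "\<exists>y. ((\<lambda>x. x - tanh x) has_real_derivative y) (at z) \<and> 0 \<le> y"
      by (intro exI conjI) auto
  qed
  then show ?thesis by simp
qed

lemma abs_tanh_le_abs: "\<bar>tanh x\<bar> \<le> \<bar>x::real\<bar>"
  using tanh_le_self[of x] tanh_le_self[of "-x"] by (cases "0 \<le> x") auto

text \<open>The derivative of \<open>ln (cosh x)\<close> is \<open>tanh x\<close>, which is at most
  \<open>x\<close> for nonnegative \<open>x\<close>.\<close>

lemma cosh_le_exp_square: "cosh x \<le> exp (x\<^sup>2 / 2 :: real)"
proof -
  have pos: "cosh x \<le> exp (x\<^sup>2 / 2)" if "0 \<le> x" for x :: real
  proof -
    have "0\<^sup>2 / 2 - ln (cosh 0) \<le> x\<^sup>2 / 2 - ln (cosh x)"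
      using that
    proof (rule DERIV_nonneg_imp_nondecreasing)
      fix z :: real assume z: "0 \<le> z" "z \<le> x"
      have "((\<lambda>x. x\<^sup>2 / 2 - ln (cosh x)) has_real_derivative (z - tanh z)) (at z)"
        by (auto intro!: derivative_eq_intros simp: tanh_def cosh_real_pos field_simps)
      then show "\<exists>y. ((\<lambda>x. x\<^sup>2 / 2 - ln (cosh x)) has_real_derivative y) (at z) \<and> 0 \<le> y"
        using tanh_le_self[of z] z diff_ge_0_iff_ge by blast
    qed
    then have "ln (cosh x) \<le> x\<^sup>2 / 2" by simp
    then show ?thesis by (metis cosh_real_pos exp_le_cancel_iff exp_ln)
  qed
  show ?thesis using pos[of x] pos[of "-x"] by (cases "0 \<le> x") auto
qed

text \<open>The left side is the moment generating function of a sign with mean \<open>h\<close> and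
  equals \<open>cosh v * (1 + h * tanh v)\<close>. Bounding the second factor by an exponential
  makes the exponent linear in \<open>h\<close>, which matters once \<open>h\<close> is itself a
  linear form in other signs.\<close>

lemma biased_sign_mgf_le:
  fixes v h :: real
  assumes "\<bar>h\<bar> \<le> 1"
  shows "(exp v * (1 + h) + exp (- v) * (1 - h)) / 2 \<le> exp (v\<^sup>2 / 2 + h * tanh v)"
proof -
  have "(exp v * (1 + h) + exp (- v) * (1 - h)) / 2 = cosh v * (1 + h * tanh v)"
  proof -
    have "cosh v * tanh v = sinh v" by (simp add: tanh_def)
    then have "cosh v * (1 + h * tanh v) = cosh v + h * sinh v"
      by (metis distrib_left mult.left_commute mult.right_neutral)
    then show ?thesis by (simp add: cosh_def sinh_def field_simps)
  qed
  also have "\<dots> \<le> exp (v\<^sup>2 / 2) * exp (h * tanh v)"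
  proof (rule mult_mono)
    show "1 + h * tanh v \<le> exp (h * tanh v)" by (rule exp_ge_add_one_self)
    have "\<bar>h * tanh v\<bar> \<le> 1 * 1"
      unfolding abs_mult using assms tanh_real_bounds[of v] by (intro mult_mono) (auto simp: abs_le_iff)
    then show "0 \<le> 1 + h * tanh v" by auto
  qed (auto intro: cosh_le_exp_square)
  finally show ?thesis by (simp add: exp_add)
qed

text \<open>A point of the cube is coded by its set of positive coordinates, which turns an average
  over sign vectors into a sum over \<open>Pow J\<close>; coordinates outside \<open>J\<close> are
  then \<open>- 1\<close>.\<close>

definition sign_vec :: "nat set \<Rightarrow> nat \<Rightarrow> real" where
  "sign_vec S i = (if i \<in> S then 1 else - 1)"

definition rad_mean :: "nat set \<Rightarrow> ((nat \<Rightarrow> real) \<Rightarrow> real) \<Rightarrow> real" where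
  "rad_mean J F = (\<Sum>S\<in>Pow J. F (sign_vec S)) / 2 ^ card J"

lemma sign_vec_sq[simp]: "sign_vec S i * sign_vec S i = 1" "(sign_vec S i)\<^sup>2 = 1" "\<bar>sign_vec S i\<bar> = 1"
  by (auto simp: sign_vec_def)

lemma rad_mean_mono:
  assumes "\<And>S. S \<subseteq> J \<Longrightarrow> F (sign_vec S) \<le> G (sign_vec S)"
  shows "rad_mean J F \<le> rad_mean J G"
  unfolding rad_mean_def using assms by (intro divide_right_mono sum_mono) auto

lemma rad_mean_cong:
  assumes "\<And>S. S \<subseteq> J \<Longrightarrow> F (sign_vec S) = G (sign_vec S)"
  shows "rad_mean J F = rad_mean J G"
  unfolding rad_mean_def using assms by (intro arg_cong2[of _ _ _ _ "(/)"] sum.cong) auto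

lemma rad_mean_cmult: "rad_mean J (\<lambda>y. c * F y) = c * rad_mean J F"
  by (simp add: rad_mean_def sum_distrib_left)

lemma rad_mean_add: "rad_mean J (\<lambda>y. F y + G y) = rad_mean J F + rad_mean J G"
  by (simp add: rad_mean_def sum.distrib add_divide_distrib)

lemma rad_mean_sum: "rad_mean J (\<lambda>y. \<Sum>a\<in>A. F a y) = (\<Sum>a\<in>A. rad_mean J (F a))"
  unfolding rad_mean_def by (subst sum.swap) (simp add: sum_divide_distrib)

lemma rad_mean_prod:
  assumes "finite J"
  shows "rad_mean J (\<lambda>y. \<Prod>i\<in>J. g i (y i)) = (\<Prod>i\<in>J. (g i 1 + g i (- 1)) / 2)"
proof -
  have "(\<Prod>i\<in>J. g i 1 + g i (- 1)) = (\<Sum>S\<in>Pow J. (\<Prod>i\<in>S. g i 1) * (\<Prod>i\<in>J - S. g i (- 1)))"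
    by (rule prod_add) fact
  also have "\<dots> = (\<Sum>S\<in>Pow J. \<Prod>i\<in>J. g i (sign_vec S i))"
  proof (rule sum.cong[OF refl])
    fix S assume "S \<in> Pow J"
    then have "(\<Prod>i\<in>J. g i (sign_vec S i)) = (\<Prod>i\<in>J - S. g i (sign_vec S i)) * (\<Prod>i\<in>S. g i (sign_vec S i))"
      using assms by (intro prod.subset_diff) auto
    also have "(\<Prod>i\<in>J - S. g i (sign_vec S i)) = (\<Prod>i\<in>J - S. g i (- 1))"
      by (rule prod.cong) (auto simp: sign_vec_def)
    also have "(\<Prod>i\<in>S. g i (sign_vec S i)) = (\<Prod>i\<in>S. g i 1)"
      by (rule prod.cong) (auto simp: sign_vec_def)
    finally show "(\<Prod>i\<in>S. g i 1) * (\<Prod>i\<in>J - S. g i (- 1)) = (\<Prod>i\<in>J. g i (sign_vec S i))"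
      by simp
  qed
  finally show ?thesis
    by (simp add: rad_mean_def prod_dividef)
qed

lemma rad_mean_const[simp]: "finite J \<Longrightarrow> rad_mean J (\<lambda>_. c) = c"
  by (simp add: rad_mean_def card_Pow)

lemma rad_mean_split:
  assumes "finite A" "finite B" "A \<inter> B = {}"
  shows "rad_mean (A \<union> B) F = rad_mean A (\<lambda>y. rad_mean B (\<lambda>z. F (\<lambda>i. if i \<in> A then y i else z i)))"
proof -
  have bij: "bij_betw (\<lambda>(S, T). S \<union> T) (Pow A \<times> Pow B) (Pow (A \<union> B))"
    using assms by (intro bij_betwI[where g = "\<lambda>S. (S \<inter> A, S \<inter> B)"]) auto
  have "(\<Sum>S\<in>Pow (A \<union> B). F (sign_vec S)) = (\<Sum>(S, T)\<in>Pow A \<times> Pow B. F (sign_vec (S \<union> T)))"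
    using sum.reindex_bij_betw[OF bij, of "\<lambda>S. F (sign_vec S)"] by (simp add: case_prod_unfold)
  also have "\<dots> = (\<Sum>(S, T)\<in>Pow A \<times> Pow B. F (\<lambda>i. if i \<in> A then sign_vec S i else sign_vec T i))"
    using assms by (intro sum.cong refl, auto intro!: arg_cong[of _ _ F] ext simp: sign_vec_def, blast+)
  also have "\<dots> = (\<Sum>S\<in>Pow A. \<Sum>T\<in>Pow B. F (\<lambda>i. if i \<in> A then sign_vec S i else sign_vec T i))"
    by (simp add: sum.cartesian_product)
  finally show ?thesis
    using assms by (simp add: rad_mean_def card_Un_disjoint power_add sum_divide_distrib mult.commute)
qed

text \<open>Given the signs in \<open>A\<close>, those in \<open>B\<close> are independent and fair,
  so each factor is replaced by its average. The sign at \<open>b\<close> is a separate argument of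
  \<open>G\<close> because the rest of \<open>G\<close> may depend on \<open>A\<close> only.\<close>

lemma rad_mean_integrate_out:
  assumes "finite A" "finite B" "A \<inter> B = {}"
    and H: "\<And>y y'. (\<And>i. i \<in> A \<Longrightarrow> y i = y' i) \<Longrightarrow> H y = H y'"
    and G: "\<And>b y y' z. (\<And>i. i \<in> A \<Longrightarrow> y i = y' i) \<Longrightarrow> G b y z = G b y' z"
  shows "rad_mean (A \<union> B) (\<lambda>y. H y * (\<Prod>b\<in>B. G b y (y b)))
    = rad_mean A (\<lambda>y. H y * (\<Prod>b\<in>B. (G b y 1 + G b y (- 1)) / 2))"
proof -
  have "rad_mean B (\<lambda>z. H (\<lambda>i. if i \<in> A then y i else z i) *
        (\<Prod>b\<in>B. G b (\<lambda>i. if i \<in> A then y i else z i) (if b \<in> A then y b else z b)))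
      = H y * (\<Prod>b\<in>B. (G b y 1 + G b y (- 1)) / 2)" for y
  proof -
    have "H (\<lambda>i. if i \<in> A then y i else z i) *
        (\<Prod>b\<in>B. G b (\<lambda>i. if i \<in> A then y i else z i) (if b \<in> A then y b else z b))
      = H y * (\<Prod>b\<in>B. G b y (z b))" for z
      using assms(3) by (intro arg_cong2[of _ _ _ _ "(*)"] prod.cong H G) (auto cong: G intro!: G)
    then show ?thesis
      using rad_mean_prod[OF assms(2), of "\<lambda>b. G b y"] by (simp add: rad_mean_cmult)
  qed
  then show ?thesis
    by (simp add: rad_mean_split[OF assms(1-3)])
qed

lemma rad_mean_coord:
  assumes "finite A" "i \<in> A"
  shows "rad_mean A (\<lambda>y. y i) = 0"
proof -
  have "rad_mean A (\<lambda>y. y i) = rad_mean A (\<lambda>y. \<Prod>k\<in>A. if k = i then y k else 1)"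
    using assms by simp
  also have "\<dots> = (\<Prod>k\<in>A. ((if k = i then 1 else 1) + (if k = i then - 1 else 1)) / 2)"
    by (rule rad_mean_prod) fact
  also have "\<dots> = 0" using assms by (auto simp: prod_zero_iff)
  finally show ?thesis .
qed

text \<open>A product of two coordinates is a product over all of \<open>A\<close> with trivial
  factors elsewhere, so \<open>rad_mean_prod\<close> applies; for \<open>i \<noteq> j\<close> the
  factor at \<open>i\<close> averages to zero.\<close>

lemma rad_mean_coord_mult:
  assumes "finite A" "i \<in> A" "j \<in> A"
  shows "rad_mean A (\<lambda>y. y i * y j) = (if i = j then 1 else 0)"
proof (cases "i = j")
  case True
  have "rad_mean A (\<lambda>y. y i * y j) = rad_mean A (\<lambda>_. 1)"
    using True by (intro rad_mean_cong) simp
  then show ?thesis using assms True by simp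
next
  case False
  have "rad_mean A (\<lambda>y. y i * y j)
      = rad_mean A (\<lambda>y. \<Prod>k\<in>A. (if k = i then y k else 1) * (if k = j then y k else 1))"
    using assms by (simp add: prod.distrib)
  also have "\<dots> = (\<Prod>k\<in>A. ((if k = i then 1 else 1) * (if k = j then 1 else 1)
      + (if k = i then - 1 else 1) * (if k = j then - 1 else 1)) / 2)"
    by (rule rad_mean_prod) fact
  also have "\<dots> = 0" using assms False by (auto simp: prod_zero_iff)
  finally show ?thesis using False by simp
qed

lemma rad_mean_linear_mult:
  assumes "finite A"
  shows "rad_mean A (\<lambda>y. (\<Sum>a\<in>A. u a * y a) * (\<Sum>a\<in>A. v a * y a)) = (\<Sum>a\<in>A. u a * v a)"
proof -
  have "rad_mean A (\<lambda>y. (\<Sum>a\<in>A. u a * y a) * (\<Sum>a\<in>A. v a * y a))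
      = rad_mean A (\<lambda>y. \<Sum>a\<in>A. \<Sum>a'\<in>A. (u a * v a') * (y a * y a'))"
    by (simp add: sum_product mult_ac)
  also have "\<dots> = (\<Sum>a\<in>A. \<Sum>a'\<in>A. (u a * v a') * (if a = a' then 1 else 0))"
    using assms by (simp add: rad_mean_sum rad_mean_cmult rad_mean_coord_mult)
  also have "\<dots> = (\<Sum>a\<in>A. u a * v a)"
    using assms by (simp add: if_distrib[of "\<lambda>x. _ * x"] cong: if_cong)
  finally show ?thesis .
qed

lemma rad_mean_linear:
  assumes "finite A"
  shows "rad_mean A (\<lambda>y. \<Sum>a\<in>A. u a * y a) = 0"
  using assms by (simp add: rad_mean_sum rad_mean_cmult rad_mean_coord)

section \<open>Conditionally biased signs\<close>

text \<open>\<open>w b a\<close> is the coefficient of the independent sign \<open>a\<close> in the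
  conditional mean of the sign \<open>b\<close>. The row bound keeps conditional means between
  \<open>- 1 / 2\<close> and \<open>1 / 2\<close>, so that the density factors stay away from zero.
  Row and column bounds together control the exponential moments and the absolute row sums of the
  covariance.\<close>

locale bipartite_weights =
  fixes p :: nat and B :: "nat set" and w :: "nat \<Rightarrow> nat \<Rightarrow> real"
  assumes B: "B \<subseteq> {..<p}"
    and supp: "\<And>b a. w b a \<noteq> 0 \<Longrightarrow> b \<in> B \<and> a \<in> {..<p} - B"
    and row: "\<And>b. (\<Sum>a<p. \<bar>w b a\<bar>) \<le> 1 / 2"
    and col: "\<And>a. (\<Sum>b<p. \<bar>w b a\<bar>) \<le> 1 / 2"
begin

definition A :: "nat set" where "A = {..<p} - B"

definition h :: "nat \<Rightarrow> (nat \<Rightarrow> real) \<Rightarrow> real" where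
  "h b y = (\<Sum>a\<in>A. w b a * y a)"

text \<open>A density with respect to the uniform law on the cube: given the signs in
  \<open>A\<close>, those in \<open>B\<close> are independent with means
  \<open>h b y\<close>.\<close>

definition dens :: "(nat \<Rightarrow> real) \<Rightarrow> real" where
  "dens y = (\<Prod>b\<in>B. 1 + y b * h b y)"

definition mean :: "((nat \<Rightarrow> real) \<Rightarrow> real) \<Rightarrow> real" where
  "mean F = rad_mean {..<p} (\<lambda>y. F y * dens y)"

lemma fin[simp]: "finite A" "finite B" and AB: "A \<inter> B = {}" "A \<union> B = {..<p}"
  using B finite_subset[OF B] by (auto simp: A_def)

lemma h_cong: "(\<And>i. i \<in> A \<Longrightarrow> y i = y' i) \<Longrightarrow> h b y = h b y'"
  unfolding h_def by (intro sum.cong) auto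

text \<open>Stated for \<open>\<bar>y i\<bar> \<le> 1\<close> instead of signs because densities are
  later evaluated at vectors \<open>sgn (x i)\<close>, whose entries may vanish.\<close>

lemma h_le: assumes "\<And>i. \<bar>y i\<bar> \<le> 1" shows "\<bar>h b y\<bar> \<le> 1 / 2"
proof -
  have "\<bar>h b y\<bar> \<le> (\<Sum>a\<in>A. \<bar>w b a\<bar>)"
    unfolding h_def using assms
    by (intro order_trans[OF sum_abs] sum_mono) (auto simp: abs_mult intro: mult_left_le)
  also have "\<dots> \<le> (\<Sum>a<p. \<bar>w b a\<bar>)"
    by (intro sum_mono2) (auto simp: A_def)
  also have "\<dots> \<le> 1 / 2" by (rule row)
  finally show ?thesis .
qed

lemma factor_ge: assumes "\<And>i. \<bar>y i\<bar> \<le> 1" shows "1 / 2 \<le> 1 + y b * h b y"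
proof -
  have "\<bar>y b * h b y\<bar> \<le> 1 * (1 / 2)"
    unfolding abs_mult using assms h_le[OF assms] by (intro mult_mono) auto
  then show ?thesis by linarith
qed

lemma dens_nonneg: assumes "\<And>i. \<bar>y i\<bar> \<le> 1" shows "0 \<le> dens y"
  unfolding dens_def
proof (rule prod_nonneg)
  fix b show "0 \<le> 1 + y b * h b y" using factor_ge[of y b, OF assms] by simp
qed

lemma mean_mono:
  assumes "\<And>S. S \<subseteq> {..<p} \<Longrightarrow> F (sign_vec S) \<le> G (sign_vec S)"
  shows "mean F \<le> mean G"
  unfolding mean_def using assms by (intro rad_mean_mono mult_right_mono dens_nonneg) auto

lemma mean_cmult: "mean (\<lambda>y. c * F y) = c * mean F"
  by (simp add: mean_def mult.assoc rad_mean_cmult)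

lemma mean_add: "mean (\<lambda>y. F y + G y) = mean F + mean G"
  by (simp add: mean_def distrib_right rad_mean_add)

text \<open>The coefficients of the conditional expectation of coordinate \<open>i\<close> as a
  linear form in the signs of \<open>A\<close>.\<close>

definition lin :: "nat \<Rightarrow> nat \<Rightarrow> real" where
  "lin i a = (if i \<in> B then w i a else if a = i then 1 else 0)"

text \<open>Integrating out the signs in \<open>B\<close> replaces each of them by its conditional
  mean. The total mass and all first and mixed second moments follow; squares need a separate
  argument, as \<open>U\<close> is a set.\<close>

lemma mean_prod:
  assumes U: "U \<subseteq> {..<p}"
  shows "mean (\<lambda>y. \<Prod>i\<in>U. y i) = rad_mean A (\<lambda>y. \<Prod>i\<in>U. \<Sum>a\<in>A. lin i a * y a)"
proof -
  have finU: "finite U" using U finite_subset by auto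
  have split: "(\<Prod>i\<in>U. f i) = (\<Prod>i\<in>U - B. f i) * (\<Prod>b\<in>B. if b \<in> U then f b else 1)" for f :: "nat \<Rightarrow> real"
  proof -
    have "(\<Prod>i\<in>U. f i) = (\<Prod>i\<in>U - U \<inter> B. f i) * (\<Prod>i\<in>U \<inter> B. f i)"
      using finU by (intro prod.subset_diff) auto
    moreover have "U - U \<inter> B = U - B" by auto
    moreover have "(\<Prod>b\<in>B. if b \<in> U then f b else 1) = (\<Prod>i\<in>U \<inter> B. f i)"
      by (subst prod.inter_restrict[OF fin(2), symmetric]) (simp add: Int_commute)
    ultimately show ?thesis by simp
  qed
  have "mean (\<lambda>y. \<Prod>i\<in>U. y i) = rad_mean (A \<union> B)
      (\<lambda>y. (\<Prod>i\<in>U - B. y i) * (\<Prod>b\<in>B. (if b \<in> U then y b else 1) * (1 + y b * h b y)))"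
    unfolding mean_def AB(2) dens_def by (subst split) (simp add: prod.distrib mult.assoc)
  \<comment> \<open>The trivial \<open>if\<close> and the factors \<open>1\<close> and
    \<open>- 1\<close> spell out the two values of the factor in the form in which
    \<open>rad_mean_integrate_out\<close> produces them.\<close>
  also have "\<dots> = rad_mean A (\<lambda>y. (\<Prod>i\<in>U - B. y i) * (\<Prod>b\<in>B.
      ((if b \<in> U then 1 else 1) * (1 + 1 * h b y) + (if b \<in> U then - 1 else 1) * (1 + (- 1) * h b y)) / 2))"
  proof (rule rad_mean_integrate_out[OF fin AB(1)])
    show "(\<Prod>i\<in>U - B. y i) = (\<Prod>i\<in>U - B. y' i)" if "\<And>i. i \<in> A \<Longrightarrow> y i = y' i" for y y' :: "nat \<Rightarrow> real"
      using that U by (intro prod.cong) (auto simp: A_def)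
    show "(if b \<in> U then z else 1) * (1 + z * h b y) = (if b \<in> U then z else 1) * (1 + z * h b y')"
      if "\<And>i. i \<in> A \<Longrightarrow> y i = y' i" for b y y' z
      using h_cong[of y y' b] that by simp
  qed
  also have "\<dots> = rad_mean A (\<lambda>y. (\<Prod>i\<in>U - B. y i) * (\<Prod>b\<in>B. if b \<in> U then h b y else 1))"
    by (intro arg_cong[of _ _ "rad_mean A"] ext arg_cong2[of _ _ _ _ "(*)"] prod.cong refl) (auto simp: field_simps)
  also have "\<dots> = rad_mean A (\<lambda>y. \<Prod>i\<in>U. \<Sum>a\<in>A. lin i a * y a)"
  proof (rule arg_cong[of _ _ "rad_mean A"], rule ext)
    fix y
    have "(\<Prod>i\<in>U - B. y i) = (\<Prod>i\<in>U - B. \<Sum>a\<in>A. lin i a * y a)"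
      using U by (intro prod.cong refl) (auto simp: lin_def A_def if_distrib[of "\<lambda>x. x * _"] cong: if_cong)
    moreover have "(\<Prod>b\<in>B. if b \<in> U then h b y else 1) = (\<Prod>b\<in>B. if b \<in> U then \<Sum>a\<in>A. lin b a * y a else 1)"
      by (intro prod.cong refl) (auto simp: lin_def h_def)
    ultimately show "(\<Prod>i\<in>U - B. y i) * (\<Prod>b\<in>B. if b \<in> U then h b y else 1) = (\<Prod>i\<in>U. \<Sum>a\<in>A. lin i a * y a)"
      by (simp add: split[of "\<lambda>i. \<Sum>a\<in>A. lin i a * y a"])
  qed
  finally show ?thesis .
qed

lemma mean_1: "mean (\<lambda>_. 1) = 1"
  using mean_prod[of "{}"] by simp

lemma mean_const: "mean (\<lambda>_. c) = c"
  using mean_cmult[of c "\<lambda>_. 1"] by (simp add: mean_1)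

lemma mean_coord: "i < p \<Longrightarrow> mean (\<lambda>y. y i) = 0"
  using mean_prod[of "{i}"] by (simp add: rad_mean_linear)

lemma mean_coord_mult:
  assumes "i < p" "j < p" "i \<noteq> j"
  shows "mean (\<lambda>y. y i * y j) = (\<Sum>a\<in>A. lin i a * lin j a)"
  using mean_prod[of "{i, j}"] assms by (simp add: rad_mean_linear_mult)

lemma mean_coord_sq: "mean (\<lambda>y. y i * y i) = 1"
proof -
  have "mean (\<lambda>y. y i * y i) = mean (\<lambda>_. 1)"
    unfolding mean_def by (rule rad_mean_cong) simp
  then show ?thesis by (simp add: mean_1)
qed

text \<open>Integrating out \<open>B\<close> by \<open>biased_sign_mgf_le\<close> leaves the
  exponential of a linear form in the signs of \<open>A\<close>, whose coefficients
  \<open>c a\<close> mix \<open>v a\<close> with weighted \<open>tanh (v b)\<close>; its average is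
  a product of \<open>cosh (c a)\<close>. A Schur type bound limits the price of the dependence to a
  quarter of the squares over \<open>B\<close>, which together with their own half stays below
  one.\<close>

lemma mean_exp_linear:
  "mean (\<lambda>y. exp (\<Sum>i<p. v i * y i)) \<le> exp (\<Sum>i<p. (v i)\<^sup>2)"
proof -
  define c where "c a = v a + (\<Sum>b\<in>B. tanh (v b) * w b a)" for a
  have c_sq: "(\<Sum>a\<in>A. (c a)\<^sup>2 / 2) \<le> (\<Sum>a\<in>A. (v a)\<^sup>2) + (\<Sum>b\<in>B. (v b)\<^sup>2) / 4"
  proof -
    \<comment> \<open>\<open>\<bar>w b a\<bar>\<close> is split evenly between the two factors of
      Cauchy-Schwarz. The column bound is then used for the first factor, and the row bound after
      summing the second one over \<open>a\<close>.\<close>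
    have factor: "y * x = (sqrt \<bar>x\<bar> * sgn x) * (sqrt \<bar>x\<bar> * y)" for x y :: real
    proof -
      have "(sqrt \<bar>x\<bar> * sgn x) * (sqrt \<bar>x\<bar> * y) = (sqrt \<bar>x\<bar> * sqrt \<bar>x\<bar>) * sgn x * y"
        by (simp only: mult_ac)
      also have "\<dots> = \<bar>x\<bar> * sgn x * y"
        by (simp only: real_sqrt_mult_self abs_idempotent)
      also have "\<dots> = y * x"
        by (simp only: abs_mult_sgn mult.commute)
      finally show ?thesis ..
    qed
    have half_sq: "(x + y)\<^sup>2 / 2 \<le> x\<^sup>2 + y\<^sup>2" for x y :: real
      using zero_le_power2[of "x - y"] by (simp add: power2_eq_square algebra_simps)
    have one: "(c a)\<^sup>2 / 2 \<le> (v a)\<^sup>2 + (\<Sum>b\<in>B. \<bar>w b a\<bar> * (v b)\<^sup>2) / 2" for a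
    proof -
      have "(\<Sum>b\<in>B. tanh (v b) * w b a)\<^sup>2 = (\<Sum>b\<in>B. (sqrt \<bar>w b a\<bar> * sgn (w b a)) * (sqrt \<bar>w b a\<bar> * tanh (v b)))\<^sup>2"
        by (intro arg_cong[of _ _ "\<lambda>x. x\<^sup>2"] sum.cong refl factor)
      also have "\<dots> \<le> (\<Sum>b\<in>B. (sqrt \<bar>w b a\<bar> * sgn (w b a))\<^sup>2) * (\<Sum>b\<in>B. (sqrt \<bar>w b a\<bar> * tanh (v b))\<^sup>2)"
        by (rule Cauchy_Schwarz_ineq_sum)
      also have "(\<Sum>b\<in>B. (sqrt \<bar>w b a\<bar> * sgn (w b a))\<^sup>2) = (\<Sum>b\<in>B. \<bar>w b a\<bar>)"
        by (intro sum.cong refl) (auto simp: power_mult_distrib sgn_if)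
      also have "(\<Sum>b\<in>B. (sqrt \<bar>w b a\<bar> * tanh (v b))\<^sup>2) = (\<Sum>b\<in>B. \<bar>w b a\<bar> * (tanh (v b))\<^sup>2)"
        by (intro sum.cong refl) (auto simp: power_mult_distrib)
      also have "(\<Sum>b\<in>B. \<bar>w b a\<bar>) * (\<Sum>b\<in>B. \<bar>w b a\<bar> * (tanh (v b))\<^sup>2) \<le> 1 / 2 * (\<Sum>b\<in>B. \<bar>w b a\<bar> * (v b)\<^sup>2)"
      proof (rule mult_mono)
        have "(\<Sum>b\<in>B. \<bar>w b a\<bar>) \<le> (\<Sum>b<p. \<bar>w b a\<bar>)" using B by (intro sum_mono2) auto
        then show "(\<Sum>b\<in>B. \<bar>w b a\<bar>) \<le> 1 / 2" using col[of a] by simp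
        show "(\<Sum>b\<in>B. \<bar>w b a\<bar> * (tanh (v b))\<^sup>2) \<le> (\<Sum>b\<in>B. \<bar>w b a\<bar> * (v b)\<^sup>2)"
          using abs_tanh_le_abs by (intro sum_mono mult_left_mono) (auto simp: abs_le_square_iff[symmetric])
      qed (auto intro!: sum_nonneg)
      finally have "(\<Sum>b\<in>B. tanh (v b) * w b a)\<^sup>2 \<le> 1 / 2 * (\<Sum>b\<in>B. \<bar>w b a\<bar> * (v b)\<^sup>2)" .
      moreover have "(c a)\<^sup>2 / 2 \<le> (v a)\<^sup>2 + (\<Sum>b\<in>B. tanh (v b) * w b a)\<^sup>2"
        unfolding c_def by (rule half_sq)
      ultimately show ?thesis by linarith
    qed
    have "(\<Sum>a\<in>A. (c a)\<^sup>2 / 2) \<le> (\<Sum>a\<in>A. (v a)\<^sup>2 + (\<Sum>b\<in>B. \<bar>w b a\<bar> * (v b)\<^sup>2) / 2)"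
      by (intro sum_mono one)
    also have "\<dots> = (\<Sum>a\<in>A. (v a)\<^sup>2) + (\<Sum>b\<in>B. (\<Sum>a\<in>A. \<bar>w b a\<bar>) * (v b)\<^sup>2) / 2"
      by (simp add: sum.distrib sum_divide_distrib[symmetric] sum_distrib_right) (rule sum.swap)
    also have "\<dots> \<le> (\<Sum>a\<in>A. (v a)\<^sup>2) + (\<Sum>b\<in>B. 1 / 2 * (v b)\<^sup>2) / 2"
    proof -
      have "(\<Sum>a\<in>A. \<bar>w b a\<bar>) \<le> 1 / 2" for b
      proof -
        have "(\<Sum>a\<in>A. \<bar>w b a\<bar>) \<le> (\<Sum>a<p. \<bar>w b a\<bar>)" by (intro sum_mono2) (auto simp: A_def)
        then show ?thesis using row[of b] by simp
      qed
      then show ?thesis by (intro add_mono divide_right_mono sum_mono mult_right_mono) auto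
    qed
    also have "\<dots> = (\<Sum>a\<in>A. (v a)\<^sup>2) + (\<Sum>b\<in>B. (v b)\<^sup>2) / 4"
      by (simp add: sum_divide_distrib)
    finally show ?thesis .
  qed
  have sum_AB: "(\<Sum>i<p. f i) = (\<Sum>a\<in>A. f a) + (\<Sum>b\<in>B. f b)" for f :: "nat \<Rightarrow> real"
    using sum.union_disjoint[OF fin AB(1), of f] by (simp add: AB(2))
  have "mean (\<lambda>y. exp (\<Sum>i<p. v i * y i)) = rad_mean (A \<union> B)
      (\<lambda>y. exp (\<Sum>a\<in>A. v a * y a) * (\<Prod>b\<in>B. exp (v b * y b) * (1 + y b * h b y)))"
    unfolding mean_def AB(2) dens_def by (simp add: sum_AB exp_add exp_sum prod.distrib mult.assoc)
  also have "\<dots> = rad_mean A (\<lambda>y. exp (\<Sum>a\<in>A. v a * y a) * (\<Prod>b\<in>B.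
      (exp (v b * 1) * (1 + 1 * h b y) + exp (v b * (- 1)) * (1 + (- 1) * h b y)) / 2))"
  proof (rule rad_mean_integrate_out[OF fin AB(1)])
    show "exp (\<Sum>a\<in>A. v a * y a) = exp (\<Sum>a\<in>A. v a * y' a)" if "\<And>i. i \<in> A \<Longrightarrow> y i = y' i" for y y' :: "nat \<Rightarrow> real"
      using that by (intro arg_cong[of _ _ exp] sum.cong) auto
    show "exp (v b * z) * (1 + z * h b y) = exp (v b * z) * (1 + z * h b y')"
      if "\<And>i. i \<in> A \<Longrightarrow> y i = y' i" for b y y' z
      using h_cong[of y y' b] that by simp
  qed
  also have "\<dots> \<le> rad_mean A (\<lambda>y. exp (\<Sum>b\<in>B. (v b)\<^sup>2 / 2) * (\<Prod>a\<in>A. exp (c a * y a)))"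
  proof (rule rad_mean_mono)
    fix S assume "S \<subseteq> A"
    let ?y = "sign_vec S"
    let ?G = "\<lambda>b. (exp (v b * 1) * (1 + 1 * h b ?y) + exp (v b * (- 1)) * (1 + (- 1) * h b ?y)) / 2"
    let ?v = "exp (\<Sum>a\<in>A. v a * ?y a)"
    let ?B = "exp (\<Sum>b\<in>B. (v b)\<^sup>2 / 2)"
    have "?v * (\<Prod>b\<in>B. ?G b)
        \<le> ?v * (\<Prod>b\<in>B. exp ((v b)\<^sup>2 / 2 + h b ?y * tanh (v b)))"
    proof (intro mult_left_mono prod_mono conjI)
      fix b
      have *: "\<bar>h b ?y\<bar> \<le> 1" using h_le[of ?y b] by simp
      show "?G b \<le> exp ((v b)\<^sup>2 / 2 + h b ?y * tanh (v b))"
        using biased_sign_mgf_le[OF *, of "v b"] by simp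
      show "0 \<le> ?G b"
      proof -
        have "0 \<le> 1 + 1 * h b ?y" "0 \<le> 1 + (- 1) * h b ?y" using * by auto
        then have "0 \<le> exp (v b * 1) * (1 + 1 * h b ?y)" "0 \<le> exp (v b * (- 1)) * (1 + (- 1) * h b ?y)"
          by (simp_all del: mult_1 mult_minus1)
        then show ?thesis
          by - (rule divide_nonneg_pos[OF add_nonneg_nonneg], assumption+, simp)
      qed
    qed auto
    also have "\<dots> = ?B * exp ((\<Sum>a\<in>A. v a * ?y a) + (\<Sum>b\<in>B. h b ?y * tanh (v b)))"
      by (simp add: exp_sum[symmetric] sum.distrib exp_add[symmetric] add_ac)
    also have "(\<Sum>a\<in>A. v a * ?y a) + (\<Sum>b\<in>B. h b ?y * tanh (v b)) = (\<Sum>a\<in>A. c a * ?y a)"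
    proof -
      have "(\<Sum>b\<in>B. h b ?y * tanh (v b)) = (\<Sum>a\<in>A. (\<Sum>b\<in>B. tanh (v b) * w b a) * ?y a)"
        unfolding h_def sum_distrib_right by (subst sum.swap) (simp add: mult_ac)
      then show ?thesis by (simp add: c_def distrib_right sum.distrib)
    qed
    finally show "?v * (\<Prod>b\<in>B. ?G b)
        \<le> ?B * (\<Prod>a\<in>A. exp (c a * ?y a))"
      by (simp add: exp_sum)
  qed
  also have "\<dots> = exp (\<Sum>b\<in>B. (v b)\<^sup>2 / 2) * (\<Prod>a\<in>A. (exp (c a * 1) + exp (c a * - 1)) / 2)"
    by (simp only: rad_mean_cmult rad_mean_prod[OF fin(1), of "\<lambda>a z. exp (c a * z)"])
  also have "\<dots> = exp (\<Sum>b\<in>B. (v b)\<^sup>2 / 2) * (\<Prod>a\<in>A. cosh (c a))"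
    by (simp add: cosh_def)
  also have "\<dots> \<le> exp (\<Sum>b\<in>B. (v b)\<^sup>2 / 2) * (\<Prod>a\<in>A. exp ((c a)\<^sup>2 / 2))"
    by (intro mult_left_mono prod_mono) (auto intro: cosh_le_exp_square)
  also have "\<dots> = exp ((\<Sum>b\<in>B. (v b)\<^sup>2 / 2) + (\<Sum>a\<in>A. (c a)\<^sup>2 / 2))"
    by (simp add: exp_add exp_sum)
  also have "\<dots> \<le> exp (\<Sum>i<p. (v i)\<^sup>2)"
  proof -
    have "(\<Sum>b\<in>B. (v b)\<^sup>2 / 2) + (\<Sum>b\<in>B. (v b)\<^sup>2) / 4 \<le> (\<Sum>b\<in>B. (v b)\<^sup>2)"
      by (simp add: sum_divide_distrib[symmetric] sum_nonneg)
    then show ?thesis using c_sq by (simp add: sum_AB)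
  qed
  finally show ?thesis .
qed

lemma mean_tail:
  assumes v: "(\<Sum>i<p. (v i)\<^sup>2) = 1" and t: "0 < t"
  shows "mean (\<lambda>y. if t < \<bar>\<Sum>i<p. v i * y i\<bar> then 1 else 0) \<le> 2 * exp (- (t\<^sup>2 / 4))"
proof -
  let ?x = "\<lambda>y. \<Sum>i<p. v i * y i"
  \<comment> \<open>The minimiser of the Chernoff exponent \<open>l\<^sup>2 - l * t\<close>.\<close>
  let ?l = "t / 2"
  have sq: "(\<Sum>i<p. (?l * v i)\<^sup>2) = ?l\<^sup>2" "(\<Sum>i<p. (- ?l * v i)\<^sup>2) = ?l\<^sup>2"
    using v by (simp_all add: power_mult_distrib power_divide sum_distrib_left[symmetric] sum_divide_distrib[symmetric])
  have "mean (\<lambda>y. if t < \<bar>?x y\<bar> then 1 else 0)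
      \<le> mean (\<lambda>y. exp (- (?l * t)) * (exp (\<Sum>i<p. (?l * v i) * y i) + exp (\<Sum>i<p. (- ?l * v i) * y i)))"
  proof (rule mean_mono)
    fix S
    let ?X = "?x (sign_vec S)"
    have sums: "(\<Sum>i<p. (?l * v i) * sign_vec S i) = ?l * ?X" "(\<Sum>i<p. (- ?l * v i) * sign_vec S i) = - ?l * ?X"
      by (simp_all add: sum_distrib_left mult.assoc sum_negf)
    have eq: "exp (- (?l * t)) * (exp (?l * ?X) + exp (- ?l * ?X)) = exp (?l * (?X - t)) + exp (?l * (- ?X - t))"
      by (simp add: distrib_left exp_add[symmetric] algebra_simps)
    have "(if t < \<bar>?X\<bar> then 1 else 0) \<le> exp (?l * (?X - t)) + exp (?l * (- ?X - t))"
    proof (cases "t < ?X")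
      case True
      then have "1 \<le> exp (?l * (?X - t))" using t by simp
      moreover have "0 \<le> exp (?l * (- ?X - t))" by simp
      ultimately have "1 \<le> exp (?l * (?X - t)) + exp (?l * (- ?X - t))" by linarith
      then show ?thesis by simp
    next
      case False
      have "1 \<le> exp (?l * (- ?X - t))" if "t < \<bar>?X\<bar>"
        using False that t by simp
      moreover have "0 \<le> exp (?l * (- ?X - t))" "0 \<le> exp (?l * (?X - t))" by simp_all
      ultimately have "t < \<bar>?X\<bar> \<Longrightarrow> 1 \<le> exp (?l * (?X - t)) + exp (?l * (- ?X - t))" by linarith
      then show ?thesis by simp
    qed
    then show "(if t < \<bar>?X\<bar> then 1 else 0)
      \<le> exp (- (?l * t)) * (exp (\<Sum>i<p. (?l * v i) * sign_vec S i) + exp (\<Sum>i<p. (- ?l * v i) * sign_vec S i))"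
      unfolding sums eq .
  qed
  also have "\<dots> \<le> exp (- (?l * t)) * (exp (?l\<^sup>2) + exp (?l\<^sup>2))"
    unfolding mean_cmult mean_add
    using mean_exp_linear[of "\<lambda>i. ?l * v i"] mean_exp_linear[of "\<lambda>i. - ?l * v i"]
    unfolding sq by (intro mult_left_mono add_mono) auto
  also have "\<dots> = 2 * exp (- (t\<^sup>2 / 4))"
    by (simp add: distrib_left exp_add[symmetric] power2_eq_square field_simps)
  finally show ?thesis .
qed

end

section \<open>The least favourable laws\<close>

text \<open>The restriction makes the point extensional, as elements of
  \<open>space (vec_borel p)\<close> have to be.\<close>

definition scale_vec :: "nat \<Rightarrow> real \<Rightarrow> (nat \<Rightarrow> real) \<Rightarrow> nat \<Rightarrow> real" where
  "scale_vec p r y = (\<lambda>i\<in>{..<p}. r * y i)"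

text \<open>A quarter of the mass is spread uniformly over \<open>{- r, r}\<^sup>p\<close>, the rest sits at the origin.  The atom is
  what makes the sub-Gaussian bound, which has no constant in front of the exponential, hold for small \<open>t\<close>.\<close>

definition lazy_cube :: "nat \<Rightarrow> real \<Rightarrow> (nat \<Rightarrow> real) measure" where
  "lazy_cube p r = distr (measure_pmf (pmf_of_set ({..<4::nat} \<times> Pow {..<p}))) (vec_borel p)
     (\<lambda>(k, S). if k = 0 then scale_vec p r (sign_vec S) else scale_vec p r (\<lambda>_. 0))"

lemma scale_vec_space[simp]: "scale_vec p r y \<in> space (vec_borel p)"
  by (simp add: scale_vec_def space_PiM)

lemma scale_vec_nth[simp]: "i < p \<Longrightarrow> scale_vec p r y i = r * y i"
  by (simp add: scale_vec_def)

lemma sets_lazy_cube[simp, measurable_cong]: "sets (lazy_cube p r) = sets (vec_borel p)"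
  by (simp add: lazy_cube_def)

lemma prob_space_lazy_cube: "prob_space (lazy_cube p r)"
  unfolding lazy_cube_def
  by (intro prob_space.prob_space_distr prob_space_measure_pmf) (auto split: if_splits)

text \<open>The law has finitely many atoms, so integrals are finite sums and every measurable
  function is integrable.\<close>

lemma lazy_cube_integral:
  assumes F: "F \<in> borel_measurable (vec_borel p)"
  shows "(\<integral>x. F x \<partial>lazy_cube p r)
      = rad_mean {..<p} (\<lambda>y. F (scale_vec p r y)) / 4 + 3 / 4 * (F (scale_vec p r (\<lambda>_. 0)) :: real)"
    and "integrable (lazy_cube p r) F"
proof -
  let ?X = "{..<4::nat} \<times> Pow {..<p}"
  let ?\<phi> = "\<lambda>(k, S). if k = 0 then scale_vec p r (sign_vec S) else scale_vec p r (\<lambda>_. 0)"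
  have fin: "finite ?X" "?X \<noteq> {}" by (auto simp: lessThan_eq_iff lessThan_empty_iff)
  have meas: "?\<phi> \<in> measure_pmf (pmf_of_set ?X) \<rightarrow>\<^sub>M vec_borel p"
    by (auto split: if_splits)
  have "(\<integral>x. F x \<partial>lazy_cube p r) = measure_pmf.expectation (pmf_of_set ?X) (\<lambda>z. F (?\<phi> z))"
    unfolding lazy_cube_def by (rule integral_distr[OF meas F])
  also have "\<dots> = (\<Sum>z\<in>?X. F (?\<phi> z)) / card ?X"
    by (rule integral_pmf_of_set[OF fin(2,1)])
  also have "(\<Sum>z\<in>?X. F (?\<phi> z)) = (\<Sum>k<4::nat. \<Sum>S\<in>Pow {..<p}. F (?\<phi> (k, S)))"
    by (simp only: sum.cartesian_product) (auto intro!: sum.cong)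
  also have "\<dots> = (\<Sum>S\<in>Pow {..<p}. F (scale_vec p r (sign_vec S))) + 3 * (2 ^ p * F (scale_vec p r (\<lambda>_. 0)))"
    by (simp add: eval_nat_numeral lessThan_Suc card_Pow)
  finally show "(\<integral>x. F x \<partial>lazy_cube p r)
      = rad_mean {..<p} (\<lambda>y. F (scale_vec p r y)) / 4 + 3 / 4 * (F (scale_vec p r (\<lambda>_. 0)) :: real)"
    by (simp add: rad_mean_def card_Pow card_cartesian_product field_simps)
  show "integrable (lazy_cube p r) F"
    unfolding lazy_cube_def
    unfolding integrable_distr_eq[OF meas F]
    by (rule integrable_measure_pmf_finite) (use fin in \<open>simp add: set_pmf_of_set\<close>)
qed

context bipartite_weights
begin

text \<open>A density with respect to \<open>lazy_cube\<close>. The parameter \<open>\<tau>\<close>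
  changes the mass off the origin from \<open>1 / 4\<close> to \<open>(1 + \<tau>) / 4\<close> and
  multiplies the atom \<open>3 / 4\<close> by \<open>1 - \<tau> / 3\<close>, so the total stays one.
  For \<open>0 < r\<close> and \<open>1 \<le> p\<close>, coordinate 0 tells the two parts of the
  support apart: either all of the first \<open>p\<close> coordinates vanish or none does.\<close>

definition tilt :: "real \<Rightarrow> (nat \<Rightarrow> real) \<Rightarrow> real" where
  "tilt \<tau> x = (if x 0 = 0 then 1 - \<tau> / 3 else (1 + \<tau>) * dens (\<lambda>i. sgn (x i)))"

definition law :: "real \<Rightarrow> real \<Rightarrow> (nat \<Rightarrow> real) measure" where
  "law r \<tau> = density (lazy_cube p r) (\<lambda>x. ennreal (tilt \<tau> x))"

lemma tilt_nonneg: "\<bar>\<tau>\<bar> \<le> 1 \<Longrightarrow> 0 \<le> tilt \<tau> x"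
  by (auto simp: tilt_def abs_sgn_eq intro!: mult_nonneg_nonneg dens_nonneg)

lemma tilt_measurable[measurable]: 
  assumes p: "1 \<le> p" shows "tilt \<tau> \<in> borel_measurable (vec_borel p)"
proof -
  have [measurable]: "(\<lambda>x. x i) \<in> borel_measurable (vec_borel p)" if "i < p" for i
    using that by (intro measurable_component_singleton) auto
  have "(\<lambda>x. dens (\<lambda>i. sgn (x i))) \<in> borel_measurable (vec_borel p)"
    unfolding dens_def h_def using B
    by (intro borel_measurable_prod borel_measurable_add borel_measurable_times borel_measurable_sum
        borel_measurable_const borel_measurable_sgn measurable_component_singleton) (auto simp: A_def)
  then show ?thesis
    unfolding tilt_def[abs_def] using p by (intro measurable_If borel_measurable_times borel_measurable_const pred_eq_const1[where N = borel] measurable_component_singleton) auto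
qed

lemma law_integral_aux:
  assumes p: "1 \<le> p" and r: "0 < r" and \<tau>: "\<bar>\<tau>\<bar> \<le> 1" and F: "F \<in> borel_measurable (vec_borel p)"
  shows "(\<integral>x. tilt \<tau> x * F x \<partial>lazy_cube p r)
      = (1 + \<tau>) / 4 * mean (\<lambda>y. F (scale_vec p r y)) + (1 - (1 + \<tau>) / 4) * F (scale_vec p r (\<lambda>_. 0))"
proof -
  have tilt_scale: "tilt \<tau> (scale_vec p r (sign_vec S)) = (1 + \<tau>) * dens (sign_vec S)" for S
  proof -
    have "dens (\<lambda>i. sgn (scale_vec p r (sign_vec S) i)) = dens (sign_vec S)"
      unfolding dens_def h_def using B r
      by (intro prod.cong refl arg_cong2[of _ _ _ _ "(+)"] arg_cong2[of _ _ _ _ "(*)"] sum.cong)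
        (auto simp: A_def sgn_mult sign_vec_def)
    then show ?thesis using p r by (simp add: tilt_def sign_vec_def)
  qed
  have "rad_mean {..<p} (\<lambda>y. tilt \<tau> (scale_vec p r y) * F (scale_vec p r y))
      = (1 + \<tau>) * mean (\<lambda>y. F (scale_vec p r y))"
    unfolding mean_def rad_mean_cmult[symmetric] by (rule rad_mean_cong) (simp add: tilt_scale)
  moreover have "tilt \<tau> (scale_vec p r (\<lambda>_. 0)) = 1 - \<tau> / 3"
    using p by (simp add: tilt_def)
  ultimately show ?thesis
    using lazy_cube_integral(1)[of "\<lambda>x. tilt \<tau> x * F x" p r] F p
    by (simp only: borel_measurable_times tilt_measurable) (simp add: field_simps)
qed

lemma law_integral:
  assumes p: "1 \<le> p" and r: "0 < r" and \<tau>: "\<bar>\<tau>\<bar> \<le> 1" and F: "F \<in> borel_measurable (vec_borel p)"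
  shows "(\<integral>x. F x \<partial>law r \<tau>)
      = (1 + \<tau>) / 4 * mean (\<lambda>y. F (scale_vec p r y)) + (1 - (1 + \<tau>) / 4) * F (scale_vec p r (\<lambda>_. 0))"
    and "integrable (law r \<tau>) F"
proof -
  have meas: "tilt \<tau> \<in> borel_measurable (lazy_cube p r)" "F \<in> borel_measurable (lazy_cube p r)"
    using F p by (simp_all cong: measurable_cong_sets)
  have "(\<integral>x. F x \<partial>law r \<tau>) = (\<integral>x. tilt \<tau> x * F x \<partial>lazy_cube p r)"
    unfolding law_def using tilt_nonneg[OF \<tau>] meas by (subst integral_density) auto
  then show "(\<integral>x. F x \<partial>law r \<tau>)
      = (1 + \<tau>) / 4 * mean (\<lambda>y. F (scale_vec p r y)) + (1 - (1 + \<tau>) / 4) * F (scale_vec p r (\<lambda>_. 0))"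
    using law_integral_aux[OF assms] by simp
  show "integrable (law r \<tau>) F"
    unfolding law_def using tilt_nonneg[OF \<tau>] meas F p
    by (subst integrable_density) (auto intro!: lazy_cube_integral(2))
qed

lemma tilt_nn_integral:
  assumes p: "1 \<le> p" and r: "0 < r" and \<tau>: "\<bar>\<tau>\<bar> \<le> 1"
  shows "(\<integral>\<^sup>+x. ennreal (tilt \<tau> x) \<partial>lazy_cube p r) = 1"
proof -
  have "(\<integral>\<^sup>+x. ennreal (tilt \<tau> x) \<partial>lazy_cube p r) = ennreal (\<integral>x. tilt \<tau> x \<partial>lazy_cube p r)"
    using tilt_nonneg[OF \<tau>] p by (intro nn_integral_eq_integral lazy_cube_integral(2)) auto
  also have "(\<integral>x. tilt \<tau> x \<partial>lazy_cube p r) = 1"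
    using law_integral_aux[OF assms, of "\<lambda>_. 1"] by (simp add: mean_1)
  finally show ?thesis by simp
qed

lemma sets_law[simp, measurable_cong]: "sets (law r \<tau>) = sets (vec_borel p)"
  by (simp add: law_def)

lemma prob_space_law:
  assumes p: "1 \<le> p" and r: "0 < r" and \<tau>: "\<bar>\<tau>\<bar> \<le> 1"
  shows "prob_space (law r \<tau>)"
proof (rule prob_spaceI)
  have meas: "(\<lambda>x. ennreal (tilt \<tau> x)) \<in> borel_measurable (lazy_cube p r)"
    using p by (intro measurable_compose[OF _ measurable_ennreal]) (simp cong: measurable_cong_sets)
  have "emeasure (law r \<tau>) (space (law r \<tau>)) = (\<integral>\<^sup>+x. ennreal (tilt \<tau> x) * indicator (space (lazy_cube p r)) x \<partial>lazy_cube p r)"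
    unfolding law_def space_density by (rule emeasure_density[OF meas sets.top])
  also have "\<dots> = (\<integral>\<^sup>+x. ennreal (tilt \<tau> x) \<partial>lazy_cube p r)"
    by (intro nn_integral_cong) auto
  finally show "emeasure (law r \<tau>) (space (law r \<tau>)) = 1"
    using tilt_nn_integral[OF assms] by simp
qed

lemma mean_vec_law:
  assumes "1 \<le> p" "0 < r" "\<bar>\<tau>\<bar> \<le> 1" "i < p"
  shows "mean_vec (law r \<tau>) i = 0"
proof -
  have "mean (\<lambda>y. r * y i) = 0"
    using assms(4) by (simp add: mean_cmult mean_coord)
  then show ?thesis
    unfolding mean_vec_def using assms by (subst law_integral(1)) auto
qed

text \<open>The correlations of the signs. The diagonal is set apart because for \<open>i\<close> in
  \<open>B\<close> the sum would only give the variance of the conditional mean.\<close>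

definition corr :: "nat \<Rightarrow> nat \<Rightarrow> real" where
  "corr i j = (if i = j then 1 else \<Sum>a\<in>A. lin i a * lin j a)"

lemma cov_matrix_law:
  assumes "1 \<le> p" "0 < r" "\<bar>\<tau>\<bar> \<le> 1" and ij: "i < p" "j < p"
  shows "cov_matrix p (law r \<tau>) $$ (i, j) = (1 + \<tau>) / 4 * r\<^sup>2 * corr i j"
proof -
  have "mean (\<lambda>y. y i * y j) = corr i j"
    using ij by (auto simp: corr_def mean_coord_mult mean_coord_sq)
  then have m: "mean (\<lambda>y. (r * y i) * (r * y j)) = r\<^sup>2 * corr i j"
    using mean_cmult[of "r\<^sup>2" "\<lambda>y. y i * y j"] by (simp add: power2_eq_square mult_ac)
  have "cov_matrix p (law r \<tau>) $$ (i, j) = (\<integral>x. x i * x j \<partial>law r \<tau>)"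
    using assms by (simp add: cov_matrix_def mean_vec_law)
  also have "\<dots> = (1 + \<tau>) / 4 * mean (\<lambda>y. (r * y i) * (r * y j))"
    using assms by (subst law_integral(1)) auto
  finally show ?thesis by (simp add: m)
qed

lemma L2_law:
  assumes "1 \<le> p" "0 < r" "\<bar>\<tau>\<bar> \<le> 1"
  shows "law r \<tau> \<in> L2_distributions p"
proof -
  have "integrable (law r \<tau>) (\<lambda>x. (x i)\<^sup>2)" if "i < p" for i
    using that by (intro law_integral(2)[OF assms] borel_measurable_power measurable_component_singleton) auto
  then show ?thesis
    unfolding L2_distributions_def using prob_space_law[OF assms] by simp
qed

lemma sub_gaussian_law:
  assumes p: "1 \<le> p" and r: "0 < r" and \<tau>: "\<bar>\<tau>\<bar> \<le> 1" and \<rho>: "0 < \<rho>" "2 * \<rho> * r\<^sup>2 \<le> 1"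
  shows "sub_gaussian p \<rho> (law r \<tau>)"
  unfolding sub_gaussian_def
proof (intro allI impI)
  fix t :: real and v :: "nat \<Rightarrow> real" assume t: "0 < t" and v: "L2_set v {..<p} = 1"
  interpret prob_space "law r \<tau>" by (rule prob_space_law[OF p r \<tau>])
  have v1: "(\<Sum>i<p. (v i)\<^sup>2) = 1" using v by (simp add: L2_set_def)
  have space: "space (law r \<tau>) = space (vec_borel p)" by (rule sets_eq_imp_space_eq) simp
  let ?E = "{x \<in> space (vec_borel p). t < \<bar>\<Sum>i<p. v i * x i\<bar>}"
  have E: "?E \<in> sets (vec_borel p)" by measurable
  have "{x \<in> space (law r \<tau>). \<bar>\<Sum>i<p. v i * (x i - mean_vec (law r \<tau>) i)\<bar> > t} = ?E"
    using mean_vec_law[OF p r \<tau>] by (auto simp: space)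
  then have "measure (law r \<tau>) {x \<in> space (law r \<tau>). \<bar>\<Sum>i<p. v i * (x i - mean_vec (law r \<tau>) i)\<bar> > t}
      = (\<integral>x. indicator ?E x \<partial>law r \<tau>)"
    using E by (simp add: space Int_absorb2 subset_eq)
  also have "\<dots> = (1 + \<tau>) / 4 * mean (\<lambda>y. indicator ?E (scale_vec p r y))
      + (1 - (1 + \<tau>) / 4) * indicator ?E (scale_vec p r (\<lambda>_. 0))"
    using E by (intro law_integral(1)[OF p r \<tau>]) auto
  also have "\<dots> = (1 + \<tau>) / 4 * mean (\<lambda>y. if t / r < \<bar>\<Sum>i<p. v i * y i\<bar> then 1 else 0)"
  proof -
    have "indicator ?E (scale_vec p r y) = (if t / r < \<bar>\<Sum>i<p. v i * y i\<bar> then 1 else 0 :: real)" for y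
    proof -
      have "(\<Sum>i<p. v i * scale_vec p r y i) = r * (\<Sum>i<p. v i * y i)"
        by (simp add: sum_distrib_left mult_ac)
      then show ?thesis using r by (simp add: indicator_def abs_mult divide_less_eq mult.commute)
    qed
    moreover have "\<not> t / r < 0" using t r by (simp add: not_less)
    ultimately show ?thesis by simp
  qed
  \<comment> \<open>The mass \<open>(1 + \<tau>) / 4\<close> off the origin is at most
    \<open>1 / 2\<close> and absorbs the factor 2 of the two-sided Chernoff bound.\<close>
  also have "\<dots> \<le> 1 / 2 * (2 * exp (- ((t / r)\<^sup>2 / 4)))"
  proof (rule mult_mono)
    show "mean (\<lambda>y. if t / r < \<bar>\<Sum>i<p. v i * y i\<bar> then 1 else 0) \<le> 2 * exp (- ((t / r)\<^sup>2 / 4))"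
      using t r by (intro mean_tail v1) auto
    have "mean (\<lambda>_. 0) \<le> mean (\<lambda>y. if t / r < \<bar>\<Sum>i<p. v i * y i\<bar> then 1 else 0)"
      by (rule mean_mono) auto
    then show "0 \<le> mean (\<lambda>y. if t / r < \<bar>\<Sum>i<p. v i * y i\<bar> then 1 else 0)"
      by (simp add: mean_const)
  qed (use \<tau> in auto)
  also have "\<dots> \<le> exp (- (t\<^sup>2 * \<rho> / 2))"
  proof -
    have "t\<^sup>2 * (2 * \<rho> * r\<^sup>2) \<le> t\<^sup>2 * 1" using \<rho> by (intro mult_left_mono) auto
    then have "t\<^sup>2 * \<rho> / 2 \<le> (t / r)\<^sup>2 / 4" using r by (simp add: field_simps)
    then show ?thesis by simp
  qed
  finally show "measure (law r \<tau>) {x \<in> space (law r \<tau>). \<bar>\<Sum>i<p. v i * (x i - mean_vec (law r \<tau>) i)\<bar> > t}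
      \<le> exp (- (t\<^sup>2 * \<rho> / 2))" .
qed

text \<open>Off the diagonal the matrix is the product of \<open>lin\<close> with its transpose.
  Rows of \<open>lin\<close> have absolute sum at most 1 and columns at most \<open>3 / 2\<close>,
  the column bound plus one unit entry; the diagonal adds 1.\<close>

lemma corr_row_sum: "i < p \<Longrightarrow> (\<Sum>j<p. \<bar>corr i j\<bar>) \<le> 5 / 2"
proof -
  assume i: "i < p"
  have lin_row: "(\<Sum>a\<in>A. \<bar>lin i a\<bar>) \<le> 1"
  proof (cases "i \<in> B")
    case True
    have "(\<Sum>a\<in>A. \<bar>w i a\<bar>) \<le> (\<Sum>a<p. \<bar>w i a\<bar>)" by (intro sum_mono2) (auto simp: A_def)
    then show ?thesis using row[of i] True by (simp add: lin_def)
  next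
    case False
    then have "(\<Sum>a\<in>A. \<bar>lin i a\<bar>) = (\<Sum>a\<in>A. if a = i then 1 else 0)"
      by (intro sum.cong) (auto simp: lin_def)
    then show ?thesis by simp
  qed
  have lin_col: "(\<Sum>j<p. \<bar>lin j a\<bar>) \<le> 3 / 2" for a
  proof -
    have "(\<Sum>j<p. \<bar>lin j a\<bar>) \<le> (\<Sum>j<p. \<bar>w j a\<bar> + (if j = a then 1 else 0))"
      by (intro sum_mono) (auto simp: lin_def)
    also have "\<dots> \<le> 3 / 2"
      using col[of a] by (simp add: sum.distrib)
    finally show ?thesis .
  qed
  have "(\<Sum>j<p. \<bar>corr i j\<bar>) \<le> (\<Sum>j<p. (if j = i then 1 else 0) + (\<Sum>a\<in>A. \<bar>lin i a\<bar> * \<bar>lin j a\<bar>))"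
  proof (rule sum_mono)
    fix j
    have "\<bar>\<Sum>a\<in>A. lin i a * lin j a\<bar> \<le> (\<Sum>a\<in>A. \<bar>lin i a\<bar> * \<bar>lin j a\<bar>)"
      by (rule order_trans[OF sum_abs]) (simp add: abs_mult)
    moreover have "0 \<le> (\<Sum>a\<in>A. \<bar>lin i a\<bar> * \<bar>lin j a\<bar>)" by (intro sum_nonneg) auto
    ultimately show "\<bar>corr i j\<bar> \<le> (if j = i then 1 else 0) + (\<Sum>a\<in>A. \<bar>lin i a\<bar> * \<bar>lin j a\<bar>)"
      by (auto simp: corr_def)
  qed
  also have "\<dots> = 1 + (\<Sum>a\<in>A. \<bar>lin i a\<bar> * (\<Sum>j<p. \<bar>lin j a\<bar>))"
    using i by (simp add: sum.distrib sum_distrib_left sum.swap[of _ "{..<p}" A])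
  also have "\<dots> \<le> 1 + (\<Sum>a\<in>A. \<bar>lin i a\<bar> * (3 / 2))"
    by (intro add_left_mono sum_mono mult_left_mono lin_col) auto
  also have "\<dots> \<le> 5 / 2"
    using lin_row unfolding sum_distrib_right[symmetric] by linarith
  finally show ?thesis .
qed

end

text \<open>Read the eigenvector equation at a coordinate where the eigenvector has largest
  modulus.\<close>

lemma eigenvalue_le_row_sum:
  fixes M :: "real mat"
  assumes M: "M \<in> carrier_mat p p" and ev: "eigenvalue M l"
    and row: "\<And>i. i < p \<Longrightarrow> (\<Sum>j<p. \<bar>M $$ (i, j)\<bar>) \<le> c"
  shows "l \<le> c"
proof -
  from ev M obtain v where v: "v \<in> carrier_vec p" "v \<noteq> 0\<^sub>v p" "M *\<^sub>v v = l \<cdot>\<^sub>v v"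
    by (auto simp: eigenvalue_def eigenvector_def)
  then obtain k where k: "k < p" "v $ k \<noteq> 0"
    by (metis eq_vecI carrier_vecD index_zero_vec)
  define m where "m = Max ((\<lambda>i. \<bar>v $ i\<bar>) ` {..<p})"
  have m_ge: "\<bar>v $ i\<bar> \<le> m" if "i < p" for i
    unfolding m_def using that by (intro Max_ge) auto
  have m_pos: "0 < m" using m_ge[OF k(1)] k(2) by linarith
  have "m \<in> (\<lambda>i. \<bar>v $ i\<bar>) ` {..<p}"
    unfolding m_def using k(1) by (intro Max_in) auto
  then obtain i where i: "i < p" "m = \<bar>v $ i\<bar>" by auto
  have "l * v $ i = (M *\<^sub>v v) $ i" using v i by simp
  also have "\<dots> = (\<Sum>j<p. M $$ (i, j) * v $ j)"
    using v(1) M i by (simp add: scalar_prod_def lessThan_atLeast0)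
  finally have "\<bar>l\<bar> * m = \<bar>\<Sum>j<p. M $$ (i, j) * v $ j\<bar>"
    using i by (metis abs_mult)
  also have "\<dots> \<le> (\<Sum>j<p. \<bar>M $$ (i, j)\<bar> * m)"
    by (rule order_trans[OF sum_abs]) (auto intro!: sum_mono mult_left_mono m_ge simp: abs_mult)
  also have "\<dots> \<le> c * m"
    unfolding sum_distrib_right[symmetric] using row[OF i(1)] m_pos by (intro mult_right_mono) auto
  finally have "\<bar>l\<bar> \<le> c" using m_pos by simp
  then show ?thesis by simp
qed

context bipartite_weights
begin

text \<open>The coordinate \<open>e\<close> is uncorrelated with all others and provides the real eigenvalue without which
  \<^const>\<open>lambda_max\<close> would be the maximum of a set not known to be nonempty.\<close>

lemma law_in_P'_class:
  assumes p: "1 \<le> p" and r: "0 < r" and \<tau>: "\<bar>\<tau>\<bar> \<le> 1" and \<rho>: "0 < \<rho>" "2 * \<rho> * r\<^sup>2 \<le> 1"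
    and M0: "2 * r\<^sup>2 \<le> M0" and e: "e < p" "\<And>j. w j e = 0" "e \<notin> B"
    and decay: "\<And>i j. i < p \<Longrightarrow> j < p \<Longrightarrow> i \<noteq> j \<Longrightarrow>
      r\<^sup>2 / 2 * \<bar>corr i j\<bar> \<le> M1 * \<bar>real i - real j\<bar> powr (- (\<alpha> + 1))"
  shows "law r \<tau> \<in> P'_class p \<alpha> M0 M1 \<rho>"
proof -
  let ?S = "cov_matrix p (law r \<tau>)"
  let ?c = "(1 + \<tau>) / 4 * r\<^sup>2"
  have c: "0 \<le> ?c" "?c \<le> r\<^sup>2 / 2" using \<tau> mult_right_mono[of "1 + \<tau>" 2 "r\<^sup>2"] by (auto simp: mult.commute)
  have S: "?S \<in> carrier_mat p p" by (simp add: cov_matrix_def)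
  have S_nth: "?S $$ (i, j) = ?c * corr i j" if "i < p" "j < p" for i j
    using cov_matrix_law[OF p r \<tau> that] .
  have le: "l \<le> M0" if "eigenvalue ?S l" for l
  proof -
    have "l \<le> r\<^sup>2 / 2 * (5 / 2)"
    proof (rule eigenvalue_le_row_sum[OF S that])
      fix i assume i: "i < p"
      have "(\<Sum>j<p. \<bar>?S $$ (i, j)\<bar>) = ?c * (\<Sum>j<p. \<bar>corr i j\<bar>)"
        using i c \<tau> by (simp add: S_nth abs_mult sum_distrib_left)
      also have "\<dots> \<le> r\<^sup>2 / 2 * (5 / 2)"
        using c corr_row_sum[OF i] by (intro mult_mono) (auto intro: sum_nonneg)
      finally show "(\<Sum>j<p. \<bar>?S $$ (i, j)\<bar>) \<le> r\<^sup>2 / 2 * (5 / 2)" .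
    qed
    also have "\<dots> \<le> 2 * r\<^sup>2" by simp
    finally show ?thesis using M0 by simp
  qed
  have "eigenvalue ?S ?c"
    unfolding eigenvalue_def
  proof (rule exI, unfold eigenvector_def, intro conjI)
    show "unit_vec p e \<in> carrier_vec (dim_row ?S)" using S by simp
    show "unit_vec p e \<noteq> 0\<^sub>v (dim_row ?S)" using S e by simp
    show "?S *\<^sub>v unit_vec p e = ?c \<cdot>\<^sub>v unit_vec p e"
    proof (rule eq_vecI)
      fix i assume "i < dim_vec (?c \<cdot>\<^sub>v unit_vec p e)"
      then have i: "i < p" by simp
      have "(?S *\<^sub>v unit_vec p e) $ i = ?S $$ (i, e)"
        using S e i by simp
      also have "\<dots> = ?c * corr i e" using i e by (intro S_nth)
      also have "corr i e = (if i = e then 1 else 0)"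
      proof -
        have "lin i a * lin e a = 0" if "i \<noteq> e" for a
          using e that by (auto simp: lin_def)
        then show ?thesis by (auto simp: corr_def)
      qed
      finally show "(?S *\<^sub>v unit_vec p e) $ i = (?c \<cdot>\<^sub>v unit_vec p e) $ i"
        using i e by (simp add: unit_vec_def)
    qed (use S in auto)
  qed
  then have "spectrum ?S \<noteq> {}" by (auto simp: spectrum_def)
  moreover have "finite (spectrum ?S)" using card_finite_spectrum[OF S] by simp
  ultimately have "lambda_max ?S \<le> M0"
    unfolding lambda_max_def using le by (subst Max_le_iff) (auto simp: spectrum_def)
  moreover have "\<bar>?S $$ (i, j)\<bar> \<le> M1 * \<bar>real i - real j\<bar> powr (- (\<alpha> + 1))"
    if "i < p" "j < p" "i \<noteq> j" for i j
  proof -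
    have "\<bar>?S $$ (i, j)\<bar> = ?c * \<bar>corr i j\<bar>"
      using that c \<tau> by (simp add: S_nth abs_mult)
    also have "\<dots> \<le> r\<^sup>2 / 2 * \<bar>corr i j\<bar>"
      using c by (intro mult_right_mono) auto
    finally show ?thesis using decay[OF that] by simp
  qed
  ultimately show ?thesis
    unfolding P'_class_def G_class_def covariance_matrices_def
    using L2_law[OF p r \<tau>] sub_gaussian_law[OF p r \<tau> \<rho>] by auto
qed

end

section \<open>Block designs and the lower rate\<close>

text \<open>All weights are zero, and the two hypotheses differ in the mass off the origin,
  \<open>\<tau> = \<gamma>\<close> against \<open>\<tau> = - \<gamma>\<close>. This rescales every
  variance at once, but only the entry at \<open>(0, 0)\<close> is charged, whence the factor
  \<open>1 / real p\<close>. The bound serves dimensions too small for a block.\<close>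

lemma minimax_risk_variance_lower_bound:
  fixes \<alpha> M0 M1 \<rho> r \<gamma> :: real
  assumes p: "1 \<le> p" and r: "0 < r" "2 * \<rho> * r\<^sup>2 \<le> 1" "2 * r\<^sup>2 \<le> M0"
    and pos: "0 < M1" "0 < \<rho>" and \<gamma>: "0 \<le> \<gamma>" "\<gamma> \<le> 1"
  shows "ennreal (1 / real p * ((r\<^sup>2 * \<gamma> / 4)\<^sup>2 * (1 - \<gamma>\<^sup>2) ^ n)) \<le> minimax_risk n p (P'_class p \<alpha> M0 M1 \<rho>)"
proof -
  let ?w = "\<lambda>_ _. 0 :: real"
  interpret bipartite_weights p "{}" ?w by unfold_locales auto
  let ?\<tau> = "\<lambda>D. if (0, 0) \<in> D then \<gamma> else - \<gamma> :: real"
  have \<tau>: "\<bar>?\<tau> D\<bar> \<le> 1" for D :: "(nat \<times> nat) set" using \<gamma> by auto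
  have corr0: "corr i j = (if i = j then 1 else 0)" for i j
    by (auto simp: corr_def lin_def intro!: sum.neutral)
  have "ennreal (real (card {(0::nat, 0::nat)}) / real p * ((r\<^sup>2 * \<gamma> / 4)\<^sup>2 * (1 - \<gamma>\<^sup>2) ^ n))
      \<le> minimax_risk n p (P'_class p \<alpha> M0 M1 \<rho>)"
  proof (rule minimax_risk_assouad[where f = "\<lambda>D. tilt (?\<tau> D)" and m = "r\<^sup>2 / 4"])
    show "prob_space (lazy_cube p r)" by (rule prob_space_lazy_cube)
    fix D :: "(nat \<times> nat) set" assume "D \<subseteq> {(0, 0)}"
    show "tilt (?\<tau> D) \<in> borel_measurable (lazy_cube p r)"
      using tilt_measurable[OF p] by (simp cong: measurable_cong_sets)
    show "0 \<le> tilt (?\<tau> D) x" for x by (rule tilt_nonneg[OF \<tau>])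
    show "(\<integral>\<^sup>+x. ennreal (tilt (?\<tau> D) x) \<partial>lazy_cube p r) = 1"
      by (rule tilt_nn_integral[OF p r(1) \<tau>])
    have "law r (?\<tau> D) \<in> P'_class p \<alpha> M0 M1 \<rho>"
      using p r pos by (intro law_in_P'_class[where e = 0] \<tau>) (auto simp: corr0)
    then show "density (lazy_cube p r) (\<lambda>x. ennreal (tilt (?\<tau> D) x)) \<in> P'_class p \<alpha> M0 M1 \<rho>"
      by (simp only: law_def)
    show "cov_matrix p (density (lazy_cube p r) (\<lambda>x. ennreal (tilt (?\<tau> D) x))) $$ (i, j)
        = (if (i, j) \<in> D then r\<^sup>2 / 4 + r\<^sup>2 * \<gamma> / 4 else r\<^sup>2 / 4 - r\<^sup>2 * \<gamma> / 4)"
      if "(i, j) \<in> {(0, 0)}" for i j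
      using cov_matrix_law[OF p r(1) \<tau>, of i j D] that p
      unfolding law_def by (auto simp: corr0 field_simps)
  next
    fix k D x assume k: "k \<in> {(0::nat, 0::nat)}" and D: "D \<subseteq> {(0, 0)} - {k}"
    then have \<tau>_eq: "?\<tau> (insert k D) = \<gamma>" "?\<tau> D = - \<gamma>" by auto
    \<comment> \<open>Off the origin the two densities have affinity
      \<open>1 - \<gamma>\<^sup>2\<close>; at the atom it is
      \<open>1 - \<gamma>\<^sup>2 / 9\<close>, which is no worse.\<close>
    have "\<gamma>\<^sup>2 / 9 \<le> \<gamma>\<^sup>2" by simp
    then show "(1 - \<gamma>\<^sup>2) * ((tilt (?\<tau> (insert k D)) x + tilt (?\<tau> D) x) / 2)\<^sup>2 \<le> tilt (?\<tau> (insert k D)) x * tilt (?\<tau> D) x"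
      unfolding \<tau>_eq by (simp add: tilt_def dens_def power2_eq_square algebra_simps)
  qed (use p \<gamma> in \<open>auto simp: power_le_one\<close>)
  then show ?thesis by simp
qed

text \<open>A block has \<open>2 * k\<close> coordinates; \<open>2 * k \<le> p - 1\<close> makes
  room for one block and a spare coordinate. The bound on \<open>\<gamma> * real k\<close> is what
  the row and column bounds of \<open>bipartite_weights\<close> amount to.\<close>

locale block_design =
  fixes p k :: nat and \<gamma> :: real
  assumes k: "1 \<le> k" "2 * k \<le> p - 1" and \<gamma>: "0 \<le> \<gamma>" "\<gamma> * real k \<le> 1 / 2"
begin

text \<open>Fitting the blocks into \<open>p - 1\<close> coordinates leaves the last one outside all
  of them; it becomes the uncorrelated coordinate that \<open>law_in_P'_class\<close> asks
  for.\<close>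

definition nb :: nat where "nb = (p - 1) div (2 * k)"

definition Bs :: "nat set" where "Bs = {i. i < 2 * k * nb \<and> k \<le> i mod (2 * k)}"

definition K :: "(nat \<times> nat) set" where
  "K = {(b, a). b \<in> Bs \<and> a div (2 * k) = b div (2 * k) \<and> a mod (2 * k) < k}"

definition wt :: "(nat \<times> nat) set \<Rightarrow> nat \<Rightarrow> nat \<Rightarrow> real" where
  "wt D b a = (if (b, a) \<in> K then if (b, a) \<in> D then \<gamma> else - \<gamma> else 0)"

lemma nb_le: "2 * k * nb \<le> p - 1"
  unfolding nb_def by (metis div_times_less_eq_dividend mult.commute)

lemma K_less: "(b, a) \<in> K \<Longrightarrow> b < 2 * k * nb \<and> a < 2 * k * nb"
proof -
  assume K: "(b, a) \<in> K"
  then have b: "b < 2 * k * nb" by (simp add: K_def Bs_def)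
  then have "b div (2 * k) < nb" using k by (simp add: div_less_iff_less_mult mult.commute)
  then have "a div (2 * k) < nb" using K by (simp add: K_def)
  then show ?thesis using b k by (simp add: div_less_iff_less_mult mult.commute)
qed

lemma K_sub: "K \<subseteq> {..<p} \<times> {..<p}"
proof
  fix x assume "x \<in> K"
  then show "x \<in> {..<p} \<times> {..<p}"
    using K_less[of "fst x" "snd x"] nb_le by (cases x) auto
qed

lemma K_notin: "(b, a) \<in> K \<Longrightarrow> b \<in> Bs \<and> a \<notin> Bs"
  by (auto simp: K_def Bs_def)

lemma wt_abs: "\<bar>wt D b a\<bar> = (if (b, a) \<in> K then \<gamma> else 0)"
  using \<gamma> by (simp add: wt_def)

lemma div_mod_interval:
  fixes a m q lo hi :: nat
  assumes "a div m = q" "lo \<le> a mod m" "a mod m < hi"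
  shows "a \<in> {m * q + lo..<m * q + hi}"
  using assms mult_div_mod_eq[of m a] by auto

lemma row_card: "card {a. a < p \<and> (b, a) \<in> K} \<le> k"
proof -
  have "{a. a < p \<and> (b, a) \<in> K} \<subseteq> {2 * k * (b div (2 * k)) + 0..<2 * k * (b div (2 * k)) + k}"
    using div_mod_interval[of _ "2 * k" "b div (2 * k)" 0 k] by (auto simp: K_def)
  from card_mono[OF _ this] show ?thesis by simp
qed

lemma col_card: "card {b. b < p \<and> (b, a) \<in> K} \<le> k"
proof -
  have "{b. b < p \<and> (b, a) \<in> K} \<subseteq> {2 * k * (a div (2 * k)) + k..<2 * k * (a div (2 * k)) + 2 * k}"
  proof
    fix b assume "b \<in> {b. b < p \<and> (b, a) \<in> K}"
    then show "b \<in> {2 * k * (a div (2 * k)) + k..<2 * k * (a div (2 * k)) + 2 * k}"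
      using k by (intro div_mod_interval) (auto simp: K_def Bs_def)
  qed
  from card_mono[OF _ this] show ?thesis by simp
qed

text \<open>Each row and each column meets \<open>K\<close> in at most \<open>k\<close> places, all
  of weight \<open>\<gamma>\<close> in modulus.\<close>

lemma bipartite: "bipartite_weights p Bs (wt D)"
proof
  show "Bs \<subseteq> {..<p}" using nb_le by (auto simp: Bs_def)
  show "b \<in> Bs \<and> a \<in> {..<p} - Bs" if "wt D b a \<noteq> 0" for b a
    using that K_notin[of b a] K_sub by (auto simp: wt_def split: if_splits)
  have sum_le: "(\<Sum>a<p. if P a then \<gamma> else 0) \<le> 1 / 2" if "card {a. a < p \<and> P a} \<le> k" for P
  proof -
    have "(\<Sum>a<p. if P a then \<gamma> else 0) = \<gamma> * real (card {a. a < p \<and> P a})"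
      by (simp add: sum.If_cases Int_def)
    also have "\<dots> \<le> \<gamma> * real k" using that \<gamma> by (intro mult_left_mono) auto
    finally show ?thesis using \<gamma> by simp
  qed
  show "(\<Sum>a<p. \<bar>wt D b a\<bar>) \<le> 1 / 2" for b
    unfolding wt_abs by (rule sum_le[OF row_card])
  show "(\<Sum>b<p. \<bar>wt D b a\<bar>) \<le> 1 / 2" for a
    unfolding wt_abs by (rule sum_le[OF col_card])
qed

lemma card_K: "real nb * real k ^ 2 \<le> real (card K)"
proof -
  let ?X = "{..<nb} \<times> {..<k} \<times> {..<k}"
  let ?g = "\<lambda>(q, i, j). (2 * k * q + (k + i), 2 * k * q + j)"
  have dm: "(2 * k * q + i) div (2 * k) = q" "(2 * k * q + i) mod (2 * k) = i" if "i < 2 * k" for q i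
    using that by auto
  have inj: "inj_on ?g ?X"
  proof (rule inj_onI)
    fix x y assume xy: "x \<in> ?X" "y \<in> ?X" "?g x = ?g y"
    obtain q i j q' i' j' where e: "x = (q, i, j)" "y = (q', i', j')" by (metis prod_cases3)
    have l: "k + i < 2 * k" "k + i' < 2 * k" "j < 2 * k" "j' < 2 * k" using xy e by auto
    have "2 * k * q + (k + i) = 2 * k * q' + (k + i')" "2 * k * q + j = 2 * k * q' + j'"
      using xy e by auto
    then show "x = y"
      using dm[OF l(1), of q] dm[OF l(2), of q'] dm[OF l(3), of q] dm[OF l(4), of q'] e by auto
  qed
  have "?g ` ?X \<subseteq> K"
  proof
    fix z assume "z \<in> ?g ` ?X"
    then obtain q i j where z: "z = (2 * k * q + (k + i), 2 * k * q + j)" and l: "q < nb" "i < k" "j < k" by auto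
    have "2 * k * q + (k + i) < 2 * k * (q + 1)" using l by simp
    also have "\<dots> \<le> 2 * k * nb" using l by (intro mult_le_mono) auto
    finally show "z \<in> K"
      using dm[of "k + i" q] dm[of j q] l by (auto simp: z K_def Bs_def)
  qed
  then have "card (?g ` ?X) \<le> card K"
    using K_sub by (intro card_mono finite_subset[OF K_sub]) auto
  then have "nb * k ^ 2 \<le> card K"
    by (simp add: card_image[OF inj] card_cartesian_product power2_eq_square)
  then show ?thesis by (metis of_nat_le_iff of_nat_mult of_nat_power)
qed

text \<open>There is at least one block, so rounding down to whole blocks loses at most a factor of
  two; the 8 is generous. Together with \<open>card_K\<close> this gives at least
  \<open>real k / 8\<close> free entries per coordinate.\<close>

lemma nb_ge: "real p \<le> 8 * real k * real nb"
proof -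
  have lt: "p - 1 < 2 * k * (nb + 1)"
    unfolding nb_def using k dividend_less_div_times[of "2 * k" "p - 1"] by (simp add: algebra_simps)
  have "1 \<le> nb" unfolding nb_def using k by (simp add: Suc_le_eq div_greater_zero_iff)
  then have "2 * k * (nb + 1) \<le> 2 * k * (2 * nb)" by (intro mult_le_mono) auto
  from less_le_trans[OF lt this] have "p - 1 < 4 * k * nb" by (simp add: mult_ac)
  then have "p \<le> 8 * k * nb" using k by linarith
  then have "real p \<le> real (8 * k * nb)" by linarith
  then show ?thesis by simp
qed


definition obs :: "(nat \<times> nat) set \<Rightarrow> (nat \<Rightarrow> real) \<Rightarrow> real" where
  "obs D = bipartite_weights.tilt p Bs (wt D) 0"

text \<open>Flipping the sign of one weight alters only the factor at \<open>b\<close>, from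
  \<open>F - z\<close> to \<open>F + z\<close>, and leaves the rest \<open>R\<close> unchanged. The
  product of the two is \<open>F\<^sup>2 - z\<^sup>2\<close> and their midpoint is \<open>F\<close>;
  as \<open>\<bar>z\<bar> \<le> \<gamma>\<close> and \<open>F \<ge> 1 / 2\<close>, the loss is at
  most \<open>4 * \<gamma>\<^sup>2 * F\<^sup>2\<close>.\<close>

lemma obs_neighbours:
  assumes ba: "(b, a) \<in> K" and D: "D \<subseteq> K - {(b, a)}"
  shows "(1 - 4 * \<gamma>\<^sup>2) * ((obs (insert (b, a) D) x + obs D x) / 2)\<^sup>2 \<le> obs (insert (b, a) D) x * obs D x"
proof -
  let ?D' = "insert (b, a) D"
  interpret D: bipartite_weights p Bs "wt D" by (rule bipartite)
  interpret D': bipartite_weights p Bs "wt ?D'" by (rule bipartite)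
  have nD: "(b, a) \<notin> D" using D by auto
  have bB: "b \<in> Bs" and aA: "a \<in> D.A" using K_notin[OF ba] K_sub ba by (auto simp: D.A_def)
  show ?thesis
  proof (cases "x 0 = 0")
    case True
    then show ?thesis by (simp add: obs_def D.tilt_def D'.tilt_def)
  next
    case False
    let ?y = "\<lambda>i. sgn (x i)"
    define F where "F = 1 + ?y b * (\<Sum>a'\<in>D.A - {a}. wt D b a' * ?y a')"
    define z where "z = \<gamma> * (?y b * ?y a)"
    define R where "R = (\<Prod>b'\<in>Bs - {b}. 1 + ?y b' * D.h b' ?y)"
    have y1: "\<bar>?y i\<bar> \<le> 1" for i by (simp add: abs_sgn_eq)
    have split: "(\<Sum>a'\<in>D.A. g a') = g a + (\<Sum>a'\<in>D.A - {a}. g a')" for g :: "nat \<Rightarrow> real"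
      using aA by (intro sum.remove) auto
    have wt_ba: "wt D b a = - \<gamma>" "wt ?D' b a = \<gamma>" using ba nD by (auto simp: wt_def)
    have hD: "1 + ?y b * D.h b ?y = F - z"
      unfolding D.h_def split F_def z_def wt_ba by (simp add: algebra_simps)
    have hD': "1 + ?y b * D'.h b ?y = F + z"
    proof -
      have eq: "(\<Sum>a'\<in>D.A - {a}. wt ?D' b a' * ?y a') = (\<Sum>a'\<in>D.A - {a}. wt D b a' * ?y a')"
        by (intro sum.cong refl) (auto simp: wt_def)
      show ?thesis
        unfolding D'.h_def split eq F_def z_def wt_ba by (simp add: algebra_simps)
    qed
    have "D'.h b' ?y = D.h b' ?y" if "b' \<noteq> b" for b'
      unfolding D.h_def D'.h_def using that by (intro sum.cong refl) (auto simp: wt_def)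
    then have R': "(\<Prod>b'\<in>Bs - {b}. 1 + ?y b' * D'.h b' ?y) = R"
      unfolding R_def by (intro prod.cong refl) auto
    have "obs D x = (\<Prod>b'\<in>Bs. 1 + ?y b' * D.h b' ?y)"
      using False by (simp add: obs_def D.tilt_def D.dens_def)
    also have "\<dots> = (F - z) * R"
      unfolding R_def hD[symmetric] by (rule prod.remove[OF D.fin(2) bB])
    finally have oD: "obs D x = (F - z) * R" .
    have "obs ?D' x = (\<Prod>b'\<in>Bs. 1 + ?y b' * D'.h b' ?y)"
      using False by (simp add: obs_def D'.tilt_def D'.dens_def)
    also have "\<dots> = (F + z) * R"
      unfolding R'[symmetric] hD'[symmetric] by (rule prod.remove[OF D.fin(2) bB])
    finally have oD': "obs ?D' x = (F + z) * R" .
    have "1 / 2 \<le> F - z" using D.factor_ge[of ?y b, OF y1] unfolding hD .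
    moreover have "1 / 2 \<le> F + z" using D'.factor_ge[of ?y b, OF y1] unfolding hD' .
    ultimately have F: "1 / 2 \<le> F" by linarith
    have "z\<^sup>2 \<le> \<gamma>\<^sup>2"
    proof -
      have "\<bar>?y b * ?y a\<bar> \<le> 1 * 1" unfolding abs_mult by (intro mult_mono y1) auto
      then have "\<bar>z\<bar> \<le> \<gamma> * 1" unfolding z_def abs_mult using \<gamma> by (intro mult_mono) auto
      then show ?thesis using \<gamma> by (simp add: abs_le_square_iff[symmetric])
    qed
    also have "\<gamma>\<^sup>2 \<le> \<gamma>\<^sup>2 * (4 * F\<^sup>2)"
    proof -
      have "1 \<le> (2 * F)\<^sup>2" using F by (intro one_le_power) auto
      then show ?thesis using mult_left_mono[of 1 "(2 * F)\<^sup>2" "\<gamma>\<^sup>2"] by (simp add: power_mult_distrib)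
    qed
    finally have "z\<^sup>2 * R\<^sup>2 \<le> \<gamma>\<^sup>2 * (4 * F\<^sup>2) * R\<^sup>2" by (intro mult_right_mono) auto
    then show ?thesis
      unfolding oD oD' by (simp add: power2_eq_square algebra_simps)
  qed
qed

text \<open>Besides \<open>K\<close> and its transpose, correlations arise only between two
  coordinates in the second half of a block, through their common ancestors. These are sums of
  products of weights, and the row bound keeps them below \<open>\<gamma>\<close>.\<close>

lemma corr_wt:
  assumes ij: "i < p" "j < p" "i \<noteq> j"
  shows "(i, j) \<in> K \<Longrightarrow> bipartite_weights.corr p Bs (wt D) i j = wt D i j"
    and "\<bar>bipartite_weights.corr p Bs (wt D) i j\<bar> \<le> \<gamma>"
    and "i div (2 * k) \<noteq> j div (2 * k) \<Longrightarrow> bipartite_weights.corr p Bs (wt D) i j = 0"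
proof -
  interpret D: bipartite_weights p Bs "wt D" by (rule bipartite)
  have wt_le: "\<bar>wt D b a\<bar> \<le> \<gamma>" for b a using \<gamma> by (simp add: wt_def)
  have corr: "D.corr i j = (\<Sum>a\<in>D.A. D.lin i a * D.lin j a)" using ij by (simp add: D.corr_def)
  have notB: "D.corr i j = D.lin i j" if "j \<notin> Bs"
  proof -
    have "D.corr i j = (\<Sum>a\<in>D.A. if a = j then D.lin i a else 0)"
      unfolding corr using that by (intro sum.cong) (auto simp: D.lin_def)
    then show ?thesis using that ij by (simp add: D.A_def)
  qed
  have notB': "D.corr i j = D.lin j i" if "i \<notin> Bs"
  proof -
    have "D.corr i j = (\<Sum>a\<in>D.A. if a = i then D.lin j a else 0)"
      unfolding corr using that by (intro sum.cong) (auto simp: D.lin_def)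
    then show ?thesis using that ij by (simp add: D.A_def)
  qed
  show "D.corr i j = wt D i j" if "(i, j) \<in> K"
    using notB K_notin[OF that] by (simp add: D.lin_def)
  show "\<bar>D.corr i j\<bar> \<le> \<gamma>"
  proof (cases "i \<in> Bs \<and> j \<in> Bs")
    case True
    have "\<bar>D.corr i j\<bar> \<le> (\<Sum>a\<in>D.A. \<bar>wt D i a\<bar> * \<bar>wt D j a\<bar>)"
      unfolding corr using True by (intro order_trans[OF sum_abs]) (simp add: D.lin_def abs_mult)
    also have "\<dots> \<le> (\<Sum>a\<in>D.A. \<bar>wt D i a\<bar> * \<gamma>)"
      by (intro sum_mono mult_left_mono wt_le) auto
    also have "\<dots> \<le> (\<Sum>a<p. \<bar>wt D i a\<bar> * \<gamma>)"
      using \<gamma> by (intro sum_mono2) (auto simp: D.A_def)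
    also have "\<dots> \<le> 1 / 2 * \<gamma>"
      unfolding sum_distrib_right[symmetric] using D.row[of i] \<gamma> by (intro mult_right_mono) auto
    finally show ?thesis using \<gamma> by simp
  next
    case False
    then show ?thesis
      using notB notB' wt_le[of i j] wt_le[of j i] ij \<gamma> by (auto simp: D.lin_def)
  qed
  show "D.corr i j = 0" if "i div (2 * k) \<noteq> j div (2 * k)"
  proof -
    have lin0: "D.lin i a = 0" if "a div (2 * k) \<noteq> i div (2 * k)" for i a
      using that by (auto simp: D.lin_def wt_def K_def)
    show ?thesis
      unfolding corr using that lin0[of _ i] lin0[of _ j] by (intro sum.neutral) (metis mult_eq_0_iff)
  qed
qed

text \<open>Two coordinates of one block are less than \<open>2 * k\<close> apart and different
  blocks are uncorrelated, so the single inequality \<open>decay\<close> settles the decay condition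
  for every entry.\<close>

lemma minimax_risk_ge:
  fixes \<alpha> M0 M1 \<rho> r :: real
  assumes r: "0 < r" "2 * \<rho> * r\<^sup>2 \<le> 1" "2 * r\<^sup>2 \<le> M0" and pos: "0 < M1" "0 < \<rho>" "0 < \<alpha>"
    and decay: "r\<^sup>2 / 2 * \<gamma> \<le> M1 * (2 * real k) powr (- (\<alpha> + 1))"
  shows "ennreal (real k / 8 * ((r\<^sup>2 * \<gamma> / 4)\<^sup>2 * (1 - 4 * \<gamma>\<^sup>2) ^ n)) \<le> minimax_risk n p (P'_class p \<alpha> M0 M1 \<rho>)"
proof -
  have p: "1 \<le> p" using k by simp
  have \<gamma>_half: "\<gamma> \<le> 1 / 2"
    using \<gamma> k mult_left_mono[of 1 "real k" \<gamma>] by simp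
  have \<gamma>_sq: "4 * \<gamma>\<^sup>2 \<le> 1"
    using power_mono[OF \<gamma>_half \<gamma>(1), of 2] by (simp add: power_divide)
  have "ennreal (real (card K) / real p * ((r\<^sup>2 * \<gamma> / 4)\<^sup>2 * (1 - 4 * \<gamma>\<^sup>2) ^ n))
      \<le> minimax_risk n p (P'_class p \<alpha> M0 M1 \<rho>)"
  proof (rule minimax_risk_assouad[where f = obs and m = 0 and K = K, OF _ _ K_sub p])
    show "prob_space (lazy_cube p r)" by (rule prob_space_lazy_cube)
    fix D assume "D \<subseteq> K"
    interpret D: bipartite_weights p Bs "wt D" by (rule bipartite)
    show "obs D \<in> borel_measurable (lazy_cube p r)"
      using D.tilt_measurable[OF p] by (simp add: obs_def cong: measurable_cong_sets)
    show "0 \<le> obs D x" for x by (simp add: obs_def D.tilt_nonneg)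
    show "(\<integral>\<^sup>+x. ennreal (obs D x) \<partial>lazy_cube p r) = 1"
      unfolding obs_def by (rule D.tilt_nn_integral[OF p r(1)]) simp
    have law: "density (lazy_cube p r) (\<lambda>x. ennreal (obs D x)) = D.law r 0"
      by (simp add: obs_def D.law_def)
    have last: "(b, p - 1) \<notin> K \<and> p - 1 \<notin> Bs" for b
      using K_less[of b "p - 1"] nb_le by (auto simp: Bs_def)
    show "density (lazy_cube p r) (\<lambda>x. ennreal (obs D x)) \<in> P'_class p \<alpha> M0 M1 \<rho>"
      unfolding law
    proof (rule D.law_in_P'_class[where e = "p - 1"])
      fix i j assume ij: "i < p" "j < p" "i \<noteq> j"
      show "r\<^sup>2 / 2 * \<bar>D.corr i j\<bar> \<le> M1 * \<bar>real i - real j\<bar> powr (- (\<alpha> + 1))"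
      proof (cases "i div (2 * k) = j div (2 * k)")
        case True
        define c where "c = 2 * k * (j div (2 * k))"
        have "i = c + i mod (2 * k)" "j = c + j mod (2 * k)"
          using True mult_div_mod_eq[of "2 * k" i] mult_div_mod_eq[of "2 * k" j] by (simp_all only: c_def)
        moreover have "i mod (2 * k) < 2 * k" "j mod (2 * k) < 2 * k" using k by auto
        ultimately have "i < j + 2 * k" "j < i + 2 * k" by linarith+
        then have "\<bar>real i - real j\<bar> < 2 * real k" by linarith
        then have "(2 * real k) powr (- (\<alpha> + 1)) \<le> \<bar>real i - real j\<bar> powr (- (\<alpha> + 1))"
          using ij pos by (intro powr_mono2') auto
        then have "M1 * (2 * real k) powr (- (\<alpha> + 1)) \<le> M1 * \<bar>real i - real j\<bar> powr (- (\<alpha> + 1))"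
          using pos by (intro mult_left_mono) auto
        moreover have "r\<^sup>2 / 2 * \<bar>D.corr i j\<bar> \<le> r\<^sup>2 / 2 * \<gamma>"
          using corr_wt(2)[OF ij] by (intro mult_left_mono) auto
        ultimately show ?thesis using decay by linarith
      next
        case False
        then show ?thesis using corr_wt(3)[OF ij] pos by simp
      qed
    qed (use p r pos last in \<open>auto simp: wt_def\<close>)
    show "cov_matrix p (density (lazy_cube p r) (\<lambda>x. ennreal (obs D x))) $$ (i, j)
        = (if (i, j) \<in> D then 0 + r\<^sup>2 * \<gamma> / 4 else 0 - r\<^sup>2 * \<gamma> / 4)" if "(i, j) \<in> K" for i j
    proof -
      have ij: "i < p" "j < p" "i \<noteq> j" using that K_sub K_notin[OF that] by auto
      have "cov_matrix p (D.law r 0) $$ (i, j) = 1 / 4 * r\<^sup>2 * wt D i j"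
        using D.cov_matrix_law[OF p r(1), of 0 i j] corr_wt(1)[OF ij that, of D] ij by simp
      also have "wt D i j = (if (i, j) \<in> D then \<gamma> else - \<gamma>)" using that by (simp add: wt_def)
      finally show ?thesis unfolding law by (cases "(i, j) \<in> D") simp_all
    qed
  next
    fix D \<kappa> x assume "\<kappa> \<in> K" "D \<subseteq> K - {\<kappa>}"
    then show "(1 - 4 * \<gamma>\<^sup>2) * ((obs (insert \<kappa> D) x + obs D x) / 2)\<^sup>2 \<le> obs (insert \<kappa> D) x * obs D x"
      using obs_neighbours[of "fst \<kappa>" "snd \<kappa>" D x] by simp
  qed (use \<gamma> \<gamma>_sq in auto)
  moreover have "real k / 8 \<le> real (card K) / real p"
  proof -
    have "real k * real p \<le> real k * (8 * real k * real nb)"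
      by (intro mult_left_mono nb_ge) auto
    also have "\<dots> \<le> 8 * real (card K)" using card_K by (simp add: power2_eq_square mult_ac)
    finally show ?thesis using p by (simp add: field_simps)
  qed
  then have "real k / 8 * ((r\<^sup>2 * \<gamma> / 4)\<^sup>2 * (1 - 4 * \<gamma>\<^sup>2) ^ n)
      \<le> real (card K) / real p * ((r\<^sup>2 * \<gamma> / 4)\<^sup>2 * (1 - 4 * \<gamma>\<^sup>2) ^ n)"
    using \<gamma>_sq by (intro mult_right_mono) auto
  ultimately show ?thesis by (meson ennreal_leI order_trans)
qed

end

section \<open>Tuning the block design to the sample size and the dimension\<close>

lemma minimax_risk_lower_rate:
  fixes \<alpha> M0 M1 \<rho> :: real
  assumes pos: "0 < \<alpha>" "0 < M0" "0 < M1" "0 < \<rho>"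
  obtains c where "0 < c" "\<And>n p. 1 \<le> n \<Longrightarrow> 1 \<le> p \<Longrightarrow>
    ennreal (c * min (real n powr (- ((2 * \<alpha> + 1) / (2 * (\<alpha> + 1))))) (real p / real n))
      \<le> minimax_risk n p (P'_class p \<alpha> M0 M1 \<rho>)"
proof -
  define e where "e = 1 / (2 * (\<alpha> + 1))"
  \<comment> \<open>The three terms serve the sub-Gaussian tail, the bound on the largest eigenvalue
    and the decay of the entries, in this order.\<close>
  define R where "R = min (1 / (2 * \<rho>)) (min (M0 / 2) (M1 * 2 powr (- (\<alpha> + 1))))"
  define r where "r = sqrt R"
  have "0 < R" using pos by (simp add: R_def)
  then have r: "0 < r" "r\<^sup>2 = R" by (auto simp: r_def)
  have "R \<le> 1 / (2 * \<rho>)" by (simp add: R_def)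
  then have r_le: "2 * \<rho> * r\<^sup>2 \<le> 1" "2 * r\<^sup>2 \<le> M0" "r\<^sup>2 \<le> M1 * 2 powr (- (\<alpha> + 1))"
    using pos unfolding r by (simp_all add: pos_le_divide_eq mult.commute) (auto simp: R_def)
  have e: "0 < e" "e \<le> 1 / 2" using pos by (auto simp: e_def field_simps)
  \<comment> \<open>\<open>32768 = 8 * 8 * (16 * 16 * 2)\<close>: one 8 is lost in rounding
    \<open>k\<close> and one in counting free entries; the rest comes from
    \<open>(r\<^sup>2 * \<gamma> / 4)\<^sup>2\<close>, from
    \<open>\<gamma>\<^sup>2 = 1 / (16 * real n)\<close> and from the affinity being at least
    \<open>1 / 2\<close>.\<close>
  have main: "ennreal (r ^ 4 / 32768 * min (real n powr (- ((2 * \<alpha> + 1) / (2 * (\<alpha> + 1))))) (real p / real n))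
      \<le> minimax_risk n p (P'_class p \<alpha> M0 M1 \<rho>)" if n: "1 \<le> n" and p: "1 \<le> p" for n p
  proof -
    let ?min = "min (real n powr (- ((2 * \<alpha> + 1) / (2 * (\<alpha> + 1))))) (real p / real n)"
    \<comment> \<open>With this choice \<open>4 * \<gamma>\<^sup>2 * real n = 1 / 4\<close>, so by
      Bernoulli's inequality the affinity of two neighbouring samples stays above
      \<open>1 / 2\<close>.\<close>
    define \<gamma> where "\<gamma> = 1 / 4 * real n powr (- (1 / 2))"
    have n0: "0 < real n" using n by simp
    have n_half: "real n powr (- (1 / 2)) \<le> 1"
      using n by (simp add: powr_le_one_le powr_minus field_simps ge_one_powr_ge_zero)
    have \<gamma>: "0 \<le> \<gamma>" "\<gamma> \<le> 1" using n_half by (auto simp: \<gamma>_def)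
    have \<gamma>_sq: "\<gamma>\<^sup>2 = 1 / (16 * real n)"
      using n0 by (simp add: \<gamma>_def power_mult_distrib powr_power powr_minus power_divide field_simps)
    have rate: "real n powr (- ((2 * \<alpha> + 1) / (2 * (\<alpha> + 1)))) = real n powr e / real n"
    proof -
      have "- ((2 * \<alpha> + 1) / (2 * (\<alpha> + 1))) = e - 1" using pos by (simp add: e_def field_simps)
      then show ?thesis using n0 by (simp add: powr_diff)
    qed
    have bern: "1 / 2 \<le> (1 - 4 * \<gamma>\<^sup>2) ^ n"
    proof -
      have "1 + real n * (- (4 * \<gamma>\<^sup>2)) \<le> (1 + (- (4 * \<gamma>\<^sup>2))) ^ n"
        using n by (intro Bernoulli_inequality) (simp add: \<gamma>_sq field_simps)
      moreover have "real n * (4 * \<gamma>\<^sup>2) = 1 / 4" using n0 by (simp add: \<gamma>_sq)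
      ultimately show ?thesis by simp
    qed
    have sq: "(r\<^sup>2 * \<gamma> / 4)\<^sup>2 = (r\<^sup>2)\<^sup>2 * \<gamma>\<^sup>2 / 16"
      by (simp add: power_mult_distrib power_divide)
    show ?thesis
    proof (cases "p \<le> 2")
      \<comment> \<open>No block fits, since \<open>block_design\<close> needs
        \<open>p \<ge> 3\<close>. Here the rate is at most \<open>2 / real n\<close>, the order at
        which a single variance can be estimated.\<close>
      case True
      have "(1 - 4 * \<gamma>\<^sup>2) ^ n \<le> (1 - \<gamma>\<^sup>2) ^ n"
        using n by (intro power_mono) (auto simp: \<gamma>_sq field_simps)
      then have b: "1 / 2 \<le> (1 - \<gamma>\<^sup>2) ^ n" using bern by linarith
      have "r ^ 4 / 32768 * ?min \<le> r ^ 4 / 32768 * (real p / real n)"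
        by (intro mult_left_mono) auto
      also have "\<dots> \<le> r ^ 4 / 32768 * (2 / real n)"
        using True n0 by (intro mult_left_mono divide_right_mono) auto
      also have "\<dots> \<le> 1 / 2 * ((r\<^sup>2)\<^sup>2 * \<gamma>\<^sup>2 / 16 * (1 / 2))"
        using n0 unfolding \<gamma>_sq by (simp add: field_simps)
      also have "\<dots> \<le> 1 / real p * ((r\<^sup>2 * \<gamma> / 4)\<^sup>2 * (1 - \<gamma>\<^sup>2) ^ n)"
        unfolding sq using True p b by (intro mult_mono mult_left_mono) (auto simp: field_simps)
      finally have "r ^ 4 / 32768 * ?min \<le> 1 / real p * ((r\<^sup>2 * \<gamma> / 4)\<^sup>2 * (1 - \<gamma>\<^sup>2) ^ n)" .
      also have "ennreal \<dots> \<le> minimax_risk n p (P'_class p \<alpha> M0 M1 \<rho>)"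
        using minimax_risk_variance_lower_bound[OF p r(1) r_le(1,2) pos(3,4) \<gamma>] .
      finally show ?thesis by (simp add: ennreal_leI)
    next
      case False
      \<comment> \<open>The first term is the ideal width, at which the admissible entries have the
        size of the noise; the second takes over when \<open>p\<close> is small and produces the
        rate \<open>p / n\<close>.\<close>
      define k where "k = min (nat \<lfloor>real n powr e\<rfloor>) ((p - 1) div 2)"
      have ne: "1 \<le> real n powr e" using n e by (intro ge_one_powr_ge_zero) auto
      have k1: "1 \<le> k" using False ne by (auto simp: k_def le_nat_iff)
      have k2: "2 * k \<le> p - 1" by (auto simp: k_def)
      have k3: "real k \<le> real n powr e"
      proof -
        have "k \<le> nat \<lfloor>real n powr e\<rfloor>" unfolding k_def by (rule min.cobounded1)
        then have "real k \<le> real (nat \<lfloor>real n powr e\<rfloor>)" by (rule of_nat_mono)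
        also have "\<dots> \<le> real n powr e" using ne by (intro of_nat_floor) auto
        finally show ?thesis .
      qed
      have k4: "min (real n powr e) (real p) \<le> 8 * real k"
      proof -
        have "1 \<le> \<lfloor>real n powr e\<rfloor>" using ne by (simp add: le_floor_iff)
        then have "1 \<le> real_of_int \<lfloor>real n powr e\<rfloor>" "real (nat \<lfloor>real n powr e\<rfloor>) = real_of_int \<lfloor>real n powr e\<rfloor>"
          by simp_all
        then have "real n powr e \<le> 2 * real (nat \<lfloor>real n powr e\<rfloor>)"
          using real_of_int_floor_add_one_gt[of "real n powr e"] by linarith
        moreover have "p \<le> 8 * ((p - 1) div 2)" using False by presburger
        then have "real p \<le> 8 * real ((p - 1) div 2)" by linarith
        ultimately have "min (real n powr e) (real p) \<le> 8 * real (nat \<lfloor>real n powr e\<rfloor>)"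
          "min (real n powr e) (real p) \<le> 8 * real ((p - 1) div 2)"
          by linarith+
        moreover have "k = nat \<lfloor>real n powr e\<rfloor> \<or> k = (p - 1) div 2"
          unfolding k_def min_def by auto
        ultimately show ?thesis by auto
      qed
      \<comment> \<open>As \<open>e \<le> 1 / 2\<close>, the ideal width never exceeds
        \<open>sqrt n\<close>, which is what keeps the conditional means bounded.\<close>
      have "real k \<le> real n powr (1 / 2)"
        using k3 powr_mono[OF e(2), of "real n"] n by simp
      then have \<gamma>k: "\<gamma> * real k \<le> 1 / 2"
        using mult_left_mono[of "real k" "real n powr (1 / 2)" \<gamma>] n0 \<gamma>
        by (simp add: \<gamma>_def powr_minus field_simps)
      interpret block_design p k \<gamma> using k1 k2 \<gamma>(1) \<gamma>k by unfold_locales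
      have "real k powr (\<alpha> + 1) \<le> (real n powr e) powr (\<alpha> + 1)"
        using k3 pos by (intro powr_mono2) auto
      also have "\<dots> = real n powr (1 / 2)"
      proof -
        have "e * (\<alpha> + 1) = 1 / 2" using pos by (simp add: e_def)
        then show ?thesis by (simp only: powr_powr)
      qed
      finally have "real n powr (- (1 / 2)) \<le> real k powr (- (\<alpha> + 1))"
        using k1 n0 unfolding powr_minus_divide by (intro frac_le) auto
      then have "r\<^sup>2 * real n powr (- (1 / 2)) \<le> (M1 * 2 powr (- (\<alpha> + 1))) * real k powr (- (\<alpha> + 1))"
        using r_le(3) pos by (intro mult_mono) auto
      moreover have "r\<^sup>2 / 2 * \<gamma> \<le> r\<^sup>2 * real n powr (- (1 / 2))"
        by (simp add: \<gamma>_def mult_left_mono)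
      ultimately have decay: "r\<^sup>2 / 2 * \<gamma> \<le> M1 * (2 * real k) powr (- (\<alpha> + 1))"
        using k1 by (simp add: powr_mult)
      have "r ^ 4 / 32768 * ?min = r ^ 4 / 32768 * (min (real n powr e) (real p) / real n)"
        using n0 unfolding rate by (simp add: min_divide_distrib_right)
      also have "\<dots> \<le> r ^ 4 / 32768 * (8 * real k / real n)"
        using k4 n0 by (intro mult_left_mono divide_right_mono) auto
      also have "\<dots> = real k / 8 * ((r\<^sup>2)\<^sup>2 * \<gamma>\<^sup>2 / 16 * (1 / 2))"
        using n0 unfolding \<gamma>_sq by (simp add: field_simps)
      also have "\<dots> \<le> real k / 8 * ((r\<^sup>2 * \<gamma> / 4)\<^sup>2 * (1 - 4 * \<gamma>\<^sup>2) ^ n)"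
        unfolding sq using bern by (intro mult_left_mono) auto
      finally have "r ^ 4 / 32768 * ?min \<le> real k / 8 * ((r\<^sup>2 * \<gamma> / 4)\<^sup>2 * (1 - 4 * \<gamma>\<^sup>2) ^ n)" .
      also have "ennreal \<dots> \<le> minimax_risk n p (P'_class p \<alpha> M0 M1 \<rho>)"
        using minimax_risk_ge[OF r(1) r_le(1,2) pos(3,4,1) decay] .
      finally show ?thesis by (simp add: ennreal_leI)
    qed
  qed
  show ?thesis
    by (rule that[of "r ^ 4 / 32768"]) (use r main in auto)
qed

section \<open>Exponential moments\<close>

text \<open>The value of \<open>1\<close> plus the series with terms
  \<open>exp (b * (j + 1)) * exp (- 2 * b * j)\<close>.\<close>

definition tail_const :: "real \<Rightarrow> real" where
  "tail_const b = 1 + exp b / (1 - exp (- b))"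

lemma tail_const_ge_1: "0 < b \<Longrightarrow> 1 \<le> tail_const b"
  by (simp add: tail_const_def)

lemma ennreal_suminf_term_le: "f j \<le> (\<Sum>j. f j)" for f :: "nat \<Rightarrow> ennreal"
  using sum_le_suminf[of f "{j}"] by simp

text \<open>Space is cut into the layers \<open>j < (V x)\<^sup>2 \<le> j + 1\<close>. The tail
  exponent is twice that of the moment, so the layers contribute a geometric series; the additional
  \<open>1\<close> covers the zeros of \<open>V\<close>.\<close>

lemma nn_integral_exp_square_le:
  fixes V :: "'a \<Rightarrow> real"
  assumes M: "prob_space M" and V[measurable]: "V \<in> borel_measurable M" and b: "0 < b"
    and tail: "\<And>t. 0 < t \<Longrightarrow> measure M {x \<in> space M. t < \<bar>V x\<bar>} \<le> exp (- (2 * b * t\<^sup>2))"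
  shows "(\<integral>\<^sup>+x. ennreal (exp (b * (V x)\<^sup>2)) \<partial>M) \<le> ennreal (tail_const b)"
proof -
  interpret prob_space M by fact
  let ?A = "\<lambda>j::nat. {x \<in> space M. real j < (V x)\<^sup>2}"
  have [measurable]: "?A j \<in> sets M" for j by measurable
  have pm: "emeasure M (?A j) \<le> ennreal (exp (- (2 * b * real j)))" for j
  proof (cases "j = 0")
    case True
    then show ?thesis by (simp add: emeasure_le_1)
  next
    case False
    have "?A j = {x \<in> space M. sqrt (real j) < \<bar>V x\<bar>}"
      by (auto simp: real_less_rsqrt real_sqrt_less_iff[of "real j" "(V _)\<^sup>2", symmetric] simp del: real_sqrt_less_iff)
    then show ?thesis
      using tail[of "sqrt (real j)"] False by (simp add: emeasure_eq_measure)
  qed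
  have ratio: "0 \<le> exp (- b)" "exp (- b) < 1" using b by auto
  have "(\<integral>\<^sup>+x. ennreal (exp (b * (V x)\<^sup>2)) \<partial>M)
      \<le> (\<integral>\<^sup>+x. 1 + (\<Sum>j. ennreal (exp (b * (real j + 1))) * indicator (?A j) x) \<partial>M)"
  proof (rule nn_integral_mono)
    fix x assume x: "x \<in> space M"
    show "ennreal (exp (b * (V x)\<^sup>2)) \<le> 1 + (\<Sum>j. ennreal (exp (b * (real j + 1))) * indicator (?A j) x)"
    proof (cases "V x = 0")
      case False
      define j where "j = nat (\<lceil>(V x)\<^sup>2\<rceil> - 1)"
      have "0 < (V x)\<^sup>2" using False by simp
      then have "0 < \<lceil>(V x)\<^sup>2\<rceil>" by simp
      then have "real j = real_of_int \<lceil>(V x)\<^sup>2\<rceil> - 1" by (simp add: j_def)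
      then have j: "real j < (V x)\<^sup>2" "(V x)\<^sup>2 \<le> real j + 1" by linarith+
      have "ennreal (exp (b * (V x)\<^sup>2)) \<le> ennreal (exp (b * (real j + 1))) * indicator (?A j) x"
        using j b x by (simp add: ennreal_leI)
      also have "\<dots> \<le> (\<Sum>j. ennreal (exp (b * (real j + 1))) * indicator (?A j) x)"
        by (rule ennreal_suminf_term_le[of "\<lambda>j. ennreal (exp (b * (real j + 1))) * indicator (?A j) x"])
      also have "\<dots> \<le> 1 + \<dots>" by (simp add: add_increasing)
      finally show ?thesis .
    qed simp
  qed
  also have "\<dots> = 1 + (\<Sum>j. ennreal (exp (b * (real j + 1))) * emeasure M (?A j))"
    by (simp add: nn_integral_add nn_integral_suminf nn_integral_cmult emeasure_space_1)
  also have "\<dots> \<le> 1 + (\<Sum>j. ennreal (exp b * exp (- b) ^ j))"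
  proof (intro add_left_mono suminf_le allI)
    fix j
    have "ennreal (exp (b * (real j + 1))) * emeasure M (?A j)
        \<le> ennreal (exp (b * (real j + 1))) * ennreal (exp (- (2 * b * real j)))"
      by (intro mult_left_mono pm) auto
    also have "\<dots> = ennreal (exp b * exp (- b) ^ j)"
      by (simp add: ennreal_mult[symmetric] exp_of_nat_mult[symmetric] exp_add[symmetric] algebra_simps)
    finally show "ennreal (exp (b * (real j + 1))) * emeasure M (?A j) \<le> ennreal (exp b * exp (- b) ^ j)" .
  qed auto
  also have "(\<Sum>j. ennreal (exp b * exp (- b) ^ j)) = ennreal (exp b / (1 - exp (- b)))"
    using sums_mult[OF geometric_sums[of "exp (- b)"], of "exp b"] ratio
    by (intro suminf_ennreal_eq) auto
  also have "1 + ennreal (exp b / (1 - exp (- b))) = ennreal (tail_const b)"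
    using ratio by (simp add: tail_const_def ennreal_plus[symmetric] flip: ennreal_1 del: ennreal_plus)
  finally show ?thesis .
qed

lemma exp_le_quadratic: "exp u \<le> 1 + u + u\<^sup>2 * exp \<bar>u\<bar>" for u :: real
proof -
  obtain t where t: "\<bar>t\<bar> \<le> \<bar>u\<bar>" "exp u = (\<Sum>m<2. (u ^ m) / fact m) + (exp t / fact 2) * u ^ 2"
    using Maclaurin_exp_le[of u 2] by blast
  have "exp t / fact 2 * u ^ 2 \<le> exp \<bar>u\<bar> * u ^ 2"
    using t(1) by (intro mult_right_mono) (auto intro!: divide_le_eq_numeral1(1)[THEN iffD2] order_trans[of "exp t" "exp \<bar>u\<bar>"] simp: abs_le_iff)
  then show ?thesis using t(2) by (simp add: eval_nat_numeral lessThan_Suc mult.commute)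
qed

text \<open>In \<open>exp_le_quadratic\<close> the linear term has mean zero. Of the available
  exponent \<open>\<beta>\<close>, one half absorbs the square, at the price
  \<open>8 / \<beta>\<^sup>2\<close>, and the other half absorbs
  \<open>exp \<bar>s * z\<bar>\<close>. Centring costs the factor \<open>exp K\<close>, because
  \<open>\<beta>\<close> times the modulus of the mean is at most \<open>K\<close>.\<close>

lemma (in prob_space) centred_mgf_le:
  assumes Z[measurable]: "random_variable borel Z" and \<beta>: "0 < \<beta>" and K: "0 \<le> K"
    and mom: "(\<integral>\<^sup>+x. ennreal (exp (\<beta> * \<bar>Z x\<bar>)) \<partial>M) \<le> ennreal K" and s: "\<bar>s\<bar> \<le> \<beta> / 2"
  shows "(\<integral>\<^sup>+x. ennreal (exp (s * (Z x - expectation Z))) \<partial>M) \<le> ennreal (exp (s\<^sup>2 * (8 / \<beta>\<^sup>2 * (K * exp K))))"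
proof -
  let ?\<sigma> = "expectation Z"
  have int_exp: "integrable M (\<lambda>x. exp (\<beta> * \<bar>Z x\<bar>))"
    using mom by (intro integrableI_nonneg) (auto intro: le_less_trans[of _ "ennreal K"])
  have exp_K: "expectation (\<lambda>x. exp (\<beta> * \<bar>Z x\<bar>)) \<le> K"
    using mom K int_exp by (subst (asm) nn_integral_eq_integral) (auto simp: ennreal_le_iff)
  have le_exp: "\<beta> * \<bar>Z x\<bar> \<le> exp (\<beta> * \<bar>Z x\<bar>)" for x
    using exp_ge_add_one_self[of "\<beta> * \<bar>Z x\<bar>"] by linarith
  have intZ: "integrable M (\<lambda>x. \<beta> * Z x)"
  proof (rule Bochner_Integration.integrable_bound[OF int_exp])
    show "AE x in M. norm (\<beta> * Z x) \<le> norm (exp (\<beta> * \<bar>Z x\<bar>))"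
    proof (rule AE_I2)
      fix x
      show "norm (\<beta> * Z x) \<le> norm (exp (\<beta> * \<bar>Z x\<bar>))" using \<beta> le_exp[of x] by (simp add: abs_mult)
    qed
  qed simp
  have \<sigma>: "\<beta> * \<bar>?\<sigma>\<bar> \<le> K"
  proof -
    have "\<beta> * \<bar>?\<sigma>\<bar> = \<bar>expectation (\<lambda>x. \<beta> * Z x)\<bar>" using \<beta> by (simp add: abs_mult)
    also have "\<dots> \<le> expectation (\<lambda>x. \<bar>\<beta> * Z x\<bar>)" by (rule integral_abs_bound)
    also have "\<dots> \<le> expectation (\<lambda>x. exp (\<beta> * \<bar>Z x\<bar>))"
    proof (rule integral_mono[OF _ int_exp])
      show "integrable M (\<lambda>x. \<bar>\<beta> * Z x\<bar>)" using intZ by simp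
      fix x
      show "\<bar>\<beta> * Z x\<bar> \<le> exp (\<beta> * \<bar>Z x\<bar>)" using \<beta> le_exp[of x] by (simp add: abs_mult)
    qed
    finally show ?thesis using exp_K by simp
  qed
  have intZ': "integrable M Z" using intZ \<beta> by simp
  have int_cexp: "integrable M (\<lambda>x. exp (\<beta> * \<bar>Z x - ?\<sigma>\<bar>))"
    and cexp_K: "expectation (\<lambda>x. exp (\<beta> * \<bar>Z x - ?\<sigma>\<bar>)) \<le> K * exp K"
  proof -
    have bd: "exp (\<beta> * \<bar>Z x - ?\<sigma>\<bar>) \<le> exp K * exp (\<beta> * \<bar>Z x\<bar>)" for x
    proof -
      have "\<beta> * \<bar>Z x - ?\<sigma>\<bar> \<le> \<beta> * (\<bar>Z x\<bar> + \<bar>?\<sigma>\<bar>)" using \<beta> by (intro mult_left_mono) auto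
      then show ?thesis using \<sigma> by (simp add: exp_add[symmetric] distrib_left)
    qed
    show int: "integrable M (\<lambda>x. exp (\<beta> * \<bar>Z x - ?\<sigma>\<bar>))"
      by (rule Bochner_Integration.integrable_bound[OF integrable_mult_right[OF int_exp, of "exp K"]])
        (use bd in auto)
    have "expectation (\<lambda>x. exp (\<beta> * \<bar>Z x - ?\<sigma>\<bar>)) \<le> expectation (\<lambda>x. exp K * exp (\<beta> * \<bar>Z x\<bar>))"
      by (rule integral_mono[OF int integrable_mult_right[OF int_exp] bd])
    also have "\<dots> \<le> exp K * K" using exp_K by simp
    finally show "expectation (\<lambda>x. exp (\<beta> * \<bar>Z x - ?\<sigma>\<bar>)) \<le> K * exp K" by (simp add: mult.commute)
  qed
  let ?B = "\<lambda>x. 1 + s * (Z x - ?\<sigma>) + s\<^sup>2 * (8 / \<beta>\<^sup>2 * exp (\<beta> * \<bar>Z x - ?\<sigma>\<bar>))"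
  have pw: "exp (s * (Z x - ?\<sigma>)) \<le> ?B x" for x
  proof -
    define z where "z = Z x - ?\<sigma>"
    have "z\<^sup>2 \<le> 8 / \<beta>\<^sup>2 * exp (\<beta> / 2 * \<bar>z\<bar>)"
    proof -
      have "(\<beta> / 2 * \<bar>z\<bar>)\<^sup>2 / 2 \<le> exp (\<beta> / 2 * \<bar>z\<bar>)"
      proof -
        have nn: "0 \<le> \<beta> / 2 * \<bar>z\<bar>" using \<beta> by simp
        then show ?thesis using exp_lower_Taylor_quadratic[OF nn] by linarith
      qed
      then show ?thesis using \<beta> by (simp add: power_mult_distrib power_divide field_simps)
    qed
    moreover have "exp \<bar>s * z\<bar> \<le> exp (\<beta> / 2 * \<bar>z\<bar>)"
      using mult_right_mono[OF s abs_ge_zero[of z]] by (simp add: abs_mult)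
    ultimately have "z\<^sup>2 * exp \<bar>s * z\<bar> \<le> (8 / \<beta>\<^sup>2 * exp (\<beta> / 2 * \<bar>z\<bar>)) * exp (\<beta> / 2 * \<bar>z\<bar>)"
      by (intro mult_mono) auto
    also have "\<dots> = 8 / \<beta>\<^sup>2 * exp (\<beta> * \<bar>z\<bar>)"
      by (simp add: exp_add[symmetric])
    finally have "s\<^sup>2 * (z\<^sup>2 * exp \<bar>s * z\<bar>) \<le> s\<^sup>2 * (8 / \<beta>\<^sup>2 * exp (\<beta> * \<bar>z\<bar>))"
      by (rule mult_left_mono) simp
    then show ?thesis
      using exp_le_quadratic[of "s * z"] by (simp add: z_def power_mult_distrib mult.assoc)
  qed
  have int_B: "integrable M ?B"
    using intZ' int_cexp by auto
  have "(\<integral>\<^sup>+x. ennreal (exp (s * (Z x - ?\<sigma>))) \<partial>M) \<le> (\<integral>\<^sup>+x. ennreal (?B x) \<partial>M)"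
    by (intro nn_integral_mono ennreal_leI pw)
  also have "\<dots> = ennreal (expectation ?B)"
    by (intro nn_integral_eq_integral int_B AE_I2 order_trans[OF _ pw]) simp
  also have "expectation ?B = 1 + s\<^sup>2 * (8 / \<beta>\<^sup>2 * expectation (\<lambda>x. exp (\<beta> * \<bar>Z x - ?\<sigma>\<bar>)))"
    using intZ' int_cexp by (simp add: prob_space)
  also have "\<dots> \<le> 1 + s\<^sup>2 * (8 / \<beta>\<^sup>2 * (K * exp K))"
    using \<beta> by (intro add_left_mono mult_left_mono cexp_K) auto
  also have "\<dots> \<le> exp (s\<^sup>2 * (8 / \<beta>\<^sup>2 * (K * exp K)))" by (rule exp_ge_add_one_self)
  finally show ?thesis by (simp add: ennreal_leI)
qed

text \<open>At \<open>s = \<beta> / 2 / sqrt (real m)\<close> each summand contributes a factor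
  \<open>exp (2 * (K * exp K) / real m)\<close>, so the product over the sample does not depend on
  \<open>m\<close>. The modulus is handled by adding the bounds for \<open>s\<close> and
  \<open>- s\<close>.\<close>

lemma (in prob_space) sample_mean_exp_moment:
  fixes Z :: "nat \<Rightarrow> 'a \<Rightarrow> real"
  assumes m: "1 \<le> m" and indep: "indep_vars (\<lambda>_. borel) Z {..<m}" and \<beta>: "0 < \<beta>" and K: "0 \<le> K"
    and mom: "\<And>l. l < m \<Longrightarrow> (\<integral>\<^sup>+x. ennreal (exp (\<beta> * \<bar>Z l x\<bar>)) \<partial>M) \<le> ennreal K"
    and mean: "\<And>l. l < m \<Longrightarrow> expectation (Z l) = \<sigma>"
  shows "(\<integral>\<^sup>+x. ennreal (exp (\<beta> / 2 * (sqrt (real m) * \<bar>(\<Sum>l<m. Z l x) / real m - \<sigma>\<bar>))) \<partial>M)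
    \<le> ennreal (2 * exp (2 * (K * exp K)))"
proof -
  let ?C = "exp (2 * (K * exp K))"
  let ?W = "\<lambda>x. exp (\<beta> / 2 * (sqrt (real m) * \<bar>(\<Sum>l<m. Z l x) / real m - \<sigma>\<bar>))"
  let ?D = "\<lambda>s. exp (s\<^sup>2 * (8 / \<beta>\<^sup>2 * (K * exp K)))"
  have Z[measurable]: "random_variable borel (Z l)" if "l < m" for l
    using indep that by (auto simp: indep_vars_def)
  define E where "E s x = (\<Prod>l<m. exp (s * (Z l x - \<sigma>)))" for s x
  have E_le: "(\<integral>\<^sup>+x. ennreal (E s x) \<partial>M) \<le> ennreal ?C"
    if s: "\<bar>s\<bar> = \<beta> / 2 / sqrt (real m)" for s
  proof -
    have s2: "s\<^sup>2 = \<beta>\<^sup>2 / 4 / real m"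
      using arg_cong[OF s, of "\<lambda>x. x\<^sup>2"] by (simp add: power_divide)
    have s_le: "\<bar>s\<bar> \<le> \<beta> / 2"
    proof -
      have "1 \<le> sqrt (real m)" using m by simp
      then have "\<beta> / 2 / sqrt (real m) \<le> \<beta> / 2 / 1" using \<beta> by (intro divide_left_mono) auto
      then show ?thesis using s by simp
    qed
    have ind: "indep_vars (\<lambda>_. borel) (\<lambda>l x. ennreal (exp (s * (Z l x - \<sigma>)))) {..<m}"
      by (rule indep_vars_compose2[OF indep]) measurable
    have "(\<integral>\<^sup>+x. ennreal (E s x) \<partial>M) = (\<integral>\<^sup>+x. (\<Prod>l<m. ennreal (exp (s * (Z l x - \<sigma>)))) \<partial>M)"
      by (simp add: E_def prod_ennreal)
    also have "\<dots> = (\<Prod>l<m. \<integral>\<^sup>+x. ennreal (exp (s * (Z l x - \<sigma>))) \<partial>M)"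
      by (rule indep_vars_nn_integral[OF _ ind]) auto
    also have "\<dots> \<le> (\<Prod>l<m. ennreal (?D s))"
    proof (rule prod_mono_ennreal)
      fix l assume "l \<in> {..<m}"
      then have l: "l < m" by simp
      show "(\<integral>\<^sup>+x. ennreal (exp (s * (Z l x - \<sigma>))) \<partial>M) \<le> ennreal (?D s)"
        using centred_mgf_le[OF Z[OF l] \<beta> K mom[OF l] s_le] mean[OF l] by simp
    qed
    also have "\<dots> = ennreal (exp (real m * (s\<^sup>2 * (8 / \<beta>\<^sup>2 * (K * exp K)))))"
      unfolding exp_of_nat_mult by (simp add: ennreal_power)
    also have "real m * (s\<^sup>2 * (8 / \<beta>\<^sup>2 * (K * exp K))) = 2 * (K * exp K)"
      using m \<beta> unfolding s2 by (simp add: field_simps)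
    finally show ?thesis .
  qed
  let ?s = "\<beta> / 2 / sqrt (real m)"
  have pw: "?W x \<le> E ?s x + E (- ?s) x" for x
  proof -
    let ?N = "(\<Sum>l<m. Z l x) / real m - \<sigma>"
    have E_eq: "E s x = exp (s * (real m * ?N))" for s
      using m by (simp add: E_def exp_sum[symmetric] sum_distrib_left[symmetric] sum_subtractf right_diff_distrib)
    have "?s * (real m * ?N) = \<beta> / 2 * (sqrt (real m) * ?N)"
    proof -
      have "?s * (real m * ?N) = \<beta> / 2 * ((real m / sqrt (real m)) * ?N)" by simp
      also have "real m / sqrt (real m) = sqrt (real m)" by (rule real_div_sqrt) simp
      finally show ?thesis .
    qed
    then have "E ?s x = exp (\<beta> / 2 * (sqrt (real m) * ?N))" "E (- ?s) x = exp (- (\<beta> / 2 * (sqrt (real m) * ?N)))"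
      unfolding E_eq by simp_all
    moreover have "exp (c * (r * \<bar>z\<bar>)) \<le> exp (c * (r * z)) + exp (- (c * (r * z)))" for c r z :: real
      by (cases "0 \<le> z") auto
    ultimately show ?thesis by (simp only:)
  qed
  have Em: "(\<lambda>x. ennreal (E s x)) \<in> borel_measurable M" for s
    unfolding E_def by measurable
  have "(\<integral>\<^sup>+x. ennreal (?W x) \<partial>M)
      \<le> (\<integral>\<^sup>+x. ennreal (E ?s x) + ennreal (E (- ?s) x) \<partial>M)"
    using pw by (intro nn_integral_mono) (simp add: ennreal_plus[symmetric] ennreal_leI E_def prod_nonneg del: ennreal_plus)
  also have "\<dots> = (\<integral>\<^sup>+x. ennreal (E ?s x) \<partial>M) + (\<integral>\<^sup>+x. ennreal (E (- ?s) x) \<partial>M)"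
    by (rule nn_integral_add[OF Em Em])
  also have "\<dots> \<le> ennreal ?C + ennreal ?C"
    using \<beta> by (intro add_mono E_le) auto
  also have "\<dots> = ennreal (2 * ?C)"
    by (simp add: ennreal_plus[symmetric] del: ennreal_plus)
  finally show ?thesis .
qed

section \<open>Sample covariances of paired differences\<close>

lemma indep_vars_PiM_coords:
  assumes P: "prob_space P" and I: "I \<noteq> {}"
  shows "prob_space.indep_vars (Pi\<^sub>M I (\<lambda>_. P)) (\<lambda>_. P) (\<lambda>i X. X i) I"
proof -
  interpret PM: prob_space "Pi\<^sub>M I (\<lambda>_. P)" by (intro prob_space_PiM P)
  have "distr (Pi\<^sub>M I (\<lambda>_. P)) (Pi\<^sub>M I (\<lambda>_. P)) (\<lambda>X. \<lambda>i\<in>I. X i) = distr (Pi\<^sub>M I (\<lambda>_. P)) (Pi\<^sub>M I (\<lambda>_. P)) (\<lambda>X. X)"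
    by (rule distr_cong) (auto simp: space_PiM PiE_def extensional_restrict)
  also have "\<dots> = Pi\<^sub>M I (\<lambda>i. distr (Pi\<^sub>M I (\<lambda>_. P)) P (\<lambda>X. X i))"
    by (simp add: distr_PiM_component[OF P] cong: PiM_cong)
  finally show ?thesis
    using I by (subst PM.indep_vars_iff_distr_eq_PiM') auto
qed

lemma expectation_PiM_mult:
  fixes f g :: "'a \<Rightarrow> real"
  assumes P: "prob_space P" and I: "finite I" "a \<in> I" "b \<in> I" "a \<noteq> b" and f: "integrable P f" and g: "integrable P g"
  shows "(\<integral>X. f (X a) * g (X b) \<partial>Pi\<^sub>M I (\<lambda>_. P)) = (\<integral>x. f x \<partial>P) * (\<integral>x. g x \<partial>P)"
    and "integrable (Pi\<^sub>M I (\<lambda>_. P)) (\<lambda>X. f (X a) * g (X b))"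
proof -
  interpret P: prob_space P by fact
  interpret PM: product_sigma_finite "\<lambda>_. P" by standard
  let ?h = "\<lambda>i x. (if i = a then f x else 1) * (if i = b then g x else 1)"
  have prod_eq: "(\<Prod>i\<in>I. ?h i (X i)) = f (X a) * g (X b)" for X
    using I by (simp add: prod.distrib)
  have int: "integrable P (?h i)" for i
    using f g I by (cases "i = a"; cases "i = b") auto
  have "(\<integral>X. f (X a) * g (X b) \<partial>Pi\<^sub>M I (\<lambda>_. P)) = (\<Prod>i\<in>I. \<integral>x. ?h i x \<partial>P)"
    unfolding prod_eq[symmetric] by (rule PM.product_integral_prod[OF I(1) int])
  also have "\<dots> = (\<Prod>i\<in>I. (if i = a then \<integral>x. f x \<partial>P else 1) * (if i = b then \<integral>x. g x \<partial>P else 1))"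
    using I by (intro prod.cong refl) (auto simp: P.prob_space)
  also have "\<dots> = (\<integral>x. f x \<partial>P) * (\<integral>x. g x \<partial>P)"
    using I by (simp add: prod.distrib)
  finally show "(\<integral>X. f (X a) * g (X b) \<partial>Pi\<^sub>M I (\<lambda>_. P)) = (\<integral>x. f x \<partial>P) * (\<integral>x. g x \<partial>P)" .
  show "integrable (Pi\<^sub>M I (\<lambda>_. P)) (\<lambda>X. f (X a) * g (X b))"
    unfolding prod_eq[symmetric] by (rule PM.product_integrable_prod[OF I(1) int])
qed

lemma PiM_component_integral:
  fixes f :: "'a \<Rightarrow> real"
  assumes P: "prob_space P" and a: "a \<in> I"
  shows "f \<in> borel_measurable P \<Longrightarrow> (\<integral>X. f (X a) \<partial>Pi\<^sub>M I (\<lambda>_. P)) = (\<integral>x. f x \<partial>P)"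
    and "integrable P f \<Longrightarrow> integrable (Pi\<^sub>M I (\<lambda>_. P)) (\<lambda>X. f (X a))"
    and "F \<in> borel_measurable P \<Longrightarrow> (\<integral>\<^sup>+X. F (X a) \<partial>Pi\<^sub>M I (\<lambda>_. P)) = (\<integral>\<^sup>+x. F x \<partial>P)"
proof -
  have d: "distr (Pi\<^sub>M I (\<lambda>_. P)) P (\<lambda>X. X a) = P"
    using a by (rule distr_PiM_component[OF P])
  have m: "(\<lambda>X. X a) \<in> Pi\<^sub>M I (\<lambda>_. P) \<rightarrow>\<^sub>M P" using a by (rule measurable_component_singleton)
  show "(\<integral>X. f (X a) \<partial>Pi\<^sub>M I (\<lambda>_. P)) = (\<integral>x. f x \<partial>P)" if "f \<in> borel_measurable P"
    using integral_distr[OF m that] by (simp add: d)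
  show "integrable (Pi\<^sub>M I (\<lambda>_. P)) (\<lambda>X. f (X a))" if "integrable P f"
    using integrable_distr[OF m, of f] that by (simp add: d)
  show "(\<integral>\<^sup>+X. F (X a) \<partial>Pi\<^sub>M I (\<lambda>_. P)) = (\<integral>\<^sup>+x. F x \<partial>P)" if "F \<in> borel_measurable P"
    using nn_integral_distr[OF m, of F] that by (simp add: d)
qed

lemma exp_mean_le: "exp ((a + b) / 2) \<le> (exp a + exp b) / 2" for a b :: real
proof -
  have "exp ((a + b) / 2) = sqrt (exp a * exp b)"
    by (rule real_sqrt_unique[symmetric]) (simp_all add: exp_add[symmetric] power2_eq_square)
  also have "\<dots> \<le> (exp a + exp b) / 2" by (rule arith_geo_mean_sqrt) auto
  finally show ?thesis .
qed

lemma exp_mean4_le: "exp ((a + b + c + d) / 4) \<le> (exp a + exp b + exp c + exp d) / 4" for a b c d :: real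
proof -
  have "exp ((a + b + c + d) / 4) = exp (((a + b) / 2 + (c + d) / 2) / 2)"
    by (simp add: add_divide_distrib)
  also have "\<dots> \<le> (exp ((a + b) / 2) + exp ((c + d) / 2)) / 2" by (rule exp_mean_le)
  also have "\<dots> \<le> ((exp a + exp b) / 2 + (exp c + exp d) / 2) / 2"
    by (intro divide_right_mono add_mono exp_mean_le) simp
  also have "\<dots> = (exp a + exp b + exp c + exp d) / 4"
    by (simp add: add_divide_distrib)
  finally show ?thesis .
qed

text \<open>Halving compensates for the difference of two independent copies having twice the
  covariance.\<close>

definition pair_product :: "nat \<Rightarrow> nat \<Rightarrow> nat \<Rightarrow> (nat \<Rightarrow> nat \<Rightarrow> real) \<Rightarrow> real" where
  "pair_product i j l X = (X (2 * l) i - X (2 * l + 1) i) * (X (2 * l) j - X (2 * l + 1) j) / 2"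

text \<open>Differencing disjoint pairs of observations removes the unknown mean and keeps the summands independent.\<close>

definition pair_cov :: "nat \<Rightarrow> nat \<Rightarrow> nat \<Rightarrow> (nat \<Rightarrow> nat \<Rightarrow> real) \<Rightarrow> real" where
  "pair_cov m i j X = (\<Sum>l<m. pair_product i j l X) / real m"

lemma pair_product_measurable:
  assumes "i < p" "j < p" "2 * l + 1 < n"
  shows "pair_product i j l \<in> borel_measurable (Pi\<^sub>M {..<n} (\<lambda>_. vec_borel p))"
proof -
  have [measurable]: "(\<lambda>X. X k i) \<in> borel_measurable (Pi\<^sub>M {..<n} (\<lambda>_. vec_borel p))" if "k < n" "i < p" for k i
    using that by (intro measurable_compose[of "\<lambda>X. X k" _ "vec_borel p" "\<lambda>x. x i"] measurable_component_singleton) auto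
  have "2 * l < n" using assms by simp
  then show ?thesis
    unfolding pair_product_def[abs_def] using assms
    by (intro borel_measurable_divide borel_measurable_times borel_measurable_diff borel_measurable_const) auto
qed

lemma pair_cov_measurable:
  assumes "i < p" "j < p" "2 * m \<le> n"
  shows "pair_cov m i j \<in> borel_measurable (Pi\<^sub>M {..<n} (\<lambda>_. vec_borel p))"
  unfolding pair_cov_def[abs_def] using assms
  by (intro borel_measurable_divide borel_measurable_sum pair_product_measurable borel_measurable_const) auto

locale sub_gaussian_sample =
  fixes n p :: nat and \<rho> :: real and P :: "(nat \<Rightarrow> real) measure"
  assumes \<rho>: "0 < \<rho>" and L2: "P \<in> L2_distributions p" and sg: "sub_gaussian p \<rho> P"
begin

abbreviation "sample \<equiv> Pi\<^sub>M {..<n} (\<lambda>_. P)"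

lemma sets_P[measurable_cong]: "sets P = sets (vec_borel p)" and prob_P: "prob_space P"
  using L2 by (auto simp: L2_distributions_def)

lemma coord_meas[measurable]: "i < p \<Longrightarrow> (\<lambda>x. x i) \<in> borel_measurable P"
  by (subst measurable_cong_sets[OF sets_P refl]) auto

lemma prob_sample: "prob_space sample"
  by (intro prob_space_PiM prob_P)

text \<open>Sub-Gaussianity in the direction of a coordinate axis; the exponent is written as
  \<open>nn_integral_exp_square_le\<close> expects it for \<open>b = \<rho> / 4\<close>.\<close>

lemma coord_tail:
  assumes i: "i < p" and t: "0 < t"
  shows "measure P {x \<in> space P. t < \<bar>x i - mean_vec P i\<bar>} \<le> exp (- (2 * (\<rho> / 4) * t\<^sup>2))"
proof -
  let ?v = "\<lambda>k. if k = i then 1 else 0 :: real"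
  have "L2_set ?v {..<p} = 1"
    using i by (simp add: L2_set_def if_distrib[of "\<lambda>x. x\<^sup>2"] cong: if_cong)
  then have "measure P {x \<in> space P. \<bar>\<Sum>k<p. ?v k * (x k - mean_vec P k)\<bar> > t} \<le> exp (- (t\<^sup>2 * \<rho> / 2))"
    using sg t unfolding sub_gaussian_def by blast
  moreover have "(\<Sum>k<p. ?v k * (x k - mean_vec P k)) = x i - mean_vec P i" for x
    using i by (simp add: if_distrib[of "\<lambda>x. x * _"] cong: if_cong)
  ultimately show ?thesis by (simp add: mult.commute)
qed

abbreviation K where "K \<equiv> tail_const (\<rho> / 4)"

lemma coord_exp_moment:
  assumes i: "i < p"
  shows "(\<integral>\<^sup>+x. ennreal (exp (\<rho> / 4 * (x i - mean_vec P i)\<^sup>2)) \<partial>P) \<le> ennreal K"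
proof (rule nn_integral_exp_square_le[OF prob_P])
  show "(\<lambda>x. x i - mean_vec P i) \<in> borel_measurable P" using i by measurable
  show "0 < \<rho> / 4" using \<rho> by simp
qed (rule coord_tail[OF i])

lemma coord_sq_integrable: "i < p \<Longrightarrow> integrable P (\<lambda>x. (x i)\<^sup>2)"
  using L2 by (auto simp: L2_distributions_def)

lemma coord_mult_integrable: "i < p \<Longrightarrow> j < p \<Longrightarrow> integrable P (\<lambda>x. x i * x j)"
proof -
  assume ij: "i < p" "j < p"
  show "integrable P (\<lambda>x. x i * x j)"
  proof (rule Bochner_Integration.integrable_bound)
    show "integrable P (\<lambda>x. (x i)\<^sup>2 + (x j)\<^sup>2)" using coord_sq_integrable ij by auto
    show "AE x in P. norm (x i * x j) \<le> norm ((x i)\<^sup>2 + (x j)\<^sup>2)"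
    proof (rule AE_I2)
      fix x :: "nat \<Rightarrow> real"
      have "2 * (\<bar>x i\<bar> * \<bar>x j\<bar>) \<le> (x i)\<^sup>2 + (x j)\<^sup>2"
        using sum_squares_bound[of "\<bar>x i\<bar>" "\<bar>x j\<bar>"] by simp
      moreover have "0 \<le> \<bar>x i\<bar> * \<bar>x j\<bar>" by simp
      moreover have "norm (x i * x j) = \<bar>x i\<bar> * \<bar>x j\<bar>" "norm ((x i)\<^sup>2 + (x j)\<^sup>2) = (x i)\<^sup>2 + (x j)\<^sup>2"
        by (simp_all add: abs_mult)
      ultimately show "norm (x i * x j) \<le> norm ((x i)\<^sup>2 + (x j)\<^sup>2)" by linarith
    qed
  qed (use ij in measurable)
qed

lemma coord_integrable: "i < p \<Longrightarrow> integrable P (\<lambda>x. x i)"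
proof -
  assume i: "i < p"
  interpret prob_space P by (rule prob_P)
  show ?thesis
    using square_integrable_imp_integrable[OF coord_meas[OF i] coord_sq_integrable[OF i]] .
qed

text \<open>Differences do not change when the coordinates are centred. After expansion the cross
  terms factor by independence and vanish, and the two remaining terms each give the
  covariance.\<close>

lemma pair_product_expectation:
  assumes ij: "i < p" "j < p" and l: "2 * l + 1 < n"
  shows "(\<integral>X. pair_product i j l X \<partial>sample) = cov_matrix p P $$ (i, j)"
proof -
  interpret prob_space P by (rule prob_P)
  interpret S: prob_space sample by (rule prob_sample)
  let ?V = "\<lambda>i x. x i - mean_vec P i"
  let ?a = "2 * l" and ?b = "2 * l + 1"
  have ab: "?a \<in> {..<n}" "?b \<in> {..<n}" "?a \<noteq> ?b" using l by auto
  have V_int: "integrable P (?V i)" if "i < p" for i using coord_integrable[OF that] by auto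
  have V_mean: "(\<integral>x. ?V i x \<partial>P) = 0" if "i < p" for i
    using coord_integrable[OF that] by (simp add: mean_vec_def prob_space)
  have VV_int: "integrable P (\<lambda>x. ?V i x * ?V j x)"
    using coord_integrable ij coord_mult_integrable[OF ij] by (auto simp: algebra_simps)
  have VV_mean: "(\<integral>x. ?V i x * ?V j x \<partial>P) = cov_matrix p P $$ (i, j)"
    using ij by (simp add: cov_matrix_def)
  have eq: "pair_product i j l X = ((?V i (X ?a) * ?V j (X ?a) + ?V i (X ?b) * ?V j (X ?b))
      - (?V i (X ?a) * ?V j (X ?b) + ?V j (X ?a) * ?V i (X ?b))) / 2" for X
    by (simp add: pair_product_def field_simps)
  note comp = PiM_component_integral[OF prob_P]
  note int = comp(2)[OF ab(1) VV_int] comp(2)[OF ab(2) VV_int]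
    expectation_PiM_mult(2)[OF prob_P _ ab V_int[OF ij(1)] V_int[OF ij(2)]]
    expectation_PiM_mult(2)[OF prob_P _ ab V_int[OF ij(2)] V_int[OF ij(1)]]
  have "(\<integral>X. pair_product i j l X \<partial>sample) = (((\<integral>X. ?V i (X ?a) * ?V j (X ?a) \<partial>sample) + (\<integral>X. ?V i (X ?b) * ?V j (X ?b) \<partial>sample))
      - ((\<integral>X. ?V i (X ?a) * ?V j (X ?b) \<partial>sample) + (\<integral>X. ?V j (X ?a) * ?V i (X ?b) \<partial>sample))) / 2"
    unfolding eq using int
    by (subst integral_divide_zero, subst Bochner_Integration.integral_diff,
        (intro Bochner_Integration.integrable_add; simp)+,
        (subst Bochner_Integration.integral_add; simp))
  also have "(\<integral>X. ?V i (X ?a) * ?V j (X ?a) \<partial>sample) = cov_matrix p P $$ (i, j)"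
    using comp(1)[OF ab(1), of "\<lambda>x. ?V i x * ?V j x"] VV_int VV_mean by auto
  also have "(\<integral>X. ?V i (X ?b) * ?V j (X ?b) \<partial>sample) = cov_matrix p P $$ (i, j)"
    using comp(1)[OF ab(2), of "\<lambda>x. ?V i x * ?V j x"] VV_int VV_mean by auto
  also have "(\<integral>X. ?V i (X ?a) * ?V j (X ?b) \<partial>sample) = 0"
    using expectation_PiM_mult(1)[OF prob_P _ ab V_int[OF ij(1)] V_int[OF ij(2)]] V_mean[OF ij(1)] by simp
  also have "(\<integral>X. ?V j (X ?a) * ?V i (X ?b) \<partial>sample) = 0"
    using expectation_PiM_mult(1)[OF prob_P _ ab V_int[OF ij(2)] V_int[OF ij(1)]] V_mean[OF ij(1)] by simp
  finally show ?thesis by simp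
qed

text \<open>The product is at most half the sum of four centred squares, so
  \<open>\<rho> / 8\<close> times it is at most the average of the four exponents
  \<open>\<rho> / 4\<close> times a square. By convexity of \<open>exp\<close> the bound
  \<open>K\<close> for a single coordinate carries over unchanged.\<close>

lemma pair_product_exp_moment:
  assumes ij: "i < p" "j < p" and l: "2 * l + 1 < n"
  shows "(\<integral>\<^sup>+X. ennreal (exp (\<rho> / 8 * \<bar>pair_product i j l X\<bar>)) \<partial>sample) \<le> ennreal K"
proof -
  let ?V = "\<lambda>i x. x i - mean_vec P i"
  let ?a = "2 * l" and ?b = "2 * l + 1"
  have ab: "?a \<in> {..<n}" "?b \<in> {..<n}" using l by auto
  let ?g = "\<lambda>i x. exp (\<rho> / 4 * (?V i x)\<^sup>2)"
  let ?W = "\<lambda>X. exp (\<rho> / 8 * \<bar>pair_product i j l X\<bar>)"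
  let ?G = "\<lambda>X. (?g i (X ?a) + ?g i (X ?b) + ?g j (X ?a) + ?g j (X ?b)) / 4"
  let ?E = "\<lambda>X. (ennreal (?g i (X ?a)) + ennreal (?g i (X ?b)) + ennreal (?g j (X ?a)) + ennreal (?g j (X ?b))) / 4"
  have pw: "?W X
      \<le> ?G X" for X
  proof -
    have ineq: "\<bar>(u - u') * (v - v') / 2\<bar> \<le> (u\<^sup>2 + u'\<^sup>2 + v\<^sup>2 + v'\<^sup>2) / 2" for u u' v v' :: real
    proof -
      have "2 * (\<bar>u - u'\<bar> * \<bar>v - v'\<bar>) \<le> (u - u')\<^sup>2 + (v - v')\<^sup>2"
        using sum_squares_bound[of "\<bar>u - u'\<bar>" "\<bar>v - v'\<bar>"] by simp
      moreover have "(u - u')\<^sup>2 \<le> 2 * u\<^sup>2 + 2 * u'\<^sup>2" "(v - v')\<^sup>2 \<le> 2 * v\<^sup>2 + 2 * v'\<^sup>2"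
        using zero_le_power2[of "u + u'"] zero_le_power2[of "v + v'"]
        by (simp_all add: power2_eq_square algebra_simps)
      ultimately show ?thesis by (simp add: abs_mult)
    qed
    have "pair_product i j l X = (?V i (X ?a) - ?V i (X ?b)) * (?V j (X ?a) - ?V j (X ?b)) / 2"
      by (simp add: pair_product_def)
    then have "\<bar>pair_product i j l X\<bar> \<le> ((?V i (X ?a))\<^sup>2 + (?V i (X ?b))\<^sup>2 + (?V j (X ?a))\<^sup>2 + (?V j (X ?b))\<^sup>2) / 2"
      by (simp only: ineq)
    then have "\<rho> / 8 * \<bar>pair_product i j l X\<bar> \<le> \<rho> / 8 * (((?V i (X ?a))\<^sup>2 + (?V i (X ?b))\<^sup>2 + (?V j (X ?a))\<^sup>2 + (?V j (X ?b))\<^sup>2) / 2)"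
      using \<rho> by (intro mult_left_mono) auto
    also have "\<dots> = (\<rho> / 4 * (?V i (X ?a))\<^sup>2 + \<rho> / 4 * (?V i (X ?b))\<^sup>2 + \<rho> / 4 * (?V j (X ?a))\<^sup>2 + \<rho> / 4 * (?V j (X ?b))\<^sup>2) / 4"
      by (simp add: field_simps)
    finally have "?W X \<le> exp \<dots>" by simp
    also have "\<dots> \<le> ?G X" by (rule exp_mean4_le)
    finally show ?thesis .
  qed
  have g_meas: "(\<lambda>x. ennreal (?g i x)) \<in> borel_measurable P" if "i < p" for i using that by measurable
  have gX_meas: "(\<lambda>X. ennreal (?g i (X k))) \<in> borel_measurable sample" if "i < p" "k < n" for i k
    using that by (intro measurable_compose[of "\<lambda>X. X k" _ P "\<lambda>x. ennreal (?g i x)"] measurable_component_singleton g_meas) auto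
  have E: "(\<integral>\<^sup>+X. ennreal (?g i (X k)) \<partial>sample) \<le> ennreal K" if "i < p" "k < n" for i k
    using PiM_component_integral(3)[OF prob_P _ g_meas[OF that(1)], of k "{..<n}"] that coord_exp_moment[OF that(1)] by simp
  have "(\<integral>\<^sup>+X. ennreal (?W X) \<partial>sample)
      \<le> (\<integral>\<^sup>+X. ?E X \<partial>sample)"
  proof (rule nn_integral_mono)
    fix X
    have "ennreal (?W X) \<le> ennreal (?G X)"
      by (intro ennreal_leI pw)
    also have "\<dots> = ?E X"
      by (subst divide_ennreal[symmetric]) (auto simp: add_nonneg_nonneg)
    finally show "ennreal (?W X)
      \<le> ?E X" .
  qed
  also have "\<dots> = ((\<integral>\<^sup>+X. ennreal (?g i (X ?a)) \<partial>sample) + (\<integral>\<^sup>+X. ennreal (?g i (X ?b)) \<partial>sample)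
      + (\<integral>\<^sup>+X. ennreal (?g j (X ?a)) \<partial>sample) + (\<integral>\<^sup>+X. ennreal (?g j (X ?b)) \<partial>sample)) / 4"
    using gX_meas ij ab by (simp add: nn_integral_divide nn_integral_add)
  also have "\<dots> \<le> (ennreal K + ennreal K + ennreal K + ennreal K) / 4"
    using E ij ab by (intro divide_right_mono_ennreal add_mono) auto
  also have "\<dots> = ennreal K"
    using tail_const_ge_1[of "\<rho> / 4"] \<rho>
    by (simp add: ennreal_plus[symmetric] divide_ennreal del: ennreal_plus flip: ennreal_numeral)
  finally show ?thesis .
qed

lemma pair_cov_exp_moment:
  assumes ij: "i < p" "j < p" and m: "1 \<le> m" "2 * m \<le> n"
  shows "(\<integral>\<^sup>+X. ennreal (exp (\<rho> / 16 * (sqrt (real m) * \<bar>pair_cov m i j X - cov_matrix p P $$ (i, j)\<bar>))) \<partial>sample)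
    \<le> ennreal (2 * exp (2 * (K * exp K)))"
proof -
  interpret S: prob_space sample by (rule prob_sample)
  have l: "2 * l + 1 < n" if "l < m" for l using that m by simp
  have dis: "disjoint_family_on (\<lambda>l. {2 * l, 2 * l + 1}) {..<m}"
    by (auto simp: disjoint_family_on_def)
  \<comment> \<open>\<open>pair_product i j l\<close> reads only the observations
    \<open>2 * l\<close> and \<open>2 * l + 1\<close>, and these index sets are disjoint.\<close>
  have "S.indep_vars (\<lambda>l. Pi\<^sub>M {2 * l, 2 * l + 1} (\<lambda>_. P)) (\<lambda>l X. \<lambda>k\<in>{2 * l, 2 * l + 1}. X k) {..<m}"
    using m by (intro S.indep_vars_restrict[OF indep_vars_PiM_coords[OF prob_P] _ dis]) (auto simp: lessThan_empty_iff)
  then have "S.indep_vars (\<lambda>_. borel) (\<lambda>l X. pair_product i j l (\<lambda>k\<in>{2 * l, 2 * l + 1}. X k)) {..<m}"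
  proof (rule S.indep_vars_compose2)
    fix l assume "l \<in> {..<m}"
    have [measurable]: "(\<lambda>X. X k i) \<in> borel_measurable (Pi\<^sub>M {2 * l, 2 * l + 1} (\<lambda>_. P))"
      if "k \<in> {2 * l, 2 * l + 1}" "i < p" for k i
      using that by (intro measurable_compose[of "\<lambda>X. X k" _ P "\<lambda>x. x i"] measurable_component_singleton coord_meas) auto
    show "pair_product i j l \<in> borel_measurable (Pi\<^sub>M {2 * l, 2 * l + 1} (\<lambda>_. P))"
      unfolding pair_product_def[abs_def] using ij by measurable
  qed
  then have indep: "S.indep_vars (\<lambda>_. borel) (pair_product i j) {..<m}"
    by (rule S.indep_vars_cong[THEN iffD1, rotated -1]) (auto simp: pair_product_def fun_eq_iff)
  have "(\<integral>\<^sup>+X. ennreal (exp (\<rho> / 8 / 2 * (sqrt (real m) * \<bar>(\<Sum>l<m. pair_product i j l X) / real m - cov_matrix p P $$ (i, j)\<bar>))) \<partial>sample)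
    \<le> ennreal (2 * exp (2 * (K * exp K)))"
    using tail_const_ge_1[of "\<rho> / 4"] \<rho> l
    by (intro S.sample_mean_exp_moment m(1) indep pair_product_exp_moment ij pair_product_expectation) auto
  then show ?thesis by (simp add: pair_cov_def)
qed

end

section \<open>Off-diagonal sums and thresholding\<close>

text \<open>Each distance from \<open>j\<close> occurs at most twice. The range ends at
  \<open>max p (j + 1)\<close> because \<open>j\<close> is not assumed to be below
  \<open>p\<close>.\<close>

lemma sum_off_diagonal_le:
  fixes g :: "nat \<Rightarrow> real"
  assumes g: "\<And>d. 0 \<le> g d"
  shows "(\<Sum>i | i < p \<and> \<bar>int i - int j\<bar> > int k. g (nat \<bar>int i - int j\<bar>)) \<le> 2 * (\<Sum>d\<in>{k<..<max p (j + 1)}. g d)"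
proof -
  let ?U = "{i. i < p \<and> j + k < i}" and ?L = "{i. i < p \<and> i + k < j}"
  have eq: "{i. i < p \<and> \<bar>int i - int j\<bar> > int k} = ?U \<union> ?L" by auto
  have U: "(\<Sum>i\<in>?U. g (nat \<bar>int i - int j\<bar>)) \<le> (\<Sum>d\<in>{k<..<max p (j + 1)}. g d)"
  proof -
    have "(\<Sum>i\<in>?U. g (nat \<bar>int i - int j\<bar>)) = (\<Sum>d\<in>(\<lambda>i. nat \<bar>int i - int j\<bar>) ` ?U. g d)"
      by (subst sum.reindex) (auto simp: inj_on_def)
    also have "\<dots> \<le> (\<Sum>d\<in>{k<..<max p (j + 1)}. g d)"
      by (intro sum_mono2 g) auto
    finally show ?thesis .
  qed
  have L: "(\<Sum>i\<in>?L. g (nat \<bar>int i - int j\<bar>)) \<le> (\<Sum>d\<in>{k<..<max p (j + 1)}. g d)"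
  proof -
    have "(\<Sum>i\<in>?L. g (nat \<bar>int i - int j\<bar>)) = (\<Sum>d\<in>(\<lambda>i. nat \<bar>int i - int j\<bar>) ` ?L. g d)"
      by (subst sum.reindex) (auto simp: inj_on_def)
    also have "\<dots> \<le> (\<Sum>d\<in>{k<..<max p (j + 1)}. g d)"
      by (intro sum_mono2 g) auto
    finally show ?thesis .
  qed
  have "(\<Sum>i\<in>?U \<union> ?L. g (nat \<bar>int i - int j\<bar>)) = (\<Sum>i\<in>?U. g (nat \<bar>int i - int j\<bar>)) + (\<Sum>i\<in>?L. g (nat \<bar>int i - int j\<bar>))"
    by (intro sum.union_disjoint) auto
  then show ?thesis unfolding eq using U L by simp
qed

text \<open>The mean value theorem for \<open>x powr (- a)\<close> on an interval of length one, in
  a form that telescopes.\<close>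

lemma powr_tail_step:
  assumes a: "0 < a" and d: "2 \<le> d"
  shows "real d powr (- (a + 1)) \<le> (1 / a) * (real (d - 1) powr (- a) - real d powr (- a))"
proof -
  let ?f = "\<lambda>x. - (x powr (- a)) :: real"
  have lt: "real (d - 1) < real d" using d by simp
  have "\<exists>z. real (d - 1) < z \<and> z < real d \<and> ?f (real d) - ?f (real (d - 1)) = (real d - real (d - 1)) * (a * z powr (- a - 1))"
  proof (rule MVT2[OF lt])
    fix z assume "real (d - 1) \<le> z" "z \<le> real d"
    then have "0 < z" using d by linarith
    then show "(?f has_real_derivative a * z powr (- a - 1)) (at z)"
      by (auto intro!: derivative_eq_intros)
  qed
  then obtain z where z': "real (d - 1) < z" "z < real d"
    and eq: "?f (real d) - ?f (real (d - 1)) = (real d - real (d - 1)) * (a * z powr (- a - 1))" by blast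
  have z: "real (d - 1) < z" "z < real d"
    "real (d - 1) powr (- a) - real d powr (- a) = (real d - real (d - 1)) * (a * z powr (- a - 1))"
    using z' eq by simp_all
  have "0 < z" using z d by linarith
  then have "real d powr (- (a + 1)) \<le> z powr (- (a + 1))"
    using z a by (intro powr_mono2') auto
  also have "\<dots> = (1 / a) * (a * z powr (- a - 1))" using a by (simp add: minus_add_distrib)
  also have "a * z powr (- a - 1) = real (d - 1) powr (- a) - real d powr (- a)"
  proof -
    have "real d - real (d - 1) = 1" using d by simp
    then show ?thesis unfolding z(3) by simp
  qed
  finally show ?thesis .
qed

lemma powr_tail_sum:
  assumes a: "0 < a" and k: "1 \<le> k"
  shows "(\<Sum>d\<in>{k<..<q}. real d powr (- (a + 1))) \<le> (1 / a) * real k powr (- a)"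
proof -
  \<comment> \<open>The subtracted end term is kept for the induction, so that each new summand is
    paid for by a telescoping difference.\<close>
  have "(\<Sum>d\<in>{k<..<q}. real d powr (- (a + 1))) \<le> (1 / a) * (real k powr (- a) - (if k < q then real (q - 1) powr (- a) else 0))"
  proof (induction q)
    case (Suc q)
    show ?case
    proof (cases "k < q")
      case True
      then have eq: "{k<..<Suc q} = insert q {k<..<q}" by auto
      have "real q powr (- (a + 1)) \<le> (1 / a) * (real (q - 1) powr (- a) - real q powr (- a))"
        using True k a by (intro powr_tail_step) auto
      then show ?thesis
        using Suc True unfolding eq by (simp add: algebra_simps)
    next
      case False
      then have "{k<..<Suc q} = {}" by auto
      moreover have "k < Suc q \<Longrightarrow> q = k" using False by simp
      ultimately show ?thesis using a by auto
    qed
  qed (use a in simp)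
  also have "\<dots> \<le> (1 / a) * real k powr (- a)"
    using a by (intro mult_left_mono) auto
  finally show ?thesis .
qed

lemma off_diagonal_powr_sum:
  assumes a: "0 < a" and k: "1 \<le> k"
  shows "(\<Sum>i | i < p \<and> \<bar>int i - int j\<bar> > int k. \<bar>real i - real j\<bar> powr (- (a + 1))) \<le> 2 / a * real k powr (- a)"
proof -
  have nat: "real (nat \<bar>int i - int j\<bar>) = \<bar>real i - real j\<bar>" for i by simp
  have "(\<Sum>i | i < p \<and> \<bar>int i - int j\<bar> > int k. \<bar>real i - real j\<bar> powr (- (a + 1)))
      \<le> 2 * (\<Sum>d\<in>{k<..<max p (j + 1)}. real d powr (- (a + 1)))"
    unfolding nat[symmetric] by (rule sum_off_diagonal_le) simp
  also have "\<dots> \<le> 2 * ((1 / a) * real k powr (- a))"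
    by (intro mult_left_mono powr_tail_sum[OF a k]) simp
  finally show ?thesis by simp
qed

text \<open>A dyadic decomposition: at distance between \<open>2 ^ s * k\<close> and
  \<open>2 ^ (s + 1) * k\<close> the weight is at most
  \<open>2 powr ((s + 1) * (\<alpha> / 2))\<close>, while the tail beyond \<open>2 ^ s * k\<close>
  is \<open>M * (2 ^ s * k) powr (- \<alpha>)\<close>. As the weight grows with only half the
  exponent of the decay, the scales sum geometrically with ratio
  \<open>2 powr (- (\<alpha> / 2))\<close>.\<close>

lemma weighted_tail_sum:
  fixes x :: "nat \<Rightarrow> real"
  assumes \<alpha>: "0 < \<alpha>" and k: "1 \<le> k" and j: "j < p"
    and tail: "\<And>k. 1 \<le> k \<Longrightarrow> (\<Sum>i | i < p \<and> \<bar>int i - int j\<bar> > int k. \<bar>x i\<bar>) \<le> M * real k powr (- \<alpha>)"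
    and M: "0 < M"
  shows "(\<Sum>i | i < p \<and> \<bar>int i - int j\<bar> > int k. \<bar>x i\<bar> * (\<bar>real i - real j\<bar> / real k) powr (\<alpha> / 2))
    \<le> M * 2 powr (\<alpha> / 2) / (1 - 2 powr (- (\<alpha> / 2))) * real k powr (- \<alpha>)"
proof -
  let ?I = "\<lambda>k. {i. i < p \<and> \<bar>int i - int j\<bar> > int k}"
  let ?w = "\<lambda>s::nat. 2 powr (real (s + 1) * (\<alpha> / 2))"
  have pw: "(\<bar>real i - real j\<bar> / real k) powr (\<alpha> / 2) \<le> (\<Sum>s<p. if i \<in> ?I (2 ^ s * k) then ?w s else 0)"
    if i: "i \<in> ?I k" for i
  proof -
    define d where "d = nat \<bar>int i - int j\<bar>"
    have d: "k < d" "d < p" using i j by (auto simp: d_def)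
    have d_real: "real d = \<bar>real i - real j\<bar>" by (simp add: d_def)
    \<comment> \<open>The wanted scale is \<open>s = t - 1\<close>, the last one with
      \<open>2 ^ s * k < d\<close>. It is below \<open>p\<close> because
      \<open>d < p \<le> 2 ^ p\<close>, so a sum over \<open>s < p\<close> contains it.\<close>
    define t where "t = (LEAST t. d \<le> 2 ^ t * k)"
    have ex: "d \<le> 2 ^ p * k"
    proof -
      have "d \<le> 2 ^ p * 1" using d(2) less_exp[of p] by linarith
      also have "\<dots> \<le> 2 ^ p * k" using k by (intro mult_le_mono) auto
      finally show ?thesis .
    qed
    have t: "d \<le> 2 ^ t * k" unfolding t_def by (rule LeastI[of _ p]) (rule ex)
    have t_le: "t \<le> p" unfolding t_def by (rule Least_le) (rule ex)
    have "t \<noteq> 0" using t d(1) by (intro notI) simp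
    then obtain s where s: "t = Suc s" by (cases t) auto
    have "\<not> d \<le> 2 ^ s * k" using not_less_Least[of s "\<lambda>t. d \<le> 2 ^ t * k"] s by (simp add: t_def)
    then have "int (2 ^ s * k) < int d" unfolding of_nat_less_iff by linarith
    moreover have "int d = \<bar>int i - int j\<bar>" by (simp add: d_def)
    ultimately have mem: "i \<in> ?I (2 ^ s * k)" using i by (simp only: mem_Collect_eq)
    have "real d / real k \<le> 2 ^ (s + 1)"
    proof -
      have "real d \<le> real (2 ^ t * k)" using t by (rule of_nat_mono)
      then show ?thesis using k s by (simp add: field_simps)
    qed
    also have "2 ^ (s + 1) = (2 :: real) powr real (s + 1)" by (rule powr_realpow[symmetric]) simp
    finally have "(real d / real k) powr (\<alpha> / 2) \<le> (2 powr real (s + 1)) powr (\<alpha> / 2)"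
      using \<alpha> by (intro powr_mono2) auto
    also have "\<dots> = ?w s" by (simp only: powr_powr)
    also have "\<dots> = (if i \<in> ?I (2 ^ s * k) then ?w s else 0)" using mem by simp
    also have "\<dots> \<le> (\<Sum>s<p. if i \<in> ?I (2 ^ s * k) then ?w s else 0)"
      using t_le s by (intro member_le_sum) auto
    finally show ?thesis by (simp only: d_real)
  qed
  have sub: "?I (2 ^ s * k) \<subseteq> ?I k" for s
  proof -
    have "k \<le> 2 ^ s * k" by simp
    then have "int k \<le> int (2 ^ s * k)" by (simp only: of_nat_le_iff)
    then show ?thesis by auto
  qed
  define r where "r = 2 powr (- (\<alpha> / 2))"
  have r: "0 < r" "r < 1" using \<alpha> by (auto simp: r_def powr_less_one)
  have "(\<Sum>i\<in>?I k. \<bar>x i\<bar> * (\<bar>real i - real j\<bar> / real k) powr (\<alpha> / 2))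
      \<le> (\<Sum>i\<in>?I k. \<bar>x i\<bar> * (\<Sum>s<p. if i \<in> ?I (2 ^ s * k) then ?w s else 0))"
    by (intro sum_mono mult_left_mono pw) auto
  also have "\<dots> = (\<Sum>s<p. ?w s * (\<Sum>i\<in>?I (2 ^ s * k). \<bar>x i\<bar>))"
  proof -
    have "(\<Sum>i\<in>?I k. \<bar>x i\<bar> * (\<Sum>s<p. if i \<in> ?I (2 ^ s * k) then ?w s else 0))
      = (\<Sum>s<p. \<Sum>i\<in>?I k. if i \<in> ?I (2 ^ s * k) then ?w s * \<bar>x i\<bar> else 0)"
      unfolding sum_distrib_left by (subst sum.swap) (auto intro!: sum.cong)
    also have "\<dots> = (\<Sum>s<p. \<Sum>i\<in>?I (2 ^ s * k). ?w s * \<bar>x i\<bar>)"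
    proof (rule sum.cong[OF refl])
      fix s
      have "?I k \<inter> ?I (2 ^ s * k) = ?I (2 ^ s * k)" using sub[of s] by blast
      then show "(\<Sum>i\<in>?I k. if i \<in> ?I (2 ^ s * k) then ?w s * \<bar>x i\<bar> else 0) = (\<Sum>i\<in>?I (2 ^ s * k). ?w s * \<bar>x i\<bar>)"
        using sum.inter_restrict[of "?I k" "\<lambda>i. ?w s * \<bar>x i\<bar>" "?I (2 ^ s * k)"] by simp
    qed
    finally show ?thesis by (simp only: sum_distrib_left)
  qed
  also have "\<dots> \<le> (\<Sum>s<p. ?w s * (M * real (2 ^ s * k) powr (- \<alpha>)))"
    using k by (intro sum_mono mult_left_mono tail) auto
  also have "\<dots> = (\<Sum>s<p. M * 2 powr (\<alpha> / 2) * real k powr (- \<alpha>) * r ^ s)"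
  proof (rule sum.cong[OF refl])
    fix s
    have f1: "real (2 ^ s * k) powr (- \<alpha>) = 2 powr (real s * (- \<alpha>)) * real k powr (- \<alpha>)"
    proof -
      have "real (2 ^ s * k) powr (- \<alpha>) = (2 powr real s * real k) powr (- \<alpha>)"
        by (simp add: powr_realpow)
      also have "\<dots> = (2 powr real s) powr (- \<alpha>) * real k powr (- \<alpha>)"
        by (subst powr_mult) auto
      finally show ?thesis by (simp only: powr_powr)
    qed
    have f2: "?w s = 2 powr (\<alpha> / 2) * 2 powr (real s * (\<alpha> / 2))"
    proof -
      have "real (s + 1) * (\<alpha> / 2) = \<alpha> / 2 + real s * (\<alpha> / 2)"
        by (simp add: distrib_right add_divide_distrib)
      then show ?thesis by (simp only: powr_add)
    qed
    have f3: "2 powr (real s * (\<alpha> / 2)) * 2 powr (real s * (- \<alpha>)) = r ^ s"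
    proof -
      have "r ^ s = 2 powr (- (\<alpha> / 2) * real s)" 
      proof -
        have "r ^ s = r powr real s" using r by (intro powr_realpow[symmetric]) auto
        then show ?thesis by (simp only: r_def powr_powr)
      qed
      moreover have "real s * (\<alpha> / 2) + real s * (- \<alpha>) = - (\<alpha> / 2) * real s" by (simp add: algebra_simps)
      ultimately show ?thesis by (simp only: powr_add[symmetric])
    qed
    show "?w s * (M * real (2 ^ s * k) powr (- \<alpha>)) = M * 2 powr (\<alpha> / 2) * real k powr (- \<alpha>) * r ^ s"
      unfolding f1 f2 f3[symmetric] by (simp only: mult_ac)
  qed
  also have "\<dots> = M * 2 powr (\<alpha> / 2) * real k powr (- \<alpha>) * (\<Sum>s<p. r ^ s)"
    by (simp add: sum_distrib_left)
  also have "\<dots> \<le> M * 2 powr (\<alpha> / 2) * real k powr (- \<alpha>) * (1 / (1 - r))"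
  proof (intro mult_left_mono)
    show "(\<Sum>s<p. r ^ s) \<le> 1 / (1 - r)"
      using r by (simp add: sum_gp_strict divide_right_mono)
  qed (use M in auto)
  finally show ?thesis by (simp add: r_def)
qed

lemma card_band_le: "card {i. i < p \<and> \<bar>int i - int j\<bar> \<le> int k} \<le> 2 * k + 1"
proof -
  have "{i. i < p \<and> \<bar>int i - int j\<bar> \<le> int k} \<subseteq> {j - k..j + k}" by auto
  then have "card {i. i < p \<and> \<bar>int i - int j\<bar> \<le> int k} \<le> card {j - k..j + k}"
    by (intro card_mono) auto
  also have "\<dots> \<le> 2 * k + 1" by simp
  finally show ?thesis .
qed

section \<open>Hard thresholding of one noisy entry\<close>

definition hard_threshold :: "real \<Rightarrow> real \<Rightarrow> real" where
  "hard_threshold l s = (if l < \<bar>s\<bar> then s else 0)"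

text \<open>If the noise is at most \<open>l / 2\<close>, a kept entry has
  \<open>\<bar>\<sigma>\<bar> \<ge> l / 2\<close> and a killed one
  \<open>\<bar>\<sigma>\<bar> \<le> 2 * l\<close>, so the squared error is at most a multiple of
  \<open>\<bar>\<sigma>\<bar> * l\<close>. If it is larger, a killed entry satisfies
  \<open>\<bar>\<sigma>\<bar> \<le> 3 * \<bar>s - \<sigma>\<bar>\<close>, whence the 9.\<close>

lemma hard_threshold_error:
  assumes l: "0 \<le> l"
  shows "(hard_threshold l s - \<sigma>)\<^sup>2 \<le> 2 * \<bar>\<sigma>\<bar> * l + 9 * (if l / 2 < \<bar>s - \<sigma>\<bar> then (s - \<sigma>)\<^sup>2 else 0)"
proof (cases "l < \<bar>s\<bar>")
  case kept: True
  show ?thesis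
  proof (cases "l / 2 < \<bar>s - \<sigma>\<bar>")
    case True
    then show ?thesis using kept l zero_le_power2[of "s - \<sigma>"] mult_nonneg_nonneg[of "2 * \<bar>\<sigma>\<bar>" l] by (simp add: hard_threshold_def)
  next
    case False
    then have "(s - \<sigma>)\<^sup>2 \<le> (l / 2)\<^sup>2" by (simp add: abs_le_square_iff[symmetric])
    also have "\<dots> \<le> (l / 2) * \<bar>\<sigma>\<bar>"
    proof -
      have "l / 2 \<le> \<bar>\<sigma>\<bar>" using kept False by linarith
      then show ?thesis unfolding power2_eq_square using l by (intro mult_left_mono) auto
    qed
    also have "\<dots> \<le> 2 * \<bar>\<sigma>\<bar> * l" using l by (simp add: mult.commute mult_left_mono)
    finally show ?thesis using kept False by (simp add: hard_threshold_def)
  qed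
next
  case zero: False
  show ?thesis
  proof (cases "l / 2 < \<bar>s - \<sigma>\<bar>")
    case True
    then have "\<bar>\<sigma>\<bar> \<le> 3 * \<bar>s - \<sigma>\<bar>"
      using zero abs_triangle_ineq4[of s "s - \<sigma>"] by simp
    then have "\<bar>\<sigma>\<bar> \<le> \<bar>3 * (s - \<sigma>)\<bar>" by (simp only: abs_mult abs_numeral)
    then have "\<sigma>\<^sup>2 \<le> (3 * (s - \<sigma>))\<^sup>2" by (simp only: abs_le_square_iff)
    then have "\<sigma>\<^sup>2 \<le> 9 * (s - \<sigma>)\<^sup>2" unfolding power_mult_distrib by simp
    moreover have "0 \<le> 2 * \<bar>\<sigma>\<bar> * l" using l by simp
    ultimately have "\<sigma>\<^sup>2 \<le> 2 * \<bar>\<sigma>\<bar> * l + 9 * (s - \<sigma>)\<^sup>2" by (intro add_increasing)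
    moreover have "(hard_threshold l s - \<sigma>)\<^sup>2 = \<sigma>\<^sup>2" using zero by (simp add: hard_threshold_def)
    ultimately show ?thesis using True by (simp only: if_True)
  next
    case False
    then have "\<bar>\<sigma>\<bar> \<le> 2 * l" using zero l by linarith
    then have "\<bar>\<sigma>\<bar> * \<bar>\<sigma>\<bar> \<le> \<bar>\<sigma>\<bar> * (2 * l)" by (intro mult_left_mono) auto
    then show ?thesis using zero False by (simp add: hard_threshold_def power2_eq_square mult_ac)
  qed
qed

text \<open>The inequality \<open>x \<le> exp x\<close> at \<open>x = c * u / r\<close>, raised to
  the power \<open>r\<close>.\<close>

lemma powr_le_exp:
  fixes u c r :: real
  assumes "0 \<le> u" "0 < c" "0 < r"
  shows "u powr r \<le> (r / c) powr r * exp (c * u)"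
proof -
  have "c * u / r \<le> exp (c * u / r)" using exp_ge_add_one_self[of "c * u / r"] by linarith
  then have "u \<le> (r / c) * exp (c * u / r)" using assms by (simp add: field_simps)
  then have "u powr r \<le> ((r / c) * exp (c * u / r)) powr r" using assms by (intro powr_mono2) auto
  also have "\<dots> = (r / c) powr r * exp (c * u)"
    using assms by (subst powr_mult) (auto simp: exp_powr_real)
  finally show ?thesis .
qed

section \<open>Risk of the threshold estimator\<close>

context sub_gaussian_sample
begin

definition moment_const :: real where
  "moment_const = 2 * exp (2 * (K * exp K))"

definition noise_const :: "real \<Rightarrow> real" where
  "noise_const r = (r / (\<rho> / 16)) powr r * moment_const"

lemma noise_const_nonneg: "0 \<le> noise_const r"
  by (simp add: noise_const_def moment_const_def)

lemma pair_cov_sample_meas: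
  assumes "i < p" "j < p" "2 * m \<le> n"
  shows "pair_cov m i j \<in> borel_measurable sample"
proof -
  have "sets sample = sets (Pi\<^sub>M {..<n} (\<lambda>_. vec_borel p))"
    by (intro sets_PiM_cong) (auto simp: sets_P)
  then show ?thesis
    using pair_cov_measurable[OF assms] by (simp cong: measurable_cong_sets)
qed

lemma noise_measurable:
  assumes "g \<in> borel_measurable borel" "i < p" "j < p" "2 * m \<le> n"
  shows "(\<lambda>X. g (pair_cov m i j X - c)) \<in> borel_measurable sample"
  by (intro measurable_compose[OF _ assms(1)] borel_measurable_diff pair_cov_sample_meas assms borel_measurable_const)

lemma noise_moment:
  assumes ij: "i < p" "j < p" and m: "1 \<le> m" "2 * m \<le> n" and r: "0 < r"
  shows "(\<integral>\<^sup>+X. ennreal ((sqrt (real m) * \<bar>pair_cov m i j X - cov_matrix p P $$ (i, j)\<bar>) powr r) \<partial>sample)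
    \<le> ennreal (noise_const r)"
proof -
  let ?u = "\<lambda>X. sqrt (real m) * \<bar>pair_cov m i j X - cov_matrix p P $$ (i, j)\<bar>"
  let ?c = "(r / (\<rho> / 16)) powr r"
  have meas: "(\<lambda>X. ennreal (exp (\<rho> / 16 * ?u X))) \<in> borel_measurable sample"
    by (rule noise_measurable[where g = "\<lambda>z. ennreal (exp (\<rho> / 16 * (sqrt (real m) * \<bar>z\<bar>)))", OF _ ij m(2)]) measurable
  have "(\<integral>\<^sup>+X. ennreal (?u X powr r) \<partial>sample) \<le> (\<integral>\<^sup>+X. ennreal ?c * ennreal (exp (\<rho> / 16 * ?u X)) \<partial>sample)"
  proof (rule nn_integral_mono)
    fix X
    have "ennreal (?u X powr r) \<le> ennreal (?c * exp (\<rho> / 16 * ?u X))"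
      using \<rho> r by (intro ennreal_leI powr_le_exp) auto
    also have "\<dots> = ennreal ?c * ennreal (exp (\<rho> / 16 * ?u X))"
      by (rule ennreal_mult) auto
    finally show "ennreal (?u X powr r) \<le> ennreal ?c * ennreal (exp (\<rho> / 16 * ?u X))" .
  qed
  also have "\<dots> = ennreal ?c * (\<integral>\<^sup>+X. ennreal (exp (\<rho> / 16 * ?u X)) \<partial>sample)"
    by (rule nn_integral_cmult[OF meas])
  also have "\<dots> \<le> ennreal ?c * ennreal moment_const"
    unfolding moment_const_def by (intro mult_left_mono pair_cov_exp_moment ij m) auto
  also have "\<dots> = ennreal (noise_const r)"
    by (simp add: noise_const_def moment_const_def ennreal_mult[symmetric])
  finally show ?thesis .
qed

lemma noise_sq:
  assumes ij: "i < p" "j < p" and m: "1 \<le> m" "2 * m \<le> n"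
  shows "(\<integral>\<^sup>+X. ennreal ((pair_cov m i j X - cov_matrix p P $$ (i, j))\<^sup>2) \<partial>sample) \<le> ennreal (noise_const 2 / real m)"
proof -
  let ?N = "\<lambda>X. pair_cov m i j X - cov_matrix p P $$ (i, j)"
  have eq: "(?N X)\<^sup>2 = 1 / real m * (sqrt (real m) * \<bar>?N X\<bar>) powr 2" for X
    using m by (simp add: powr_numeral power_mult_distrib)
  have meas: "(\<lambda>X. ennreal ((sqrt (real m) * \<bar>?N X\<bar>) powr 2)) \<in> borel_measurable sample"
    by (rule noise_measurable[where g = "\<lambda>z. ennreal ((sqrt (real m) * \<bar>z\<bar>) powr 2)", OF _ ij m(2)]) measurable
  have "(\<integral>\<^sup>+X. ennreal ((?N X)\<^sup>2) \<partial>sample) = (\<integral>\<^sup>+X. ennreal (1 / real m) * ennreal ((sqrt (real m) * \<bar>?N X\<bar>) powr 2) \<partial>sample)"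
    unfolding eq by (intro nn_integral_cong) (simp add: ennreal_mult[symmetric])
  also have "\<dots> = ennreal (1 / real m) * (\<integral>\<^sup>+X. ennreal ((sqrt (real m) * \<bar>?N X\<bar>) powr 2) \<partial>sample)"
    by (rule nn_integral_cmult[OF meas])
  also have "\<dots> \<le> ennreal (1 / real m) * ennreal (noise_const 2)"
    by (intro mult_left_mono noise_moment ij m) auto
  also have "\<dots> = ennreal (noise_const 2 / real m)"
    using noise_const_nonneg[of 2] by (simp add: ennreal_mult[symmetric])
  finally show ?thesis .
qed

text \<open>On the event the normalised noise \<open>u\<close> exceeds \<open>L / 2\<close>, so the
  factor \<open>(2 * u / L) powr q\<close> is at least one and can be inserted, as in Markov's
  inequality. The moment of order \<open>2 + q\<close> buys the decay
  \<open>L powr (- q)\<close>.\<close>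

lemma noise_tail:
  assumes ij: "i < p" "j < p" and m: "1 \<le> m" "2 * m \<le> n" and q: "0 < q" and L: "0 < L"
  shows "(\<integral>\<^sup>+X. ennreal (if L / sqrt (real m) / 2 < \<bar>pair_cov m i j X - cov_matrix p P $$ (i, j)\<bar>
      then (pair_cov m i j X - cov_matrix p P $$ (i, j))\<^sup>2 else 0) \<partial>sample)
    \<le> ennreal (2 powr q * noise_const (2 + q) / real m * L powr (- q))"
proof -
  let ?N = "\<lambda>X. pair_cov m i j X - cov_matrix p P $$ (i, j)"
  let ?u = "\<lambda>X. sqrt (real m) * \<bar>?N X\<bar>"
  let ?c = "2 powr q * L powr (- q) / real m"
  have pw: "(if L / sqrt (real m) / 2 < \<bar>?N X\<bar> then (?N X)\<^sup>2 else 0) \<le> ?c * ?u X powr (2 + q)" for X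
  proof (cases "L / sqrt (real m) / 2 < \<bar>?N X\<bar>")
    case True
    then have u: "L < 2 * ?u X" using m by (simp add: field_simps)
    have u0: "0 < ?u X" using u L by linarith
    have "1 \<le> (2 * ?u X / L) powr q"
      using u L q by (intro ge_one_powr_ge_zero) (auto simp: field_simps)
    also have "\<dots> = 2 powr q * L powr (- q) * ?u X powr q"
      using u0 L by (simp add: powr_divide powr_mult powr_minus_divide)
    finally have "1 / real m * ?u X powr 2 * 1 \<le> 1 / real m * ?u X powr 2 * (2 powr q * L powr (- q) * ?u X powr q)"
      by (intro mult_left_mono) auto
    also have "\<dots> = ?c * ?u X powr (2 + q)"
      unfolding powr_add by simp
    finally have "1 / real m * ?u X powr 2 \<le> ?c * ?u X powr (2 + q)" by (simp only: mult_1_right)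
    moreover have "(?N X)\<^sup>2 = 1 / real m * ?u X powr 2"
      using m by (simp add: powr_numeral power_mult_distrib)
    ultimately show ?thesis using True by (simp only: if_True)
  next
    case False
    then show ?thesis by simp
  qed
  have meas: "(\<lambda>X. ennreal (?u X powr (2 + q))) \<in> borel_measurable sample"
    by (rule noise_measurable[where g = "\<lambda>z. ennreal ((sqrt (real m) * \<bar>z\<bar>) powr (2 + q))", OF _ ij m(2)]) measurable
  have "(\<integral>\<^sup>+X. ennreal (if L / sqrt (real m) / 2 < \<bar>?N X\<bar> then (?N X)\<^sup>2 else 0) \<partial>sample)
      \<le> (\<integral>\<^sup>+X. ennreal ?c * ennreal (?u X powr (2 + q)) \<partial>sample)"
  proof (rule nn_integral_mono)
    fix X
    have "ennreal (if L / sqrt (real m) / 2 < \<bar>?N X\<bar> then (?N X)\<^sup>2 else 0) \<le> ennreal (?c * ?u X powr (2 + q))"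
      by (intro ennreal_leI pw)
    also have "\<dots> = ennreal ?c * ennreal (?u X powr (2 + q))"
      by (rule ennreal_mult) auto
    finally show "ennreal (if L / sqrt (real m) / 2 < \<bar>?N X\<bar> then (?N X)\<^sup>2 else 0)
        \<le> ennreal ?c * ennreal (?u X powr (2 + q))" .
  qed
  also have "\<dots> = ennreal ?c * (\<integral>\<^sup>+X. ennreal (?u X powr (2 + q)) \<partial>sample)"
    by (rule nn_integral_cmult[OF meas])
  also have "\<dots> \<le> ennreal ?c * ennreal (noise_const (2 + q))"
    using q by (intro mult_left_mono noise_moment ij m) auto
  also have "\<dots> = ennreal (2 powr q * noise_const (2 + q) / real m * L powr (- q))"
    using noise_const_nonneg[of "2 + q"] by (subst ennreal_mult[symmetric]) (auto simp: mult_ac)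
  finally show ?thesis .
qed

text \<open>A bound in terms of \<open>\<rho>\<close> alone, for the case \<open>n = 1\<close>, in
  which the estimator is zero and the error is the entry itself.\<close>

lemma cov_entry_bound:
  assumes ij: "i < p" "j < p"
  shows "\<bar>cov_matrix p P $$ (i, j)\<bar> \<le> 4 / \<rho> * K"
proof -
  let ?V = "\<lambda>i x. x i - mean_vec P i"
  let ?g = "\<lambda>i x. exp (\<rho> / 4 * (?V i x)\<^sup>2)"
  have pw: "\<bar>?V i x * ?V j x\<bar> \<le> 2 / \<rho> * ?g i x + 2 / \<rho> * ?g j x" for x
  proof -
    have sq: "z\<^sup>2 \<le> 4 / \<rho> * exp (\<rho> / 4 * z\<^sup>2)" for z
    proof -
      have "\<rho> / 4 * z\<^sup>2 \<le> exp (\<rho> / 4 * z\<^sup>2)" using exp_ge_add_one_self[of "\<rho> / 4 * z\<^sup>2"] by linarith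
      then show ?thesis using \<rho> by (simp add: field_simps)
    qed
    have "2 * (\<bar>?V i x\<bar> * \<bar>?V j x\<bar>) \<le> (?V i x)\<^sup>2 + (?V j x)\<^sup>2"
      using sum_squares_bound[of "\<bar>?V i x\<bar>" "\<bar>?V j x\<bar>"] by simp
    also have "\<dots> \<le> 4 / \<rho> * ?g i x + 4 / \<rho> * ?g j x" by (intro add_mono sq)
    finally show ?thesis by (simp add: abs_mult)
  qed
  have VV_int: "integrable P (\<lambda>x. ?V i x * ?V j x)"
  proof -
    interpret prob_space P by (rule prob_P)
    show ?thesis using coord_integrable ij coord_mult_integrable[OF ij] by (auto simp: algebra_simps)
  qed
  have g_meas: "(\<lambda>x. ennreal (?g i x)) \<in> borel_measurable P" if "i < p" for i using that by measurable
  have "cov_matrix p P $$ (i, j) = (\<integral>x. ?V i x * ?V j x \<partial>P)" using ij by (simp add: cov_matrix_def)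
  then have "ennreal \<bar>cov_matrix p P $$ (i, j)\<bar> \<le> (\<integral>\<^sup>+x. ennreal \<bar>?V i x * ?V j x\<bar> \<partial>P)"
    using integral_norm_bound_ennreal[OF VV_int] by simp
  also have "\<dots> \<le> (\<integral>\<^sup>+x. ennreal (2 / \<rho>) * ennreal (?g i x) + ennreal (2 / \<rho>) * ennreal (?g j x) \<partial>P)"
  proof (rule nn_integral_mono)
    fix x
    have "ennreal \<bar>?V i x * ?V j x\<bar> \<le> ennreal (2 / \<rho> * ?g i x + 2 / \<rho> * ?g j x)" by (intro ennreal_leI pw)
    also have "\<dots> = ennreal (2 / \<rho>) * ennreal (?g i x) + ennreal (2 / \<rho>) * ennreal (?g j x)"
    proof -
      have em: "ennreal (2 / \<rho>) * ennreal (?g i x) = ennreal (2 / \<rho> * ?g i x)" for i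
        using \<rho> by (subst ennreal_mult) auto
      show ?thesis unfolding em using \<rho> by (intro ennreal_plus) auto
    qed
    finally show "ennreal \<bar>?V i x * ?V j x\<bar> \<le> ennreal (2 / \<rho>) * ennreal (?g i x) + ennreal (2 / \<rho>) * ennreal (?g j x)" .
  qed
  also have "\<dots> = ennreal (2 / \<rho>) * (\<integral>\<^sup>+x. ennreal (?g i x) \<partial>P) + ennreal (2 / \<rho>) * (\<integral>\<^sup>+x. ennreal (?g j x) \<partial>P)"
    using g_meas[OF ij(1)] g_meas[OF ij(2)] by (simp add: nn_integral_add nn_integral_cmult)
  also have "\<dots> \<le> ennreal (2 / \<rho>) * ennreal K + ennreal (2 / \<rho>) * ennreal K"
    using ij by (intro add_mono mult_left_mono coord_exp_moment) auto
  also have "\<dots> = ennreal (4 / \<rho> * K)"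
    using \<rho> tail_const_ge_1[of "\<rho> / 4"] by (simp add: ennreal_mult[symmetric] ennreal_plus[symmetric] del: ennreal_plus)
  finally show ?thesis
    using \<rho> tail_const_ge_1[of "\<rho> / 4"] by (simp add: ennreal_le_iff)
qed

text \<open>A sum so that each case can use its own term: the first for entries in the band, the
  next two for the bias and the exceedance beyond it, and the last two for
  \<open>n = 1\<close>.\<close>

definition entry_const :: "real \<Rightarrow> real" where
  "entry_const \<delta> = 3 * noise_const 2 + 4 + 27 * (2 powr (2 / \<delta>) * noise_const (2 + 2 / \<delta>))
    + (4 / \<rho> * K)\<^sup>2 + 4 / \<rho> * K"

end

text \<open>For \<open>n = 1\<close> there is no pair of observations; division by zero makes \<^const>\<open>pair_cov\<close>, and with it the
  estimator, vanish, which is good enough.\<close>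

definition threshold_estimator :: "nat \<Rightarrow> nat \<Rightarrow> nat \<Rightarrow> real \<Rightarrow> (nat \<Rightarrow> nat \<Rightarrow> real) \<Rightarrow> real mat" where
  "threshold_estimator n p k \<delta> X = mat p p (\<lambda>(i, j).
     if \<bar>int i - int j\<bar> \<le> int k then pair_cov (n div 2) i j X
     else hard_threshold ((\<bar>real i - real j\<bar> / real k) powr \<delta> / sqrt (real (n div 2))) (pair_cov (n div 2) i j X))"

lemma hard_threshold_measurable[measurable]: "hard_threshold l \<in> borel_measurable borel"
  unfolding hard_threshold_def[abs_def] by measurable

lemma threshold_estimator_entry_measurable:
  assumes "i < p" "j < p"
  shows "(\<lambda>X. threshold_estimator n p k \<delta> X $$ (i, j)) \<in> borel_measurable (Pi\<^sub>M {..<n} (\<lambda>_. vec_borel p))"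
  using assms pair_cov_measurable[of i p j "n div 2" n]
    measurable_compose[OF pair_cov_measurable[of i p j "n div 2" n] hard_threshold_measurable]
  by (cases "\<bar>int i - int j\<bar> \<le> int k") (simp_all add: threshold_estimator_def)

lemma threshold_estimator_in_estimators: "threshold_estimator n p k \<delta> \<in> estimators n p"
  unfolding estimators_def
  using threshold_estimator_entry_measurable by (auto simp: threshold_estimator_def)

context sub_gaussian_sample
begin

text \<open>Beyond the band an entry pays its modulus times its threshold, plus the noise that
  exceeds the threshold. The latter decays like \<open>L powr (- q)\<close> with \<open>L\<close>
  the relative threshold, and \<open>q = 2 / \<delta>\<close> turns this into the inverse square of
  the relative distance, which is summable.\<close>

lemma threshold_entry_risk:
  assumes ij: "i < p" "j < p" and n: "1 \<le> n" and k: "1 \<le> k" and \<delta>: "0 < \<delta>"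
  shows "(\<integral>\<^sup>+X. ennreal ((threshold_estimator n p k \<delta> X $$ (i, j) - cov_matrix p P $$ (i, j))\<^sup>2) \<partial>sample)
    \<le> ennreal (entry_const \<delta> * (if \<bar>int i - int j\<bar> \<le> int k then 1 / real n
        else \<bar>cov_matrix p P $$ (i, j)\<bar> * (\<bar>real i - real j\<bar> / real k) powr \<delta> / sqrt (real n)
          + (\<bar>real i - real j\<bar> / real k) powr (- 2) / real n))"
proof -
  interpret S: prob_space sample by (rule prob_sample)
  let ?\<sigma> = "cov_matrix p P $$ (i, j)"
  let ?T = "\<lambda>X. threshold_estimator n p k \<delta> X $$ (i, j)"
  let ?m = "n div 2"
  let ?D = "\<bar>real i - real j\<bar> / real k"
  let ?R = "if \<bar>int i - int j\<bar> \<le> int k then 1 / real n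
        else \<bar>?\<sigma>\<bar> * ?D powr \<delta> / sqrt (real n) + ?D powr (- 2) / real n"
  let ?S = "4 / \<rho> * K"
  let ?C2 = "2 powr (2 / \<delta>) * noise_const (2 + 2 / \<delta>)"
  have S: "0 \<le> ?S" using \<rho> tail_const_ge_1[of "\<rho> / 4"] by simp
  have C: "0 \<le> noise_const 2" "0 \<le> ?C2" using noise_const_nonneg by simp_all
  have A: "3 * noise_const 2 \<le> entry_const \<delta>" "?S\<^sup>2 \<le> entry_const \<delta>" "?S \<le> entry_const \<delta>"
    "4 \<le> entry_const \<delta>" "27 * ?C2 \<le> entry_const \<delta>" "0 \<le> entry_const \<delta>"
    using S C zero_le_power2[of ?S] by (auto simp: entry_const_def)
  have \<sigma>: "\<bar>?\<sigma>\<bar> \<le> ?S" by (rule cov_entry_bound[OF ij])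
  have D_ge: "1 \<le> ?D" if "\<not> \<bar>int i - int j\<bar> \<le> int k"
  proof -
    have "real_of_int (int k) \<le> real_of_int \<bar>int i - int j\<bar>" unfolding of_int_le_iff using that by linarith
    then show ?thesis using k by simp
  qed
  show ?thesis
  proof (cases "n = 1")
    case True
    then have T0: "?T X = 0" for X
      using ij by (simp add: threshold_estimator_def pair_cov_def hard_threshold_def)
    have "(\<integral>\<^sup>+X. ennreal ((?T X - ?\<sigma>)\<^sup>2) \<partial>sample) = ennreal (\<bar>?\<sigma>\<bar> * \<bar>?\<sigma>\<bar>)"
      by (simp add: T0 S.emeasure_space_1 power2_eq_square)
    also have "\<dots> \<le> ennreal (entry_const \<delta> * ?R)"
    proof (rule ennreal_leI, cases "\<bar>int i - int j\<bar> \<le> int k")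
      case near: True
      have "\<bar>?\<sigma>\<bar> * \<bar>?\<sigma>\<bar> \<le> ?S * ?S" using \<sigma> S by (intro mult_mono) auto
      then show "\<bar>?\<sigma>\<bar> * \<bar>?\<sigma>\<bar> \<le> entry_const \<delta> * ?R"
        using near True A(2) by (simp add: power2_eq_square)
    next
      \<comment> \<open>One factor \<open>\<bar>\<sigma>\<bar>\<close> is absorbed into the
        constant; the other is covered by the bias term, whose weight is at least one here.\<close>
      case far: False
      have D1: "1 \<le> ?D powr \<delta>" using D_ge[OF far] \<delta> by (intro ge_one_powr_ge_zero) auto
      have "\<bar>?\<sigma>\<bar> * \<bar>?\<sigma>\<bar> \<le> entry_const \<delta> * (\<bar>?\<sigma>\<bar> * ?D powr \<delta>)"
        using \<sigma> A(3,6) D1 mult_left_mono[OF D1, of "\<bar>?\<sigma>\<bar>"] by (intro mult_mono) auto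
      also have "\<dots> \<le> entry_const \<delta> * (\<bar>?\<sigma>\<bar> * ?D powr \<delta> + ?D powr (- 2))"
        using A(6) by (intro mult_left_mono) auto
      finally show "\<bar>?\<sigma>\<bar> * \<bar>?\<sigma>\<bar> \<le> entry_const \<delta> * ?R"
        using far True by simp
    qed
    finally show ?thesis .
  next
    case False
    then have n2: "2 \<le> n" using n by simp
    have m: "1 \<le> ?m" "2 * ?m \<le> n" using n2 by auto
    \<comment> \<open>For \<open>2 \<le> n\<close> halving with rounding keeps at least a third of
      the sample. This gives the factor 3 for \<open>1 / m\<close>; for the square root the cruder
      \<open>n \<le> 4 * m\<close> gives 2.\<close>
    have m3: "real n \<le> 3 * real ?m"
    proof -
      have "n \<le> 3 * (n div 2)" using n2 by presburger
      then show ?thesis by linarith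
    qed
    have inv: "1 / real ?m \<le> 3 / real n" using m3 m n by (simp add: field_simps)
    have inv_sqrt: "1 / sqrt (real ?m) \<le> 2 / sqrt (real n)"
    proof -
      have "sqrt (real n) \<le> sqrt (4 * real ?m)" using m3 by (intro real_sqrt_le_mono) linarith
      then show ?thesis using m n by (simp add: real_sqrt_mult field_simps)
    qed
    show ?thesis
    proof (cases "\<bar>int i - int j\<bar> \<le> int k")
      case near: True
      have "(\<integral>\<^sup>+X. ennreal ((?T X - ?\<sigma>)\<^sup>2) \<partial>sample) \<le> ennreal (noise_const 2 / real ?m)"
        using noise_sq[OF ij m] near ij by (simp add: threshold_estimator_def)
      also have "\<dots> \<le> ennreal (entry_const \<delta> * (1 / real n))"
      proof (rule ennreal_leI)
        have "noise_const 2 / real ?m \<le> noise_const 2 * (3 / real n)"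
          using mult_left_mono[OF inv C(1)] by simp
        also have "\<dots> \<le> entry_const \<delta> * (1 / real n)"
          using divide_right_mono[OF A(1), of "real n"] by (simp add: mult.commute)
        finally show "noise_const 2 / real ?m \<le> entry_const \<delta> * (1 / real n)" .
      qed
      finally show ?thesis using near by simp
    next
      case far: False
      note D = D_ge[OF far]
      define L where "L = ?D powr \<delta>"
      have L: "0 < L" unfolding L_def using D by (subst powr_gt_zero) linarith
      have Lq: "L powr (- (2 / \<delta>)) = ?D powr (- 2)" using \<delta> by (simp add: L_def powr_powr)
      let ?N = "\<lambda>X. pair_cov ?m i j X - ?\<sigma>"
      let ?ind = "\<lambda>X. if L / sqrt (real ?m) / 2 < \<bar>?N X\<bar> then (?N X)\<^sup>2 else 0"
      have T: "?T X = hard_threshold (L / sqrt (real ?m)) (pair_cov ?m i j X)" for X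
        using far ij by (simp add: threshold_estimator_def L_def)
      have [measurable]: "pair_cov ?m i j \<in> borel_measurable sample" by (rule pair_cov_sample_meas[OF ij m(2)])
      have ind_meas: "(\<lambda>X. ennreal (?ind X)) \<in> borel_measurable sample" by measurable
      have "(\<integral>\<^sup>+X. ennreal ((?T X - ?\<sigma>)\<^sup>2) \<partial>sample)
          \<le> (\<integral>\<^sup>+X. ennreal (2 * \<bar>?\<sigma>\<bar> * (L / sqrt (real ?m))) + ennreal 9 * ennreal (?ind X) \<partial>sample)"
      proof (rule nn_integral_mono)
        fix X
        have "(?T X - ?\<sigma>)\<^sup>2 \<le> 2 * \<bar>?\<sigma>\<bar> * (L / sqrt (real ?m)) + 9 * ?ind X"
          unfolding T using L by (intro hard_threshold_error) auto
        then have "ennreal ((?T X - ?\<sigma>)\<^sup>2) \<le> ennreal (2 * \<bar>?\<sigma>\<bar> * (L / sqrt (real ?m)) + 9 * ?ind X)"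
          by (rule ennreal_leI)
        also have "\<dots> = ennreal (2 * \<bar>?\<sigma>\<bar> * (L / sqrt (real ?m))) + ennreal 9 * ennreal (?ind X)"
          using L by (subst ennreal_plus, simp, simp, subst ennreal_mult, simp, simp, simp)
        finally show "ennreal ((?T X - ?\<sigma>)\<^sup>2) \<le> ennreal (2 * \<bar>?\<sigma>\<bar> * (L / sqrt (real ?m))) + ennreal 9 * ennreal (?ind X)" .
      qed
      also have "\<dots> = ennreal (2 * \<bar>?\<sigma>\<bar> * (L / sqrt (real ?m))) + ennreal 9 * (\<integral>\<^sup>+X. ennreal (?ind X) \<partial>sample)"
        by (subst nn_integral_add, simp, use ind_meas in simp, subst nn_integral_cmult, rule ind_meas)
          (simp add: S.emeasure_space_1)
      also have "\<dots> \<le> ennreal (2 * \<bar>?\<sigma>\<bar> * (L / sqrt (real ?m))) + ennreal 9 * ennreal (?C2 / real ?m * L powr (- (2 / \<delta>)))"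
        using \<delta> by (intro add_left_mono mult_left_mono noise_tail ij m L) auto
      also have "\<dots> = ennreal (2 * \<bar>?\<sigma>\<bar> * (L / sqrt (real ?m)) + 9 * (?C2 / real ?m * ?D powr (- 2)))"
        unfolding Lq using L C(2)
        by (subst ennreal_mult[symmetric], simp, simp, subst ennreal_plus, simp, simp, simp)
      also have "\<dots> \<le> ennreal (entry_const \<delta> * (\<bar>?\<sigma>\<bar> * ?D powr \<delta> / sqrt (real n) + ?D powr (- 2) / real n))"
      proof (rule ennreal_leI)
        have "2 * \<bar>?\<sigma>\<bar> * (L / sqrt (real ?m)) \<le> entry_const \<delta> * (\<bar>?\<sigma>\<bar> * ?D powr \<delta> / sqrt (real n))"
        proof -
          have "2 * \<bar>?\<sigma>\<bar> * (L / sqrt (real ?m)) = (2 * \<bar>?\<sigma>\<bar> * L) * (1 / sqrt (real ?m))" by simp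
          also have "\<dots> \<le> (2 * \<bar>?\<sigma>\<bar> * L) * (2 / sqrt (real n))"
            using L by (intro mult_left_mono inv_sqrt) auto
          also have "\<dots> = 4 * (\<bar>?\<sigma>\<bar> * L / sqrt (real n))" by simp
          also have "\<dots> \<le> entry_const \<delta> * (\<bar>?\<sigma>\<bar> * L / sqrt (real n))"
            using L by (intro mult_right_mono A(4)) auto
          finally show ?thesis by (simp only: L_def)
        qed
        moreover have "9 * (?C2 / real ?m * ?D powr (- 2)) \<le> entry_const \<delta> * (?D powr (- 2) / real n)"
        proof -
          have "9 * (?C2 / real ?m * ?D powr (- 2)) = (9 * ?C2 * ?D powr (- 2)) * (1 / real ?m)" by simp
          also have "\<dots> \<le> (9 * ?C2 * ?D powr (- 2)) * (3 / real n)"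
            using C(2) by (intro mult_left_mono inv) auto
          also have "\<dots> = 27 * ?C2 * (?D powr (- 2) / real n)" by simp
          also have "\<dots> \<le> entry_const \<delta> * (?D powr (- 2) / real n)"
            by (intro mult_right_mono A(5)) auto
          finally show ?thesis .
        qed
        ultimately show "2 * \<bar>?\<sigma>\<bar> * (L / sqrt (real ?m)) + 9 * (?C2 / real ?m * ?D powr (- 2))
            \<le> entry_const \<delta> * (\<bar>?\<sigma>\<bar> * ?D powr \<delta> / sqrt (real n) + ?D powr (- 2) / real n)"
          unfolding distrib_left by linarith
      qed
      finally show ?thesis using far by simp
    qed
  qed
qed

end

section \<open>From entrywise bounds to the minimax upper rate\<close>

lemma frobenius_risk_le:
  assumes T: "T \<in> estimators n p" and sets: "sets P = sets (vec_borel p)" and p: "1 \<le> p"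
    and b: "\<And>i j. i < p \<Longrightarrow> j < p \<Longrightarrow> 0 \<le> b i j"
    and entry: "\<And>i j. i < p \<Longrightarrow> j < p \<Longrightarrow>
      (\<integral>\<^sup>+X. ennreal ((T X $$ (i, j) - cov_matrix p P $$ (i, j))\<^sup>2) \<partial>Pi\<^sub>M {..<n} (\<lambda>_. P)) \<le> ennreal (b i j)"
    and col: "\<And>j. j < p \<Longrightarrow> (\<Sum>i<p. b i j) \<le> R"
  shows "frobenius_risk n p P T \<le> ennreal R"
proof -
  let ?S = "Pi\<^sub>M {..<n} (\<lambda>_. P)"
  let ?err = "\<lambda>i j X. (T X $$ (i, j) - cov_matrix p P $$ (i, j))\<^sup>2"
  have sets_S: "sets ?S = sets (Pi\<^sub>M {..<n} (\<lambda>_. vec_borel p))"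
    by (intro sets_PiM_cong) (auto simp: sets)
  have space_S: "space ?S = space (Pi\<^sub>M {..<n} (\<lambda>_. vec_borel p))"
    by (rule sets_eq_imp_space_eq[OF sets_S])
  have meas: "(\<lambda>X. ennreal (?err i j X)) \<in> borel_measurable ?S" if "i < p" "j < p" for i j
  proof -
    have "(\<lambda>X. T X $$ (i, j)) \<in> borel_measurable ?S"
      using T that by (subst measurable_cong_sets[OF sets_S refl]) (auto simp: estimators_def)
    then show ?thesis
      by (intro measurable_compose[OF _ measurable_ennreal] borel_measurable_power borel_measurable_diff borel_measurable_const)
  qed
  have "frobenius_risk n p P T = (\<integral>\<^sup>+X. ennreal (1 / real p) * (\<Sum>j<p. \<Sum>i<p. ennreal (?err i j X)) \<partial>?S)"
    unfolding frobenius_risk_def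
  proof (rule nn_integral_cong)
    fix X assume "X \<in> space ?S"
    then have "T X \<in> carrier_mat p p" using T by (simp add: estimators_def space_S)
    then have "(frobenius_norm (T X - cov_matrix p P))\<^sup>2 = (\<Sum>j<p. \<Sum>i<p. ?err i j X)"
      by (subst frobenius_norm_sq_diff[OF _ cov_matrix_carrier]) (auto intro: sum.swap)
    then show "ennreal (1 / real p * (frobenius_norm (T X - cov_matrix p P))\<^sup>2)
        = ennreal (1 / real p) * (\<Sum>j<p. \<Sum>i<p. ennreal (?err i j X))"
      by (simp add: sum_ennreal sum_nonneg ennreal_mult[symmetric])
  qed
  also have "\<dots> = ennreal (1 / real p) * (\<integral>\<^sup>+X. (\<Sum>j<p. \<Sum>i<p. ennreal (?err i j X)) \<partial>?S)"
    using meas by (intro nn_integral_cmult borel_measurable_sum) auto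
  also have "(\<integral>\<^sup>+X. (\<Sum>j<p. \<Sum>i<p. ennreal (?err i j X)) \<partial>?S) = (\<Sum>j<p. \<integral>\<^sup>+X. (\<Sum>i<p. ennreal (?err i j X)) \<partial>?S)"
    using meas by (intro nn_integral_sum borel_measurable_sum) auto
  also have "\<dots> = (\<Sum>j<p. \<Sum>i<p. \<integral>\<^sup>+X. ennreal (?err i j X) \<partial>?S)"
    using meas by (intro sum.cong refl nn_integral_sum) auto
  also have "ennreal (1 / real p) * \<dots> \<le> ennreal (1 / real p) * (\<Sum>j<p. \<Sum>i<p. ennreal (b i j))"
    by (intro mult_left_mono sum_mono entry) auto
  also have "(\<Sum>j<p. \<Sum>i<p. ennreal (b i j)) = (\<Sum>j<p. ennreal (\<Sum>i<p. b i j))"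
    using b by (intro sum.cong refl sum_ennreal) auto
  also have "\<dots> = ennreal (\<Sum>j<p. \<Sum>i<p. b i j)"
    using b by (intro sum_ennreal sum_nonneg) auto
  also have "ennreal (1 / real p) * \<dots> = ennreal (1 / real p * (\<Sum>j<p. \<Sum>i<p. b i j))"
    using b by (intro ennreal_mult[symmetric] sum_nonneg) auto
  also have "\<dots> \<le> ennreal R"
  proof (rule ennreal_leI)
    have "(\<Sum>j<p. \<Sum>i<p. b i j) \<le> (\<Sum>j<p. R)" by (intro sum_mono col) auto
    then have "(\<Sum>j<p. \<Sum>i<p. b i j) \<le> real p * R" by simp
    then show "1 / real p * (\<Sum>j<p. \<Sum>i<p. b i j) \<le> R" using p by (simp add: field_simps)
  qed
  finally show ?thesis .
qed

lemma minimax_risk_le: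
  assumes "T \<in> estimators n p" "\<And>P. P \<in> \<P> \<Longrightarrow> frobenius_risk n p P T \<le> R"
  shows "minimax_risk n p \<P> \<le> R"
  unfolding minimax_risk_def using assms by (intro INF_lower2[of T] SUP_least) auto

lemma F_class_tail:
  assumes S: "S \<in> F_class p \<alpha> M0 M" and j: "j < p" and k: "1 \<le> k"
  shows "(\<Sum>i | i < p \<and> \<bar>int i - int j\<bar> > int k. \<bar>S $$ (i, j)\<bar>) \<le> M * real k powr (- \<alpha>)"
proof -
  have "(\<Sum>i | i < p \<and> \<bar>int i - int j\<bar> > int k. \<bar>S $$ (i, j)\<bar>)
      \<le> (MAX j\<in>{..<p}. \<Sum>i | i < p \<and> \<bar>int i - int j\<bar> > int k. \<bar>S $$ (i, j)\<bar>)"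
    using j by (intro Max_ge) auto
  also have "\<dots> \<le> M * real k powr (- \<alpha>)"
    using S k by (simp add: F_class_def)
  finally show ?thesis .
qed

text \<open>The band contributes at most \<open>2 * k + 1 \<le> 3 * k\<close> entries. Beyond it the
  inverse squares sum to at most \<open>2 * k\<close>, by \<open>off_diagonal_powr_sum\<close> with
  exponent one, which makes \<open>5 * k\<close> in all; the bias terms are handled by
  \<open>weighted_tail_sum\<close>.\<close>

lemma entry_bound_column_sum:
  fixes x :: "nat \<Rightarrow> real"
  assumes \<alpha>: "0 < \<alpha>" and k: "1 \<le> k" and n: "1 \<le> n" and j: "j < p" and M: "0 < M"
    and tail: "\<And>k. 1 \<le> k \<Longrightarrow> (\<Sum>i | i < p \<and> \<bar>int i - int j\<bar> > int k. \<bar>x i\<bar>) \<le> M * real k powr (- \<alpha>)"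
  shows "(\<Sum>i<p. if \<bar>int i - int j\<bar> \<le> int k then 1 / real n
        else \<bar>x i\<bar> * (\<bar>real i - real j\<bar> / real k) powr (\<alpha> / 2) / sqrt (real n)
          + (\<bar>real i - real j\<bar> / real k) powr (- 2) / real n)
    \<le> 5 * real k / real n + M * 2 powr (\<alpha> / 2) / (1 - 2 powr (- (\<alpha> / 2))) * real k powr (- \<alpha>) / sqrt (real n)"
proof -
  let ?D = "\<lambda>i. \<bar>real i - real j\<bar> / real k"
  let ?I = "{i. i < p \<and> \<bar>int i - int j\<bar> > int k}"
  have eq: "{..<p} \<inter> {i. \<bar>int i - int j\<bar> \<le> int k} = {i. i < p \<and> \<bar>int i - int j\<bar> \<le> int k}"
    "{..<p} \<inter> - {i. \<bar>int i - int j\<bar> \<le> int k} = ?I" by auto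
  have "(\<Sum>i<p. if \<bar>int i - int j\<bar> \<le> int k then 1 / real n
        else \<bar>x i\<bar> * ?D i powr (\<alpha> / 2) / sqrt (real n) + ?D i powr (- 2) / real n)
      = real (card {i. i < p \<and> \<bar>int i - int j\<bar> \<le> int k}) / real n
        + ((\<Sum>i\<in>?I. \<bar>x i\<bar> * ?D i powr (\<alpha> / 2)) / sqrt (real n) + (\<Sum>i\<in>?I. ?D i powr (- 2)) / real n)"
    by (subst sum.If_cases) (simp_all add: eq sum.distrib sum_divide_distrib)
  also have "\<dots> \<le> 3 * real k / real n
        + (M * 2 powr (\<alpha> / 2) / (1 - 2 powr (- (\<alpha> / 2))) * real k powr (- \<alpha>) / sqrt (real n) + 2 * real k / real n)"
  proof (intro add_mono divide_right_mono)
    have "card {i. i < p \<and> \<bar>int i - int j\<bar> \<le> int k} \<le> 3 * k"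
      using card_band_le[of p j k] k by linarith
    then show "real (card {i. i < p \<and> \<bar>int i - int j\<bar> \<le> int k}) \<le> 3 * real k" by linarith
    show "(\<Sum>i\<in>?I. \<bar>x i\<bar> * ?D i powr (\<alpha> / 2)) \<le> M * 2 powr (\<alpha> / 2) / (1 - 2 powr (- (\<alpha> / 2))) * real k powr (- \<alpha>)"
      by (rule weighted_tail_sum[OF \<alpha> k j tail M])
    have "(\<Sum>i\<in>?I. ?D i powr (- 2)) = (\<Sum>i\<in>?I. (real k)\<^sup>2 * \<bar>real i - real j\<bar> powr (- (1 + 1)))"
      using k by (intro sum.cong refl) (simp add: powr_divide powr_minus_divide powr_numeral field_simps)
    also have "\<dots> \<le> (real k)\<^sup>2 * (2 / 1 * real k powr (- 1))"
      unfolding sum_distrib_left[symmetric] by (intro mult_left_mono off_diagonal_powr_sum k) auto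
    also have "\<dots> = 2 * real k" using k by (simp add: powr_minus_divide power2_eq_square)
    finally show "(\<Sum>i\<in>?I. ?D i powr (- 2)) \<le> 2 * real k" .
  qed auto
  finally show ?thesis by (simp add: add_divide_distrib[symmetric])
qed

lemma minimax_risk_upper_rate:
  fixes \<alpha> M0 M \<rho> :: real
  assumes pos: "0 < \<alpha>" "0 < M" "0 < \<rho>"
  obtains C where "0 < C" "\<And>n p. 1 \<le> n \<Longrightarrow> 1 \<le> p \<Longrightarrow>
    minimax_risk n p (P_class p \<alpha> M0 M \<rho>)
      \<le> ennreal (C * min (real n powr (- ((2 * \<alpha> + 1) / (2 * (\<alpha> + 1))))) (real p / real n))"
proof -
  define e where "e = 1 / (2 * (\<alpha> + 1))"
  \<comment> \<open>Outside the locale the constant takes only \<open>\<rho>\<close> as a parameter,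
    so it can be fixed before \<open>n\<close>, \<open>p\<close> and the law. The modulus and the
    \<open>1\<close> ensure positivity.\<close>
  define A where "A = \<bar>sub_gaussian_sample.entry_const \<rho> (\<alpha> / 2)\<bar> + 1"
  define B where "B = M * 2 powr (\<alpha> / 2) / (1 - 2 powr (- (\<alpha> / 2)))"
  have e: "0 < e" using pos by (simp add: e_def)
  have A: "0 < A" by (simp add: A_def)
  have "2 powr (- (\<alpha> / 2)) < (1 :: real)" using pos by (simp add: powr_less_one)
  then have B: "0 < B" using pos by (simp add: B_def)
  have main: "minimax_risk n p (P_class p \<alpha> M0 M \<rho>)
      \<le> ennreal (A * (10 + B) * min (real n powr (- ((2 * \<alpha> + 1) / (2 * (\<alpha> + 1))))) (real p / real n))"
    if n: "1 \<le> n" and p: "1 \<le> p" for n p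
  proof -
    let ?rate = "min (real n powr (- ((2 * \<alpha> + 1) / (2 * (\<alpha> + 1))))) (real p / real n)"
    define k where "k = nat \<lceil>real n powr e\<rceil>"
    have n0: "0 < real n" using n by simp
    have ne: "1 \<le> real n powr e" using n e by (intro ge_one_powr_ge_zero) auto
    have k_ge: "real n powr e \<le> real k" unfolding k_def by (rule real_nat_ceiling_ge)
    have k1: "1 \<le> k" using k_ge ne by linarith
    have k_le: "real k \<le> 2 * real n powr e"
    proof -
      have "real k = real_of_int \<lceil>real n powr e\<rceil>" using ne by (simp add: k_def)
      also have "\<dots> \<le> real n powr e + 1" by (rule of_int_ceiling_le_add_one)
      finally show ?thesis using ne by linarith
    qed
    have rate: "real n powr (- ((2 * \<alpha> + 1) / (2 * (\<alpha> + 1)))) = real n powr e / real n"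
    proof -
      have "- ((2 * \<alpha> + 1) / (2 * (\<alpha> + 1))) = e - 1" using pos by (simp add: e_def field_simps)
      then show ?thesis using n0 by (simp add: powr_diff)
    qed
    have min_eq: "?rate = min (real n powr e) (real p) / real n"
      using n0 unfolding rate by (simp add: min_divide_distrib_right)
    show ?thesis
    proof (rule minimax_risk_le)
      show "threshold_estimator n p k (\<alpha> / 2) \<in> estimators n p" by (rule threshold_estimator_in_estimators)
      fix P assume P: "P \<in> P_class p \<alpha> M0 M \<rho>"
      interpret sub_gaussian_sample n p \<rho> P
        using P pos by unfold_locales (auto simp: P_class_def)
      let ?x = "\<lambda>i j. cov_matrix p P $$ (i, j)"
      let ?b = "\<lambda>i j. if \<bar>int i - int j\<bar> \<le> int k then 1 / real n
        else \<bar>?x i j\<bar> * (\<bar>real i - real j\<bar> / real k) powr (\<alpha> / 2) / sqrt (real n)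
          + (\<bar>real i - real j\<bar> / real k) powr (- 2) / real n"
      have b: "0 \<le> ?b i j" for i j by simp
      have A_ge: "entry_const (\<alpha> / 2) \<le> A" by (simp add: A_def)
      show "frobenius_risk n p P (threshold_estimator n p k (\<alpha> / 2)) \<le> ennreal (A * (10 + B) * ?rate)"
      proof (rule frobenius_risk_le[where b = "\<lambda>i j. A * ?b i j", OF threshold_estimator_in_estimators sets_P p])
        show "0 \<le> A * ?b i j" for i j using A b[of i j] by (intro mult_nonneg_nonneg) auto
        show "(\<integral>\<^sup>+X. ennreal ((threshold_estimator n p k (\<alpha> / 2) X $$ (i, j) - ?x i j)\<^sup>2) \<partial>sample) \<le> ennreal (A * ?b i j)"
          if "i < p" "j < p" for i j
        proof -
          have "ennreal (entry_const (\<alpha> / 2) * ?b i j) \<le> ennreal (A * ?b i j)"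
            by (intro ennreal_leI mult_right_mono A_ge b)
          with threshold_entry_risk[OF that n k1, of "\<alpha> / 2"] pos show ?thesis by (meson half_gt_zero order_trans)
        qed
        fix j assume j: "j < p"
        have "(\<Sum>i<p. ?b i j) \<le> (10 + B) * ?rate"
        proof (cases "p \<le> k")
          \<comment> \<open>The band covers the whole matrix and nothing is thresholded. Since
            \<open>k\<close> is at most twice \<open>n powr e\<close>, so is \<open>p\<close>, and
            the cost \<open>p / n\<close> is of the order of the rate.\<close>
          case True
          have "(\<Sum>i<p. ?b i j) = (\<Sum>i<p. 1 / real n)"
            using True j by (intro sum.cong refl) auto
          also have "\<dots> = real p / real n" by simp
          also have "\<dots> \<le> 2 * min (real n powr e) (real p) / real n"
          proof (rule divide_right_mono)
            have "real p \<le> 2 * real n powr e" using True k_le by linarith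
            then show "real p \<le> 2 * min (real n powr e) (real p)" by (simp add: min_def)
          qed simp
          also have "\<dots> = 2 * ?rate" unfolding min_eq by simp
          also have "\<dots> \<le> (10 + B) * ?rate" using B by (intro mult_right_mono) auto
          finally show ?thesis .
        next
          case False
          then have "real n powr e \<le> real p"
          proof -
            have "\<lceil>real n powr e\<rceil> \<le> int p" using False unfolding k_def by linarith
            then show ?thesis by (simp add: ceiling_le_iff)
          qed
          then have rate_eq: "?rate = real n powr e / real n" unfolding min_eq by simp
          have "cov_matrix p P \<in> F_class p \<alpha> M0 M" using P by (simp add: P_class_def)
          from F_class_tail[OF this j]
          have "(\<Sum>i<p. ?b i j) \<le> 5 * real k / real n + B * real k powr (- \<alpha>) / sqrt (real n)"
            unfolding B_def by (intro entry_bound_column_sum pos k1 n j) auto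
          also have "\<dots> \<le> 10 * (real n powr e / real n) + B * (real n powr e / real n)"
          proof (rule add_mono)
            show "5 * real k / real n \<le> 10 * (real n powr e / real n)"
              using k_le n0 by (simp add: divide_right_mono)
            \<comment> \<open>The choice of \<open>e\<close> makes the exponent
              \<open>- e * \<alpha> - 1 / 2\<close> of the bias equal to the exponent
              \<open>e - 1\<close> of the band.\<close>
            have "real k powr (- \<alpha>) \<le> (real n powr e) powr (- \<alpha>)"
              using k_ge ne pos n0 by (intro powr_mono2') auto
            then have "real k powr (- \<alpha>) / sqrt (real n) \<le> (real n powr e) powr (- \<alpha>) / real n powr (1 / 2)"
              using n0 by (simp add: powr_half_sqrt divide_right_mono)
            also have "\<dots> = real n powr (e * - \<alpha> - 1 / 2)"
              by (simp only: powr_powr powr_diff)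
            also have "e * - \<alpha> - 1 / 2 = e - 1" using pos by (simp add: e_def field_simps)
            also have "real n powr (e - 1) = real n powr e / real n" using n0 by (simp add: powr_diff)
            finally have "B * (real k powr (- \<alpha>) / sqrt (real n)) \<le> B * (real n powr e / real n)"
              using B by (intro mult_left_mono) auto
            then show "B * real k powr (- \<alpha>) / sqrt (real n) \<le> B * (real n powr e / real n)" by simp
          qed
          also have "\<dots> = (10 + B) * ?rate" unfolding rate_eq by (simp only: distrib_right)
          finally show ?thesis .
        qed
        then have "A * (\<Sum>i<p. ?b i j) \<le> A * ((10 + B) * ?rate)" using A by (intro mult_left_mono) auto
        then show "(\<Sum>i<p. A * ?b i j) \<le> A * (10 + B) * ?rate" by (simp only: sum_distrib_left mult.assoc)
      qed
    qed
  qed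
  show ?thesis by (rule that[of "A * (10 + B)"]) (use A B main in auto)
qed

text \<open>Summing the entrywise decay over both sides of the diagonal gives at most
  \<open>2 / \<alpha>\<close> times \<open>M1 * k powr (- \<alpha>)\<close>.\<close>

lemma P'_class_subset_P_class:
  assumes \<alpha>: "0 < \<alpha>" and M1: "0 \<le> M1" "2 * M1 / \<alpha> \<le> M" and p: "1 \<le> p"
  shows "P'_class p \<alpha> M0 M1 \<rho> \<subseteq> P_class p \<alpha> M0 M \<rho>"
proof -
  have "S \<in> F_class p \<alpha> M0 M" if S: "S \<in> G_class p \<alpha> M0 M1" for S
  proof -
    have "(\<Sum>i | i < p \<and> \<bar>int i - int j\<bar> > int k. \<bar>S $$ (i, j)\<bar>) \<le> M * real k powr (- \<alpha>)"
      if j: "j < p" and k: "1 \<le> k" for j k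
    proof -
      have "(\<Sum>i | i < p \<and> \<bar>int i - int j\<bar> > int k. \<bar>S $$ (i, j)\<bar>)
          \<le> (\<Sum>i | i < p \<and> \<bar>int i - int j\<bar> > int k. M1 * \<bar>real i - real j\<bar> powr (- (\<alpha> + 1)))"
        using S j by (intro sum_mono) (auto simp: G_class_def)
      also have "\<dots> \<le> M1 * (2 / \<alpha> * real k powr (- \<alpha>))"
        unfolding sum_distrib_left[symmetric] by (intro mult_left_mono off_diagonal_powr_sum \<alpha> k M1)
      also have "\<dots> = (2 * M1 / \<alpha>) * real k powr (- \<alpha>)" by simp
      also have "\<dots> \<le> M * real k powr (- \<alpha>)" using M1 by (intro mult_right_mono) auto
      finally show ?thesis .
    qed
    then have "(MAX j\<in>{..<p}. \<Sum>i | i < p \<and> \<bar>int i - int j\<bar> > int k. \<bar>S $$ (i, j)\<bar>) \<le> M * real k powr (- \<alpha>)"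
      if "1 \<le> k" for k
      using that p by (subst Max_le_iff) (auto simp: lessThan_empty_iff)
    then show ?thesis using S by (simp add: F_class_def G_class_def)
  qed
  then show ?thesis by (auto simp: P_class_def P'_class_def)
qed

section \<open>Comparison of rates and conclusion\<close>

lemma minimax_risk_mono:
  assumes "\<P> \<subseteq> \<Q>"
  shows "minimax_risk n p \<P> \<le> minimax_risk n p \<Q>"
  unfolding minimax_risk_def using assms by (intro INF_mono' SUP_subset_mono) auto

text \<open>Both functions are compared with a positive real rate, so they are finite and positive
  and their \<open>ennreal\<close> quotient is a real one, between \<open>c1 / C2\<close> and
  \<open>C1 / c2\<close>.\<close>

lemma same_rateI:
  fixes a b :: "nat \<Rightarrow> nat \<Rightarrow> ennreal" and r :: "nat \<Rightarrow> nat \<Rightarrow> real"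
  assumes pos: "0 < c1" "0 < C1" "0 < c2" "0 < C2"
    and r: "\<And>n p. 1 \<le> n \<Longrightarrow> 1 \<le> p \<Longrightarrow> 0 < r n p"
    and a: "\<And>n p. 1 \<le> n \<Longrightarrow> 1 \<le> p \<Longrightarrow> ennreal (c1 * r n p) \<le> a n p \<and> a n p \<le> ennreal (C1 * r n p)"
    and b: "\<And>n p. 1 \<le> n \<Longrightarrow> 1 \<le> p \<Longrightarrow> ennreal (c2 * r n p) \<le> b n p \<and> b n p \<le> ennreal (C2 * r n p)"
  shows "a \<asymp> b"
proof -
  \<comment> \<open>The maximum secures \<open>c1 / C2 \<le> C\<close> directly.\<close>
  define C where "C = max (C1 / c2) (c1 / C2)"
  have bounds: "ennreal (c1 / C2) \<le> a n p / b n p \<and> a n p / b n p \<le> ennreal C" if np: "1 \<le> n" "1 \<le> p" for n p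
  proof -
    have r0: "0 < r n p" by (rule r[OF np])
    have "a n p \<noteq> \<top>" "b n p \<noteq> \<top>" using a[OF np] b[OF np] by (auto simp: top_unique)
    then obtain x y where xy: "a n p = ennreal x" "0 \<le> x" "b n p = ennreal y" "0 \<le> y"
      by (metis ennreal_cases)
    have x: "c1 * r n p \<le> x" "x \<le> C1 * r n p" and y: "c2 * r n p \<le> y" "y \<le> C2 * r n p"
      using a[OF np] b[OF np] xy r0 pos by (auto simp: ennreal_le_iff ennreal_le_iff2)
    have y0: "0 < y" using y(1) r0 pos(3) by (meson mult_pos_pos less_le_trans)
    have "c1 / C2 \<le> x / y"
    proof -
      have "c1 * y \<le> c1 * (C2 * r n p)" using y pos by (intro mult_left_mono) auto
      also have "\<dots> \<le> x * C2" using mult_left_mono[OF x(1), of C2] pos by (simp add: mult_ac)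
      finally show ?thesis using pos y0 by (simp add: field_simps)
    qed
    moreover have "x / y \<le> C1 / c2"
    proof -
      have "x * c2 \<le> (C1 * r n p) * c2" using x pos by (intro mult_right_mono) auto
      also have "\<dots> \<le> C1 * y" using mult_left_mono[OF y(1), of C1] pos by (simp add: mult_ac)
      finally show ?thesis using pos y0 by (simp add: field_simps)
    qed
    moreover have "a n p / b n p = ennreal (x / y)" using xy y0 by (simp add: divide_ennreal)
    ultimately show ?thesis by (auto intro!: ennreal_leI simp: C_def)
  qed
  show ?thesis
    unfolding same_rate_def
    using bounds pos by (intro exI[of _ "c1 / C2"] exI[of _ C]) (auto simp: C_def)
qed

theorem theorem4:
  fixes \<alpha> M0 M M1 \<rho> :: real
  assumes "\<alpha> > 0" and "M0 > 0" and "M > 0" and "M1 > 0" and "\<rho> > 0"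
  shows "(\<lambda>n p. minimax_risk n p (P_class p \<alpha> M0 M \<rho>))
           \<asymp> (\<lambda>n p. minimax_risk n p (P'_class p \<alpha> M0 M1 \<rho>))
       \<and> (\<lambda>n p. minimax_risk n p (P'_class p \<alpha> M0 M1 \<rho>))
           \<asymp> (\<lambda>n p. ennreal (min (real n powr (- ((2 * \<alpha> + 1) / (2 * (\<alpha> + 1))))) (real p / real n)))"
proof -
  let ?rate = "\<lambda>n p. min (real n powr (- ((2 * \<alpha> + 1) / (2 * (\<alpha> + 1))))) (real p / real n)"
  let ?RP = "\<lambda>n p. minimax_risk n p (P_class p \<alpha> M0 M \<rho>)"
  let ?RP' = "\<lambda>n p. minimax_risk n p (P'_class p \<alpha> M0 M1 \<rho>)"
  have rate_pos: "0 < ?rate n p" if "1 \<le> n" "1 \<le> p" for n p :: nat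
    using that by simp
  obtain c1 where c1: "0 < c1" and low': "\<And>n p. 1 \<le> n \<Longrightarrow> 1 \<le> p \<Longrightarrow> ennreal (c1 * ?rate n p) \<le> ?RP' n p"
    using minimax_risk_lower_rate[OF assms(1,2,4,5)] by blast
  \<comment> \<open>The decay constant \<open>M1\<close> for which \<open>2 * M1 / \<alpha>\<close>
    equals \<open>M\<close>, so that the smaller class lies in \<open>P_class\<close> with the given
    \<open>M\<close>.\<close>
  have "0 < \<alpha> * M / 2" using assms by simp
  from minimax_risk_lower_rate[OF assms(1,2) this assms(5)]
  obtain c2 where c2: "0 < c2" and low: "\<And>n p. 1 \<le> n \<Longrightarrow> 1 \<le> p \<Longrightarrow>
      ennreal (c2 * ?rate n p) \<le> minimax_risk n p (P'_class p \<alpha> M0 (\<alpha> * M / 2) \<rho>)"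
    by blast
  have low_P: "ennreal (c2 * ?rate n p) \<le> ?RP n p" if "1 \<le> n" "1 \<le> p" for n p
  proof -
    have "P'_class p \<alpha> M0 (\<alpha> * M / 2) \<rho> \<subseteq> P_class p \<alpha> M0 M \<rho>"
      by (rule P'_class_subset_P_class) (use assms that in auto)
    from order_trans[OF low[OF that] minimax_risk_mono[OF this]] show ?thesis .
  qed
  obtain C1 where C1: "0 < C1" and up: "\<And>n p. 1 \<le> n \<Longrightarrow> 1 \<le> p \<Longrightarrow> ?RP n p \<le> ennreal (C1 * ?rate n p)"
    using minimax_risk_upper_rate[OF assms(1,3,5), of M0] by blast
  \<comment> \<open>Conversely, this is the tail constant that the given \<open>M1\<close> leads
    to.\<close>
  have "0 < 2 * M1 / \<alpha>" using assms by simp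
  from minimax_risk_upper_rate[OF assms(1) this assms(5), of M0]
  obtain C2 where C2: "0 < C2" and up2: "\<And>n p. 1 \<le> n \<Longrightarrow> 1 \<le> p \<Longrightarrow>
      minimax_risk n p (P_class p \<alpha> M0 (2 * M1 / \<alpha>) \<rho>) \<le> ennreal (C2 * ?rate n p)"
    by blast
  have up_P': "?RP' n p \<le> ennreal (C2 * ?rate n p)" if "1 \<le> n" "1 \<le> p" for n p
  proof -
    have "P'_class p \<alpha> M0 M1 \<rho> \<subseteq> P_class p \<alpha> M0 (2 * M1 / \<alpha>) \<rho>"
      by (rule P'_class_subset_P_class) (use assms that in auto)
    from order_trans[OF minimax_risk_mono[OF this] up2[OF that]] show ?thesis .
  qed
  have "?RP \<asymp> ?RP'"
    by (rule same_rateI[OF c2 C1 c1 C2, where r = ?rate]) (simp_all only: rate_pos low_P up low' up_P')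
  moreover have "?RP' \<asymp> (\<lambda>n p. ennreal (?rate n p))"
    by (rule same_rateI[OF c1 C2, of 1 1 ?rate]) (simp_all only: rate_pos low' up_P' mult_1 order_refl zero_less_one)
  ultimately show ?thesis by blast
qed

end
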